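(* Let $X$ be an infinite countable metrizable space. Then $C_p(X)\bumpeq C_p(X)\times C_p(X)$; in particular the spaces $C_p(X)$ and $C_p(X)\times C_p(X)$ are uniformly homeomorphic.
   Context: For a Tychonoff space $X$, $C_p(X)$ is the space of all continuous real-valued functions on $X$ with the topology of pointwise convergence, equipped also with the supremum extended norm $\|f\|=\sup_{x\in X}|f(x)|\in[0,\infty]$. An extended norm on a real vector space $E$ is a function $\|\cdot\|:E\to[0,\infty]$ with $\|x\|=0$ iff $x=0$, $\|ax\|=|a|\|x\|$ (with $0\cdot\infty=0$), and $\|x+y\|\le\|x\|+\|y\|$. A product of linear topological spaces with extended norms carries the product topology and the extended norm given by the supremum of the extended norms of the coordinates. A uniform homeomorphism between topological vector spaces is a bijection that is uniformly continuous together with its inverse, with respect to the natural (additive) uniformities: $u:E\to F$ is uniformly continuous if for each neighborhood $U$ of $0$ in $F$ there is a neighborhood $V$ of $0$ in $E$ such that $f-g\in V$ implies $u(f)-u(g)\in U$. For linear topological spaces $E,F$ with extended norms $\|\cdot\|_1,\|\cdot\|_2$ (not necessarily related to the topologies), $E\bumpeq F$ means: for every $\varepsilon>0$ there is a uniform homeomorphism $u_\varepsilon:E\to F$ (with respect to the topologies) such that $(1+\varepsilon)^{-1}\|f\|_1\le\|u_\varepsilon(f)\|_2\le\|f\|_1$ for every $f\in E$. *)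

theory Defs
  imports "HOL-Analysis.Analysis"
begin

section \<open>Linear topological spaces with an extended norm\<close>

text \<open>The underlying set of \<open>E\<close> is the \<^const>\<open>topspace\<close> of its topology. Nothing links the norm to
  the topology.\<close>

record 'a ext_lts =
  lts_top :: "'a topology"
  lts_zero :: 'a
  lts_add :: "'a \<Rightarrow> 'a \<Rightarrow> 'a"
  lts_scale :: "real \<Rightarrow> 'a \<Rightarrow> 'a"
  lts_norm :: "'a \<Rightarrow> ennreal"

abbreviation lts_carrier :: "'a ext_lts \<Rightarrow> 'a set"
  where "lts_carrier E \<equiv> topspace (lts_top E)"

definition lts_minus :: "'a ext_lts \<Rightarrow> 'a \<Rightarrow> 'a \<Rightarrow> 'a"
  where "lts_minus E x y = lts_add E x (lts_scale E (- 1) y)"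

locale ext_normed_lts =
  fixes E :: "'a ext_lts"
  assumes zero_closed: "lts_zero E \<in> lts_carrier E"
    and add_assoc: "\<lbrakk>x \<in> lts_carrier E; y \<in> lts_carrier E; z \<in> lts_carrier E\<rbrakk> \<Longrightarrow>
      lts_add E (lts_add E x y) z = lts_add E x (lts_add E y z)"
    and add_commute: "\<lbrakk>x \<in> lts_carrier E; y \<in> lts_carrier E\<rbrakk> \<Longrightarrow> lts_add E x y = lts_add E y x"
    and add_zero: "x \<in> lts_carrier E \<Longrightarrow> lts_add E x (lts_zero E) = x"
    and add_neg: "x \<in> lts_carrier E \<Longrightarrow> lts_add E x (lts_scale E (- 1) x) = lts_zero E"
    and scale_add: "\<lbrakk>x \<in> lts_carrier E; y \<in> lts_carrier E\<rbrakk> \<Longrightarrow>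
      lts_scale E a (lts_add E x y) = lts_add E (lts_scale E a x) (lts_scale E a y)"
    and add_scale: "x \<in> lts_carrier E \<Longrightarrow>
      lts_scale E (a + b) x = lts_add E (lts_scale E a x) (lts_scale E b x)"
    and scale_scale: "x \<in> lts_carrier E \<Longrightarrow> lts_scale E a (lts_scale E b x) = lts_scale E (a * b) x"
    and scale_one: "x \<in> lts_carrier E \<Longrightarrow> lts_scale E 1 x = x"
    and continuous_add: "continuous_map (prod_topology (lts_top E) (lts_top E)) (lts_top E)
      (\<lambda>(x, y). lts_add E x y)"
    and continuous_scale: "continuous_map (prod_topology euclideanreal (lts_top E)) (lts_top E)
      (\<lambda>(a, x). lts_scale E a x)"
    and norm_eq_zero: "x \<in> lts_carrier E \<Longrightarrow> lts_norm E x = 0 \<longleftrightarrow> x = lts_zero E"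
    and norm_scale: "x \<in> lts_carrier E \<Longrightarrow> lts_norm E (lts_scale E a x) = ennreal \<bar>a\<bar> * lts_norm E x"
    and norm_triangle: "\<lbrakk>x \<in> lts_carrier E; y \<in> lts_carrier E\<rbrakk> \<Longrightarrow>
      lts_norm E (lts_add E x y) \<le> lts_norm E x + lts_norm E y"

definition lts_prod :: "'a ext_lts \<Rightarrow> 'b ext_lts \<Rightarrow> ('a \<times> 'b) ext_lts"
  where "lts_prod E F =
    \<lparr>lts_top = prod_topology (lts_top E) (lts_top F),
     lts_zero = (lts_zero E, lts_zero F),
     lts_add = (\<lambda>(x, y) (x', y'). (lts_add E x x', lts_add F y y')),
     lts_scale = (\<lambda>a (x, y). (lts_scale E a x, lts_scale F a y)),
     lts_norm = (\<lambda>(x, y). sup (lts_norm E x) (lts_norm F y))\<rparr>"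

lemma ext_normed_lts_prod:
  assumes "ext_normed_lts E" "ext_normed_lts F"
  shows "ext_normed_lts (lts_prod E F)"
proof -
  interpret E: ext_normed_lts E by fact
  interpret F: ext_normed_lts F by fact
  let ?T = "prod_topology (lts_top E) (lts_top F)"
  have p: "continuous_map ?T (lts_top E) fst" "continuous_map ?T (lts_top F) snd"
    by (auto intro: continuous_map_fst continuous_map_snd)
  show ?thesis
  proof
    have "continuous_map (prod_topology ?T ?T) (lts_top E)
        (\<lambda>p. lts_add E (fst (fst p)) (fst (snd p)))"
      using continuous_map_compose[OF continuous_map_pairedI E.continuous_add,
        OF continuous_map_compose[OF continuous_map_fst p(1)]
          continuous_map_compose[OF continuous_map_snd p(1)]]
      by (simp add: o_def)
    moreover have "continuous_map (prod_topology ?T ?T) (lts_top F)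
        (\<lambda>p. lts_add F (snd (fst p)) (snd (snd p)))"
      using continuous_map_compose[OF continuous_map_pairedI F.continuous_add,
        OF continuous_map_compose[OF continuous_map_fst p(2)]
          continuous_map_compose[OF continuous_map_snd p(2)]]
      by (simp add: o_def)
    ultimately show "continuous_map (prod_topology (lts_top (lts_prod E F)) (lts_top (lts_prod E F)))
        (lts_top (lts_prod E F)) (\<lambda>(x, y). lts_add (lts_prod E F) x y)"
      by (simp add: lts_prod_def case_prod_unfold continuous_map_pairedI)
    have "continuous_map (prod_topology euclideanreal ?T) (lts_top E)
        (\<lambda>p. lts_scale E (fst p) (fst (snd p)))"
      using continuous_map_compose[OF continuous_map_pairedI E.continuous_scale,
        OF continuous_map_fst continuous_map_compose[OF continuous_map_snd p(1)]]
      by (simp add: o_def)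
    moreover have "continuous_map (prod_topology euclideanreal ?T) (lts_top F)
        (\<lambda>p. lts_scale F (fst p) (snd (snd p)))"
      using continuous_map_compose[OF continuous_map_pairedI F.continuous_scale,
        OF continuous_map_fst continuous_map_compose[OF continuous_map_snd p(2)]]
      by (simp add: o_def)
    ultimately show "continuous_map (prod_topology euclideanreal (lts_top (lts_prod E F)))
        (lts_top (lts_prod E F)) (\<lambda>(a, x). lts_scale (lts_prod E F) a x)"
      by (simp add: lts_prod_def case_prod_unfold continuous_map_pairedI)
    show "lts_norm (lts_prod E F) x = 0 \<longleftrightarrow> x = lts_zero (lts_prod E F)"
      if "x \<in> lts_carrier (lts_prod E F)" for x
      using that E.norm_eq_zero F.norm_eq_zero
      by (auto simp: lts_prod_def sup_eq_bot_iff simp flip: bot_ennreal)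
    show "lts_norm (lts_prod E F) (lts_scale (lts_prod E F) a x)
        = ennreal \<bar>a\<bar> * lts_norm (lts_prod E F) x"
      if "x \<in> lts_carrier (lts_prod E F)" for a x
    proof -
      have "mono ((*) (ennreal \<bar>a\<bar>))"
        by (simp add: mono_def mult_left_mono)
      then show ?thesis
        using that E.norm_scale F.norm_scale
        by (auto simp: lts_prod_def sup_max max_of_mono)
    qed
    show "lts_norm (lts_prod E F) (lts_add (lts_prod E F) x y)
        \<le> lts_norm (lts_prod E F) x + lts_norm (lts_prod E F) y"
      if "x \<in> lts_carrier (lts_prod E F)" "y \<in> lts_carrier (lts_prod E F)" for x y
      using that E.norm_triangle[of "fst x" "fst y"] F.norm_triangle[of "snd x" "snd y"]
      by (auto simp: lts_prod_def case_prod_unfold intro: order_trans[OF _ add_mono])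
  qed (auto simp: lts_prod_def E.zero_closed F.zero_closed E.add_assoc F.add_assoc
      E.add_commute F.add_commute E.add_zero F.add_zero E.add_neg F.add_neg E.scale_add F.scale_add
      E.add_scale F.add_scale E.scale_scale F.scale_scale E.scale_one F.scale_one)
qed


section \<open>Uniform homeomorphisms\<close>

definition lts_uniformly_continuous :: "'a ext_lts \<Rightarrow> 'b ext_lts \<Rightarrow> ('a \<Rightarrow> 'b) \<Rightarrow> bool"
  where "lts_uniformly_continuous E F u \<longleftrightarrow>
    u \<in> lts_carrier E \<rightarrow> lts_carrier F \<and>
    (\<forall>U. openin (lts_top F) U \<and> lts_zero F \<in> U \<longrightarrow>
      (\<exists>V. openin (lts_top E) V \<and> lts_zero E \<in> V \<and>
        (\<forall>f\<in>lts_carrier E. \<forall>g\<in>lts_carrier E.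
          lts_minus E f g \<in> V \<longrightarrow> lts_minus F (u f) (u g) \<in> U)))"

definition lts_uniform_homeomorphism :: "'a ext_lts \<Rightarrow> 'b ext_lts \<Rightarrow> ('a \<Rightarrow> 'b) \<Rightarrow> bool"
  where "lts_uniform_homeomorphism E F u \<longleftrightarrow>
    bij_betw u (lts_carrier E) (lts_carrier F) \<and>
    lts_uniformly_continuous E F u \<and>
    lts_uniformly_continuous F E (inv_into (lts_carrier E) u)"

definition lts_uniformly_homeomorphic :: "'a ext_lts \<Rightarrow> 'b ext_lts \<Rightarrow> bool"
  where "lts_uniformly_homeomorphic E F \<longleftrightarrow> (\<exists>u. lts_uniform_homeomorphism E F u)"

definition lts_bumpeq :: "'a ext_lts \<Rightarrow> 'b ext_lts \<Rightarrow> bool"  (infix \<open>\<bumpeq>\<close> 50)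
  where "E \<bumpeq> F \<longleftrightarrow>
    (\<forall>\<epsilon>::real. \<epsilon> > 0 \<longrightarrow>
      (\<exists>u. lts_uniform_homeomorphism E F u \<and>
        (\<forall>f\<in>lts_carrier E.
          ennreal (inverse (1 + \<epsilon>)) * lts_norm E f \<le> lts_norm F (u f) \<and>
          lts_norm F (u f) \<le> lts_norm E f)))"


section \<open>Function spaces with the topology of pointwise convergence\<close>

text \<open>A function on \<open>X\<close> is represented by its extension with value \<^const>\<open>undefined\<close> outside
  \<open>topspace X\<close>; this is the convention of \<^const>\<open>product_topology\<close>, whose points are extensional.\<close>

definition Cp :: "'a topology \<Rightarrow> ('a \<Rightarrow> real) ext_lts"
  where "Cp X =
    \<lparr>lts_top = subtopology (product_topology (\<lambda>_. euclideanreal) (topspace X))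
       {f. continuous_map X euclideanreal f},
     lts_zero = (\<lambda>x\<in>topspace X. 0),
     lts_add = (\<lambda>f g. \<lambda>x\<in>topspace X. f x + g x),
     lts_scale = (\<lambda>a f. \<lambda>x\<in>topspace X. a * f x),
     lts_norm = (\<lambda>f. SUP x\<in>topspace X. ennreal \<bar>f x\<bar>)\<rparr>"

lemma lts_carrier_Cp:
  "lts_carrier (Cp X) = {f \<in> extensional (topspace X). continuous_map X euclideanreal f}"
  by (auto simp: Cp_def PiE_def)

lemma continuous_map_restrict_iff:
  "continuous_map X Y (restrict f (topspace X)) \<longleftrightarrow> continuous_map X Y f"
  by (rule iffI; erule continuous_map_eq) auto

lemma ext_normed_lts_Cp: "ext_normed_lts (Cp X)"
proof
  let ?P = "product_topology (\<lambda>_. euclideanreal) (topspace X)"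
  let ?C = "{f. continuous_map X euclideanreal f}"
  have ext: "f \<in> extensional (topspace X)" "continuous_map X euclideanreal f"
    if "f \<in> lts_carrier (Cp X)" for f
    using that by (auto simp: lts_carrier_Cp)
  note eqI = extensionalityI[where A = "topspace X"]
  show "lts_zero (Cp X) \<in> lts_carrier (Cp X)"
    unfolding lts_carrier_Cp by (simp add: Cp_def continuous_map_restrict_iff)
  show "lts_add (Cp X) x (lts_zero (Cp X)) = x" if "x \<in> lts_carrier (Cp X)" for x
    using ext[OF that] by (intro eqI) (auto simp: Cp_def)
  show "lts_scale (Cp X) 1 x = x" if "x \<in> lts_carrier (Cp X)" for x
    using ext[OF that] by (intro eqI) (auto simp: Cp_def)
  have ev: "continuous_map (lts_top (Cp X)) euclideanreal (\<lambda>f. f i)" if "i \<in> topspace X" for i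
    using continuous_map_from_subtopology[OF continuous_map_product_projection[OF that]]
    by (simp add: Cp_def)
  show "continuous_map (prod_topology (lts_top (Cp X)) (lts_top (Cp X))) (lts_top (Cp X))
      (\<lambda>(x, y). lts_add (Cp X) x y)"
  proof -
    have "continuous_map (prod_topology (lts_top (Cp X)) (lts_top (Cp X))) euclideanreal
        (\<lambda>p. fst p i + snd p i)" if "i \<in> topspace X" for i
      by (intro continuous_intros continuous_map_compose[OF continuous_map_fst ev[OF that], unfolded o_def]
          continuous_map_compose[OF continuous_map_snd ev[OF that], unfolded o_def])
    then have "continuous_map (prod_topology (lts_top (Cp X)) (lts_top (Cp X))) ?P
        (\<lambda>(x, y). lts_add (Cp X) x y)"
      by (auto simp: continuous_map_componentwise Cp_def case_prod_unfold)
    moreover have "lts_add (Cp X) x y \<in> ?C" if "x \<in> lts_carrier (Cp X)" "y \<in> lts_carrier (Cp X)" for x y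
      using ext[OF that(1)] ext[OF that(2)]
      by (auto simp: Cp_def continuous_map_restrict_iff intro!: continuous_intros)
    ultimately show ?thesis
      by (subst (3) Cp_def) (auto simp: continuous_map_in_subtopology)
  qed
  show "continuous_map (prod_topology euclideanreal (lts_top (Cp X))) (lts_top (Cp X))
      (\<lambda>(a, x). lts_scale (Cp X) a x)"
  proof -
    have "continuous_map (prod_topology euclideanreal (lts_top (Cp X))) euclideanreal
        (\<lambda>p. fst p * snd p i)" if "i \<in> topspace X" for i
      by (intro continuous_intros continuous_map_fst
          continuous_map_compose[OF continuous_map_snd ev[OF that], unfolded o_def])
    then have "continuous_map (prod_topology euclideanreal (lts_top (Cp X))) ?P
        (\<lambda>(a, x). lts_scale (Cp X) a x)"
      by (auto simp: continuous_map_componentwise Cp_def case_prod_unfold)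
    moreover have "lts_scale (Cp X) a x \<in> ?C" if "x \<in> lts_carrier (Cp X)" for a x
      using ext[OF that]
      by (auto simp: Cp_def continuous_map_restrict_iff intro!: continuous_intros)
    ultimately show ?thesis
      by (subst (2) Cp_def) (auto simp: continuous_map_in_subtopology)
  qed
  show "lts_norm (Cp X) x = 0 \<longleftrightarrow> x = lts_zero (Cp X)" if "x \<in> lts_carrier (Cp X)" for x
  proof
    assume "lts_norm (Cp X) x = 0"
    then have "\<forall>i\<in>topspace X. ennreal \<bar>x i\<bar> = bot"
      by (simp add: Cp_def SUP_bot_conv flip: bot_ennreal)
    then have "x i = 0" if "i \<in> topspace X" for i
      using that by (simp add: bot_ennreal)
    then show "x = lts_zero (Cp X)"
      using ext[OF that] by (intro eqI) (auto simp: Cp_def)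
  qed (auto simp: Cp_def bot_ennreal[symmetric] SUP_bot_conv)
  show "lts_norm (Cp X) (lts_scale (Cp X) a x) = ennreal \<bar>a\<bar> * lts_norm (Cp X) x" for a x
    by (simp add: Cp_def SUP_mult_left_ennreal abs_mult ennreal_mult)
  show "lts_norm (Cp X) (lts_add (Cp X) x y) \<le> lts_norm (Cp X) x + lts_norm (Cp X) y" for x y
  proof -
    have "ennreal \<bar>x i + y i\<bar> \<le> (SUP i\<in>topspace X. ennreal \<bar>x i\<bar>) + (SUP i\<in>topspace X. ennreal \<bar>y i\<bar>)"
      if "i \<in> topspace X" for i
    proof -
      have "ennreal \<bar>x i + y i\<bar> \<le> ennreal \<bar>x i\<bar> + ennreal \<bar>y i\<bar>"
        by (simp flip: ennreal_plus)
      also have "\<dots> \<le> (SUP i\<in>topspace X. ennreal \<bar>x i\<bar>) + (SUP i\<in>topspace X. ennreal \<bar>y i\<bar>)"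
        by (intro add_mono SUP_upper that)
      finally show ?thesis .
    qed
    then show ?thesis
      by (auto simp: Cp_def intro!: SUP_least)
  qed
qed (auto simp: Cp_def algebra_simps fun_eq_iff restrict_def)

end

theory Submission
  imports Defs
begin

text \<open>
  All spaces that occur are sets \<open>C\<close> of real functions on some index set, with the uniformity of
  pointwise convergence and the supremum norm; \<open>C \<simeq> D\<close> says that for every \<open>c > 1\<close> there is a
  uniform homeomorphism that changes norms by a factor of at most \<open>c\<close> in either direction. Uniform
  homeomorphisms need not be linear, and this is the source of everything. If \<open>A\<close> is a retract of
  \<open>X\<close> under \<open>r\<close>, the linear splitting \<open>f \<mapsto> (f | A, f - f \<circ> r)\<close> of \<open>C(X)\<close> may double the norm. But the
  subtraction \<open>t \<mapsto> t - s\<close> can be replaced by an increasing bijection of the line that still sends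
  \<open>s\<close> to \<open>0\<close> and is the identity far away from \<open>s\<close>, measured on the scale of \<open>\<bar>s\<bar>\<close>. This gives
  \<open>C(X) \<simeq> C(A) \<oplus> {f. f = 0 on A}\<close> (\<open>cfun_split_retract\<close>).

  Call a clopen set good if each of its clopen subsets \<open>V\<close> is finite or has a function space that
  absorbs a copy of itself and a copy of the scalars. A clopen set is good if it is a disjoint union of
  good sets, or if it becomes one, with pieces converging to \<open>p\<close>, when a point \<open>p\<close> is removed: its function
  space is the product over the pieces, or one scalar plus their \<open>c\<^sub>0\<close>-sum (\<open>glued_dichotomy\<close>).
  Let \<open>K\<close> be the complement of the union of all good sets. An isolated point of \<open>K\<close> would have a good neighbourhood, so \<open>K\<close> has none
  (\<open>crowded_kernel_or_self_absorbing\<close>).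

  If \<open>K\<close> is empty, then \<open>X\<close> itself is a union of good sets and \<open>C(X) \<simeq> C(X) \<oplus> C(X)\<close>. Otherwise \<open>X\<close>
  contains a nonempty closed set without isolated points, and then every nonempty countable metrizable
  space is a retract of \<open>X\<close> (\<open>countable_retract_of_crowded\<close>), in particular \<open>\<nat> \<times> X\<close>. Hence
  \<open>E = C(X)\<close> satisfies \<open>E \<simeq> E\<^sup>\<nat> \<oplus> H\<close> for some \<open>H\<close>, and Pelczynski's decomposition argument
  gives \<open>E \<oplus> E \<simeq> (E \<oplus> E\<^sup>\<nat>) \<oplus> H \<simeq> E\<^sup>\<nat> \<oplus> H \<simeq> E\<close>.
\<close>

section \<open>Almost isometric equivalence of spaces of functions\<close>

text \<open>Uniform continuity for the uniformities of pointwise convergence, spelled out on basic entourages: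
  it suffices to control one coordinate of the value at a time.\<close>

definition pointwise_ucont :: "('i \<Rightarrow> real) set \<Rightarrow> (('i \<Rightarrow> real) \<Rightarrow> 'j \<Rightarrow> real) \<Rightarrow> bool"
  where "pointwise_ucont C u \<longleftrightarrow>
    (\<forall>j. \<forall>\<epsilon>>0. \<exists>I \<delta>. finite I \<and> \<delta> > 0 \<and>
      (\<forall>f\<in>C. \<forall>g\<in>C. (\<forall>i\<in>I. \<bar>f i - g i\<bar> < \<delta>) \<longrightarrow> \<bar>u f j - u g j\<bar> < \<epsilon>))"

text \<open>The Lipschitz-type bound \<open>\<parallel>u f\<parallel> \<le> c \<parallel>f\<parallel>\<close>, phrased with finite upper bounds of the norms so that
  functions of infinite norm need no separate treatment.\<close>

definition sup_bounded :: "real \<Rightarrow> ('i \<Rightarrow> real) set \<Rightarrow> (('i \<Rightarrow> real) \<Rightarrow> 'j \<Rightarrow> real) \<Rightarrow> bool"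
  where "sup_bounded c C u \<longleftrightarrow>
    (\<forall>f\<in>C. \<forall>M. (\<forall>i. \<bar>f i\<bar> \<le> M) \<longrightarrow> (\<forall>j. \<bar>u f j\<bar> \<le> c * M))"

definition near_isometry ::
  "real \<Rightarrow> ('i \<Rightarrow> real) set \<Rightarrow> ('j \<Rightarrow> real) set \<Rightarrow>
    (('i \<Rightarrow> real) \<Rightarrow> 'j \<Rightarrow> real) \<Rightarrow> (('j \<Rightarrow> real) \<Rightarrow> 'i \<Rightarrow> real) \<Rightarrow> bool"
  where "near_isometry c C D u v \<longleftrightarrow>
    u \<in> C \<rightarrow> D \<and> v \<in> D \<rightarrow> C \<and> (\<forall>f\<in>C. v (u f) = f) \<and> (\<forall>g\<in>D. u (v g) = g) \<and>
    pointwise_ucont C u \<and> pointwise_ucont D v \<and> sup_bounded c C u \<and> sup_bounded c D v"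

definition almost_isometric :: "('i \<Rightarrow> real) set \<Rightarrow> ('j \<Rightarrow> real) set \<Rightarrow> bool"  (infix \<open>\<simeq>\<close> 50)
  where "C \<simeq> D \<longleftrightarrow> (\<forall>c>1. \<exists>u v. near_isometry c C D u v)"

lemma pointwise_ucontI:
  assumes "\<And>j \<epsilon>. \<epsilon> > 0 \<Longrightarrow> \<exists>I \<delta>. finite I \<and> \<delta> > 0 \<and>
      (\<forall>f\<in>C. \<forall>g\<in>C. (\<forall>i\<in>I. \<bar>f i - g i\<bar> < \<delta>) \<longrightarrow> \<bar>u f j - u g j\<bar> < \<epsilon>)"
  shows "pointwise_ucont C u"
  using assms unfolding pointwise_ucont_def by blast

lemma pointwise_ucontD:
  assumes "pointwise_ucont C u" "\<epsilon> > 0"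
  shows "\<exists>I \<delta>. finite I \<and> \<delta> > 0 \<and>
      (\<forall>f\<in>C. \<forall>g\<in>C. (\<forall>i\<in>I. \<bar>f i - g i\<bar> < \<delta>) \<longrightarrow> \<bar>u f j - u g j\<bar> < \<epsilon>)"
  using assms unfolding pointwise_ucont_def by blast

lemma pointwise_ucont_compose:
  assumes u: "pointwise_ucont C u" and w: "pointwise_ucont D w" and "u \<in> C \<rightarrow> D"
  shows "pointwise_ucont C (w \<circ> u)"
proof (rule pointwise_ucontI)
  fix j and \<epsilon> :: real assume "\<epsilon> > 0"
  from pointwise_ucontD[OF w this, of j] obtain I \<delta> where I: "finite I" "\<delta> > 0"
    "\<forall>f\<in>D. \<forall>g\<in>D. (\<forall>i\<in>I. \<bar>f i - g i\<bar> < \<delta>) \<longrightarrow> \<bar>w f j - w g j\<bar> < \<epsilon>"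
    by blast
  obtain K \<eta> where K: "\<And>i. finite (K i)" "\<And>i. \<eta> i > (0::real)"
    "\<And>i. \<forall>f\<in>C. \<forall>g\<in>C. (\<forall>k\<in>K i. \<bar>f k - g k\<bar> < \<eta> i) \<longrightarrow> \<bar>u f i - u g i\<bar> < \<delta>"
    using pointwise_ucontD[OF u I(2)] by metis
  define \<eta>' where "\<eta>' = Min (insert 1 (\<eta> ` I))"
  have \<eta>': "\<eta>' > 0" "\<And>i. i \<in> I \<Longrightarrow> \<eta>' \<le> \<eta> i"
    using K(2) I(1) by (auto simp: \<eta>'_def)
  have "\<bar>(w \<circ> u) f j - (w \<circ> u) g j\<bar> < \<epsilon>"
    if fg: "f \<in> C" "g \<in> C" and d: "\<forall>k\<in>(\<Union>i\<in>I. K i). \<bar>f k - g k\<bar> < \<eta>'" for f g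
  proof -
    have "\<bar>u f i - u g i\<bar> < \<delta>" if i: "i \<in> I" for i
    proof -
      have "\<bar>f k - g k\<bar> < \<eta> i" if "k \<in> K i" for k
        using d i that \<eta>'(2)[OF i] by (meson UN_I less_le_trans)
      then show ?thesis using K(3) fg by blast
    qed
    moreover have "u f \<in> D" "u g \<in> D" using fg assms(3) by auto
    ultimately show ?thesis using I(3) by simp
  qed
  then show "\<exists>I \<delta>. finite I \<and> \<delta> > 0 \<and>
      (\<forall>f\<in>C. \<forall>g\<in>C. (\<forall>i\<in>I. \<bar>f i - g i\<bar> < \<delta>) \<longrightarrow> \<bar>(w \<circ> u) f j - (w \<circ> u) g j\<bar> < \<epsilon>)"
    using I(1) K(1) \<eta>'(1) by (intro exI[of _ "\<Union>i\<in>I. K i"] exI[of _ \<eta>']) blast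
qed

lemma sup_boundedD:
  assumes "sup_bounded c C u" "f \<in> C" "\<And>i. \<bar>f i\<bar> \<le> M"
  shows "\<bar>u f j\<bar> \<le> c * M"
  using assms by (simp add: sup_bounded_def)

lemma sup_bounded_compose:
  assumes "sup_bounded c C u" "sup_bounded d D w" "u \<in> C \<rightarrow> D"
  shows "sup_bounded (d * c) C (w \<circ> u)"
  unfolding sup_bounded_def
proof (intro ballI allI impI)
  fix f M j assume f: "f \<in> C" "\<forall>i. \<bar>f i\<bar> \<le> M"
  then have "\<forall>j. \<bar>u f j\<bar> \<le> c * M" "u f \<in> D"
    using assms(1,3) by (auto simp: sup_bounded_def)
  then show "\<bar>(w \<circ> u) f j\<bar> \<le> d * c * M"
    using assms(2) by (simp add: sup_bounded_def mult.assoc)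
qed

lemma near_isometry_sym: "near_isometry c C D u v \<Longrightarrow> near_isometry c D C v u"
  by (auto simp: near_isometry_def)

lemma almost_isometricE:
  assumes "C \<simeq> D" "c > 1"
  obtains u v where "near_isometry c C D u v"
  using assms by (auto simp: almost_isometric_def)

lemma almost_isometricI:
  assumes "\<And>c. c > 1 \<Longrightarrow> \<exists>u v. near_isometry c C D u v"
  shows "C \<simeq> D"
  using assms by (simp add: almost_isometric_def)

lemma almost_isometric_sym: "C \<simeq> D \<Longrightarrow> D \<simeq> C"
  by (meson almost_isometricE almost_isometricI near_isometry_sym)

lemma almost_isometric_trans [trans]:
  assumes "C \<simeq> D" "D \<simeq> E"
  shows "C \<simeq> E"
proof (rule almost_isometricI)
  fix c :: real assume "c > 1"
  \<comment> \<open>The factors multiply under composition, so each of the two maps gets half of the allowance.\<close>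
  then have "sqrt c > 1" by simp
  obtain u v where 1: "near_isometry (sqrt c) C D u v"
    using assms(1) \<open>sqrt c > 1\<close> by (rule almost_isometricE)
  obtain u' v' where 2: "near_isometry (sqrt c) D E u' v'"
    using assms(2) \<open>sqrt c > 1\<close> by (rule almost_isometricE)
  have u: "u \<in> C \<rightarrow> D" "pointwise_ucont C u" "sup_bounded (sqrt c) C u"
    and v: "v \<in> D \<rightarrow> C" "pointwise_ucont D v" "sup_bounded (sqrt c) D v"
    and uv: "\<And>f. f \<in> C \<Longrightarrow> v (u f) = f" "\<And>g. g \<in> D \<Longrightarrow> u (v g) = g"
    using 1 by (auto simp: near_isometry_def)
  have u': "u' \<in> D \<rightarrow> E" "pointwise_ucont D u'" "sup_bounded (sqrt c) D u'"
    and v': "v' \<in> E \<rightarrow> D" "pointwise_ucont E v'" "sup_bounded (sqrt c) E v'"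
    and uv': "\<And>f. f \<in> D \<Longrightarrow> v' (u' f) = f" "\<And>g. g \<in> E \<Longrightarrow> u' (v' g) = g"
    using 2 by (auto simp: near_isometry_def)
  have c: "sqrt c * sqrt c = c"
    using \<open>c > 1\<close> by simp
  have "near_isometry c C E (u' \<circ> u) (v \<circ> v')"
    unfolding near_isometry_def
  proof (intro conjI ballI)
    show "pointwise_ucont C (u' \<circ> u)" "pointwise_ucont E (v \<circ> v')"
      using u v u' v' by (auto intro: pointwise_ucont_compose)
    show "sup_bounded c C (u' \<circ> u)" "sup_bounded c E (v \<circ> v')"
      using sup_bounded_compose[OF u(3) u'(3) u(1)] sup_bounded_compose[OF v'(3) v(3) v'(1)] c
      by simp_all
  qed (use u(1) v(1) u'(1) v'(1) uv uv' in \<open>auto simp: Pi_iff\<close>)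
  then show "\<exists>u v. near_isometry c C E u v" by blast
qed

text \<open>Maps that only permute, repeat, drop or zero-fill coordinates. They are pointwise uniformly
  continuous and do not increase the supremum norm, so every bijection of this kind in both directions
  is an equivalence; all the purely formal rearrangements below are of this form.\<close>

definition coordinatewise :: "('i \<Rightarrow> real) set \<Rightarrow> (('i \<Rightarrow> real) \<Rightarrow> 'j \<Rightarrow> real) \<Rightarrow> bool"
  where "coordinatewise C u \<longleftrightarrow> (\<forall>j. (\<forall>f\<in>C. u f j = 0) \<or> (\<exists>i. \<forall>f\<in>C. u f j = f i))"

lemma coordinatewiseI:
  assumes "\<And>j. (\<forall>f\<in>C. u f j = 0) \<or> (\<exists>i. \<forall>f\<in>C. u f j = f i)"
  shows "coordinatewise C u"
  using assms by (auto simp: coordinatewise_def)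

lemma coordinatewise_reindex:
  assumes "\<And>f j. f \<in> C \<Longrightarrow> u f j = f (\<sigma> j)"
  shows "coordinatewise C u"
  using assms by (auto simp: coordinatewise_def)

lemma coordinatewise_reindex_partial:
  assumes "\<And>f j. f \<in> C \<Longrightarrow> u f j = (if P j then f (\<sigma> j) else 0)"
  shows "coordinatewise C u"
proof (rule coordinatewiseI)
  fix j
  show "(\<forall>f\<in>C. u f j = 0) \<or> (\<exists>i. \<forall>f\<in>C. u f j = f i)"
    by (cases "P j") (use assms in auto)
qed

lemma coordinatewise_ucont:
  assumes "coordinatewise C u"
  shows "pointwise_ucont C u"
proof (rule pointwise_ucontI)
  fix j and \<epsilon> :: real assume "\<epsilon> > 0"
  consider "\<forall>f\<in>C. u f j = 0" | i where "\<forall>f\<in>C. u f j = f i"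
    using assms unfolding coordinatewise_def by blast
  then show "\<exists>I \<delta>. finite I \<and> \<delta> > 0 \<and>
      (\<forall>f\<in>C. \<forall>g\<in>C. (\<forall>i\<in>I. \<bar>f i - g i\<bar> < \<delta>) \<longrightarrow> \<bar>u f j - u g j\<bar> < \<epsilon>)"
  proof cases
    case 1
    then show ?thesis using \<open>\<epsilon> > 0\<close> by (intro exI[of _ "{}"] exI[of _ 1]) auto
  next
    case 2
    then show ?thesis using \<open>\<epsilon> > 0\<close> by (intro exI[of _ "{i}"] exI[of _ \<epsilon>]) auto
  qed
qed

lemma coordinatewise_bounded:
  assumes "coordinatewise C u" "c \<ge> 1"
  shows "sup_bounded c C u"
  unfolding sup_bounded_def
proof (intro ballI allI impI)
  fix f M j assume *: "f \<in> C" "\<forall>i. \<bar>f i\<bar> \<le> M"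
  then have "0 \<le> M" by (meson abs_ge_zero order_trans)
  moreover have "\<bar>u f j\<bar> \<le> M"
  proof -
    consider "u f j = 0" | i where "u f j = f i"
      using assms(1) *(1) unfolding coordinatewise_def by blast
    then show ?thesis
      using * calculation by cases auto
  qed
  ultimately show "\<bar>u f j\<bar> \<le> c * M"
    using assms(2) mult_right_mono[of 1 c M] by simp
qed

lemma coordinatewise_equiv:
  assumes "\<And>f. f \<in> C \<Longrightarrow> u f \<in> D" "\<And>g. g \<in> D \<Longrightarrow> v g \<in> C"
    "\<And>f. f \<in> C \<Longrightarrow> v (u f) = f" "\<And>g. g \<in> D \<Longrightarrow> u (v g) = g"
    "coordinatewise C u" "coordinatewise D v"
  shows "C \<simeq> D"
  unfolding almost_isometric_def near_isometry_def
proof (intro allI impI exI[of _ u] exI[of _ v] conjI)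
  fix c :: real assume "c > 1"
  then show "sup_bounded c C u" "sup_bounded c D v"
    using assms(5,6) by (simp_all add: coordinatewise_bounded)
qed (use assms in \<open>auto intro: coordinatewise_ucont\<close>)

lemma almost_isometric_refl [simp]: "C \<simeq> C"
  by (rule coordinatewise_equiv[of C "\<lambda>f. f" C "\<lambda>f. f"]) (auto intro!: coordinatewiseI)


section \<open>Direct sums\<close>

definition dsum2 :: "('i \<Rightarrow> real) set \<Rightarrow> ('j \<Rightarrow> real) set \<Rightarrow> ('i + 'j \<Rightarrow> real) set"  (infixr \<open>\<oplus>\<close> 65)
  where "C \<oplus> D = {h. h \<circ> Inl \<in> C \<and> h \<circ> Inr \<in> D}"

abbreviation scalars :: "(unit \<Rightarrow> real) set"
  where "scalars \<equiv> UNIV"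

lemma case_sum_in_dsum2_iff [simp]: "case_sum f g \<in> C \<oplus> D \<longleftrightarrow> f \<in> C \<and> g \<in> D"
  by (simp add: dsum2_def comp_def)

lemma sum_fun_eqI: "f \<circ> Inl = g \<circ> Inl \<Longrightarrow> f \<circ> Inr = g \<circ> Inr \<Longrightarrow> f = g"
  by (rule ext, rename_tac x, case_tac x) (auto dest: fun_cong)

lemma dsum2_comm: "C \<oplus> D \<simeq> D \<oplus> C"
proof (rule coordinatewise_equiv[where u = "\<lambda>h. case_sum (h \<circ> Inr) (h \<circ> Inl)"
      and v = "\<lambda>h. case_sum (h \<circ> Inr) (h \<circ> Inl)"])
  show "coordinatewise (C \<oplus> D) (\<lambda>h. case_sum (h \<circ> Inr) (h \<circ> Inl))"
    "coordinatewise (D \<oplus> C) (\<lambda>h. case_sum (h \<circ> Inr) (h \<circ> Inl))"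
    by (rule coordinatewise_reindex[where \<sigma> = "case_sum Inr Inl"]; auto split: sum.split)+
qed (auto simp: dsum2_def case_sum_o_inj surjective_sum[unfolded comp_def] intro: sum_fun_eqI)

lemma dsum2_assoc: "(C \<oplus> D) \<oplus> E \<simeq> C \<oplus> (D \<oplus> E)"
proof (rule coordinatewise_equiv[where
      u = "\<lambda>h. case_sum (h \<circ> Inl \<circ> Inl) (case_sum (h \<circ> Inl \<circ> Inr) (h \<circ> Inr))"
      and v = "\<lambda>h. case_sum (case_sum (h \<circ> Inl) (h \<circ> Inr \<circ> Inl)) (h \<circ> Inr \<circ> Inr)"])
  show "coordinatewise ((C \<oplus> D) \<oplus> E)
      (\<lambda>h. case_sum (h \<circ> Inl \<circ> Inl) (case_sum (h \<circ> Inl \<circ> Inr) (h \<circ> Inr)))"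
    by (rule coordinatewise_reindex[where
          \<sigma> = "case_sum (\<lambda>x. Inl (Inl x)) (case_sum (\<lambda>x. Inl (Inr x)) Inr)"])
      (auto split: sum.split)
  show "coordinatewise (C \<oplus> (D \<oplus> E))
      (\<lambda>h. case_sum (case_sum (h \<circ> Inl) (h \<circ> Inr \<circ> Inl)) (h \<circ> Inr \<circ> Inr))"
    by (rule coordinatewise_reindex[where
          \<sigma> = "case_sum (case_sum Inl (\<lambda>x. Inr (Inl x))) (\<lambda>x. Inr (Inr x))"])
      (auto split: sum.split)
qed (auto simp: dsum2_def case_sum_o_inj intro!: sum_fun_eqI)

lemma dsum2_cong:
  assumes "C \<simeq> C'" "D \<simeq> D'"
  shows "C \<oplus> D \<simeq> C' \<oplus> D'"
proof (rule almost_isometricI)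
  have ucont: "pointwise_ucont (C \<oplus> D) (\<lambda>h. case_sum (u (h \<circ> Inl)) (w (h \<circ> Inr)))"
    if uw: "pointwise_ucont C u" "pointwise_ucont D w"
    for C :: "('i \<Rightarrow> real) set" and D :: "('j \<Rightarrow> real) set"
      and u :: "('i \<Rightarrow> real) \<Rightarrow> 'k \<Rightarrow> real" and w :: "('j \<Rightarrow> real) \<Rightarrow> 'l \<Rightarrow> real"
  proof (rule pointwise_ucontI)
    fix j and \<epsilon> :: real assume e: "\<epsilon> > 0"
    show "\<exists>I \<delta>. finite I \<and> \<delta> > 0 \<and>
      (\<forall>f\<in>C \<oplus> D. \<forall>g\<in>C \<oplus> D. (\<forall>i\<in>I. \<bar>f i - g i\<bar> < \<delta>) \<longrightarrow>
        \<bar>case_sum (u (f \<circ> Inl)) (w (f \<circ> Inr)) j - case_sum (u (g \<circ> Inl)) (w (g \<circ> Inr)) j\<bar> < \<epsilon>)"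
    proof (cases j)
      case (Inl k)
      obtain I \<delta> where "finite I" "\<delta> > 0"
        "\<forall>f\<in>C. \<forall>g\<in>C. (\<forall>i\<in>I. \<bar>f i - g i\<bar> < \<delta>) \<longrightarrow> \<bar>u f k - u g k\<bar> < \<epsilon>"
        using pointwise_ucontD[OF uw(1) e, of k] by blast
      then show ?thesis
        by (intro exI[of _ "Inl ` I"] exI[of _ \<delta>]) (auto simp: Inl dsum2_def)
    next
      case (Inr k)
      obtain I \<delta> where "finite I" "\<delta> > 0"
        "\<forall>f\<in>D. \<forall>g\<in>D. (\<forall>i\<in>I. \<bar>f i - g i\<bar> < \<delta>) \<longrightarrow> \<bar>w f k - w g k\<bar> < \<epsilon>"
        using pointwise_ucontD[OF uw(2) e, of k] by blast
      then show ?thesis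
        by (intro exI[of _ "Inr ` I"] exI[of _ \<delta>]) (auto simp: Inr dsum2_def)
    qed
  qed
  have bounded: "sup_bounded c (C \<oplus> D) (\<lambda>h. case_sum (u (h \<circ> Inl)) (w (h \<circ> Inr)))"
    if "sup_bounded c C u" "sup_bounded c D w"
    for c and C :: "('i \<Rightarrow> real) set" and D :: "('j \<Rightarrow> real) set"
      and u :: "('i \<Rightarrow> real) \<Rightarrow> 'k \<Rightarrow> real" and w :: "('j \<Rightarrow> real) \<Rightarrow> 'l \<Rightarrow> real"
    using that unfolding sup_bounded_def dsum2_def by (auto split: sum.split)
  fix c :: real assume "c > 1"
  obtain u v where 1: "near_isometry c C C' u v"
    using assms(1) \<open>c > 1\<close> by (rule almost_isometricE)
  obtain u' v' where 2: "near_isometry c D D' u' v'"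
    using assms(2) \<open>c > 1\<close> by (rule almost_isometricE)
  have "near_isometry c (C \<oplus> D) (C' \<oplus> D')
      (\<lambda>h. case_sum (u (h \<circ> Inl)) (u' (h \<circ> Inr))) (\<lambda>h. case_sum (v (h \<circ> Inl)) (v' (h \<circ> Inr)))"
    unfolding near_isometry_def
  proof (intro conjI)
    show "pointwise_ucont (C \<oplus> D) (\<lambda>h. case_sum (u (h \<circ> Inl)) (u' (h \<circ> Inr)))"
      "pointwise_ucont (C' \<oplus> D') (\<lambda>h. case_sum (v (h \<circ> Inl)) (v' (h \<circ> Inr)))"
      "sup_bounded c (C \<oplus> D) (\<lambda>h. case_sum (u (h \<circ> Inl)) (u' (h \<circ> Inr)))"
      "sup_bounded c (C' \<oplus> D') (\<lambda>h. case_sum (v (h \<circ> Inl)) (v' (h \<circ> Inr)))"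
      using 1 2 unfolding near_isometry_def by (auto intro!: ucont bounded)
  qed (use 1 2 in \<open>auto simp: near_isometry_def dsum2_def Pi_iff case_sum_o_inj intro!: sum_fun_eqI\<close>)
  then show "\<exists>u v. near_isometry c (C \<oplus> D) (C' \<oplus> D') u v" by blast
qed

lemma dsum2_left_cong: "C \<simeq> C' \<Longrightarrow> C \<oplus> D \<simeq> C' \<oplus> D"
  by (simp add: dsum2_cong)

lemma dsum2_right_cong: "D \<simeq> D' \<Longrightarrow> C \<oplus> D \<simeq> C \<oplus> D'"
  by (simp add: dsum2_cong)

text \<open>With \<open>z = False\<close> this is the full product of the \<open>C n\<close>, with \<open>z = True\<close> their \<open>c\<^sub>0\<close>-sum. Both
  arise below from the same decompositions, so they are treated together.\<close>

definition dsum :: "bool \<Rightarrow> (nat \<Rightarrow> ('i \<Rightarrow> real) set) \<Rightarrow> (nat \<times> 'i \<Rightarrow> real) set"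
  where "dsum z C = {h. (\<forall>n. (\<lambda>i. h (n, i)) \<in> C n) \<and>
    (z \<longrightarrow> (\<forall>\<epsilon>>0. \<exists>N. \<forall>n\<ge>N. \<forall>i. \<bar>h (n, i)\<bar> \<le> \<epsilon>))}"

lemma dsumI:
  assumes "\<And>n. (\<lambda>i. h (n, i)) \<in> C n"
    "\<And>\<epsilon>. z \<Longrightarrow> \<epsilon> > 0 \<Longrightarrow> \<exists>N. \<forall>n\<ge>N. \<forall>i. \<bar>h (n, i)\<bar> \<le> \<epsilon>"
  shows "h \<in> dsum z C"
  using assms by (simp add: dsum_def)

lemma dsumD:
  assumes "h \<in> dsum z C"
  shows "(\<lambda>i. h (n, i)) \<in> C n" "z \<Longrightarrow> \<epsilon> > 0 \<Longrightarrow> \<exists>N. \<forall>n\<ge>N. \<forall>i. \<bar>h (n, i)\<bar> \<le> \<epsilon>"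
  using assms by (simp_all add: dsum_def)

text \<open>That all the equivalences of the summands share one constant \<open>c\<close> is what keeps the image
  of a null sequence a null sequence.\<close>

lemma dsum_cong:
  assumes "\<And>n. C n \<simeq> D n"
  shows "dsum z C \<simeq> dsum z D"
proof (rule almost_isometricI)
  have ucont: "pointwise_ucont (dsum z C) (\<lambda>h (n, j). u n (\<lambda>i. h (n, i)) j)"
    if u: "\<And>n. pointwise_ucont (C n) (u n)"
    for C :: "nat \<Rightarrow> ('i \<Rightarrow> real) set" and u :: "nat \<Rightarrow> ('i \<Rightarrow> real) \<Rightarrow> 'j \<Rightarrow> real"
  proof (rule pointwise_ucontI)
    fix nj :: "nat \<times> 'j" and \<epsilon> :: real assume e: "\<epsilon> > 0"
    obtain n j where nj: "nj = (n, j)" by (cases nj)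
    obtain I \<delta> where "finite I" "\<delta> > 0"
      "\<forall>f\<in>C n. \<forall>g\<in>C n. (\<forall>i\<in>I. \<bar>f i - g i\<bar> < \<delta>) \<longrightarrow> \<bar>u n f j - u n g j\<bar> < \<epsilon>"
      using pointwise_ucontD[OF u[of n] e, of j] by blast
    then show "\<exists>I \<delta>. finite I \<and> \<delta> > 0 \<and>
      (\<forall>f\<in>dsum z C. \<forall>g\<in>dsum z C. (\<forall>i\<in>I. \<bar>f i - g i\<bar> < \<delta>) \<longrightarrow>
        \<bar>(case nj of (n, j) \<Rightarrow> u n (\<lambda>i. f (n, i)) j) - (case nj of (n, j) \<Rightarrow> u n (\<lambda>i. g (n, i)) j)\<bar> < \<epsilon>)"
      by (intro exI[of _ "Pair n ` I"] exI[of _ \<delta>]) (auto simp: nj dsum_def)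
  qed
  have bounded: "sup_bounded c (dsum z C) (\<lambda>h (n, j). u n (\<lambda>i. h (n, i)) j)"
    if "\<And>n. sup_bounded c (C n) (u n)"
    for c and C :: "nat \<Rightarrow> ('i \<Rightarrow> real) set" and u :: "nat \<Rightarrow> ('i \<Rightarrow> real) \<Rightarrow> 'j \<Rightarrow> real"
    using that unfolding sup_bounded_def dsum_def by auto
  have maps: "(\<lambda>(n, j). u n (\<lambda>i. h (n, i)) j) \<in> dsum z D"
    if u: "\<And>n. sup_bounded c (C n) (u n)" "\<And>n. u n \<in> C n \<rightarrow> D n" and c: "c > 1" and h: "h \<in> dsum z C"
    for c h and C :: "nat \<Rightarrow> ('i \<Rightarrow> real) set" and D :: "nat \<Rightarrow> ('j \<Rightarrow> real) set"
      and u :: "nat \<Rightarrow> ('i \<Rightarrow> real) \<Rightarrow> 'j \<Rightarrow> real"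
  proof -
    have *: "\<exists>N. \<forall>n\<ge>N. \<forall>j. \<bar>u n (\<lambda>i. h (n, i)) j\<bar> \<le> \<epsilon>" if ze: "z" "\<epsilon> > 0" for \<epsilon>
    proof -
      obtain N where N: "\<And>n i. n \<ge> N \<Longrightarrow> \<bar>h (n, i)\<bar> \<le> \<epsilon> / c"
        using dsumD(2)[OF h, of "\<epsilon> / c"] ze c by auto
      have "\<bar>u n (\<lambda>i. h (n, i)) j\<bar> \<le> c * (\<epsilon> / c)" if "n \<ge> N" for n j
        using sup_boundedD[OF u(1) dsumD(1)[OF h] N[OF that]] .
      then show ?thesis using c by auto
    qed
    show ?thesis
      using u(2) h * unfolding dsum_def by (auto simp: Pi_iff)
  qed
  fix c :: real assume c: "c > 1"
  have "\<forall>n. \<exists>u v. near_isometry c (C n) (D n) u v"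
    using assms c unfolding almost_isometric_def by blast
  then obtain u v where "\<And>n. near_isometry c (C n) (D n) (u n) (v n)"
    by metis
  then have uv: "\<And>n. u n \<in> C n \<rightarrow> D n" "\<And>n. v n \<in> D n \<rightarrow> C n" "\<And>n f. f \<in> C n \<Longrightarrow> v n (u n f) = f"
    "\<And>n g. g \<in> D n \<Longrightarrow> u n (v n g) = g" "\<And>n. pointwise_ucont (C n) (u n)"
    "\<And>n. pointwise_ucont (D n) (v n)" "\<And>n. sup_bounded c (C n) (u n)" "\<And>n. sup_bounded c (D n) (v n)"
    unfolding near_isometry_def by auto
  have "near_isometry c (dsum z C) (dsum z D) (\<lambda>h (n, j). u n (\<lambda>i. h (n, i)) j) (\<lambda>h (n, j). v n (\<lambda>i. h (n, i)) j)"
    unfolding near_isometry_def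
  proof (intro conjI ballI)
    fix f assume f: "f \<in> dsum z C"
    then have "\<And>n. (\<lambda>i. f (n, i)) \<in> C n" by (simp add: dsum_def)
    then show "(\<lambda>(n, j). v n (\<lambda>i. case (n, i) of (n, j) \<Rightarrow> u n (\<lambda>i. f (n, i)) j) j) = f"
      by (simp add: uv(3) fun_eq_iff)
  next
    fix f assume f: "f \<in> dsum z D"
    then have "\<And>n. (\<lambda>i. f (n, i)) \<in> D n" by (simp add: dsum_def)
    then show "(\<lambda>(n, j). u n (\<lambda>i. case (n, i) of (n, j) \<Rightarrow> v n (\<lambda>i. f (n, i)) j) j) = f"
      by (simp add: uv(4) fun_eq_iff)
  next
    show "(\<lambda>h (n, j). u n (\<lambda>i. h (n, i)) j) \<in> dsum z C \<rightarrow> dsum z D"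
      by (rule Pi_I, rule maps[OF _ _ c]) (use uv in auto)
    show "(\<lambda>h (n, j). v n (\<lambda>i. h (n, i)) j) \<in> dsum z D \<rightarrow> dsum z C"
      by (rule Pi_I, rule maps[OF _ _ c]) (use uv in auto)
  qed (use uv in \<open>auto intro!: ucont bounded\<close>)
  then show "\<exists>u v. near_isometry c (dsum z C) (dsum z D) u v" by blast
qed

lemma dsum_split_first: "dsum z C \<simeq> C 0 \<oplus> dsum z (\<lambda>n. C (Suc n))"
proof (rule coordinatewise_equiv[where
      u = "\<lambda>h. case_sum (\<lambda>i. h (0, i)) (\<lambda>(n, i). h (Suc n, i))"
      and v = "\<lambda>h (n, i). case n of 0 \<Rightarrow> h (Inl i) | Suc m \<Rightarrow> h (Inr (m, i))"])
  show "coordinatewise (dsum z C) (\<lambda>h. case_sum (\<lambda>i. h (0, i)) (\<lambda>(n, i). h (Suc n, i)))"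
    by (rule coordinatewise_reindex[where \<sigma> = "case_sum (Pair 0) (\<lambda>(n, i). (Suc n, i))"])
      (auto split: sum.split prod.split)
  show "coordinatewise (C 0 \<oplus> dsum z (\<lambda>n. C (Suc n)))
      (\<lambda>h (n, i). case n of 0 \<Rightarrow> h (Inl i) | Suc m \<Rightarrow> h (Inr (m, i)))"
    by (rule coordinatewise_reindex[where
          \<sigma> = "\<lambda>(n, i). case n of 0 \<Rightarrow> Inl i | Suc m \<Rightarrow> Inr (m, i)"])
      (auto split: nat.split prod.split)
  show "case_sum (\<lambda>i. h (0, i)) (\<lambda>(n, i). h (Suc n, i)) \<in> C 0 \<oplus> dsum z (\<lambda>n. C (Suc n))"
    if "h \<in> dsum z C" for h
    using that unfolding dsum_def by simp (meson le_SucI)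
  show "(\<lambda>(n, i). case n of 0 \<Rightarrow> h (Inl i) | Suc m \<Rightarrow> h (Inr (m, i))) \<in> dsum z C"
    if "h \<in> C 0 \<oplus> dsum z (\<lambda>n. C (Suc n))" for h
  proof -
    have h: "(\<lambda>i. h (Inl i)) \<in> C 0" "(\<lambda>x. h (Inr x)) \<in> dsum z (\<lambda>n. C (Suc n))"
      using that by (simp_all add: dsum2_def comp_def)
    have "\<exists>N. \<forall>n\<ge>N. \<forall>i. \<bar>case n of 0 \<Rightarrow> h (Inl i) | Suc m \<Rightarrow> h (Inr (m, i))\<bar> \<le> \<epsilon>" if ze: "z" "\<epsilon> > 0" for \<epsilon>
    proof -
      obtain N where "\<And>n i. n \<ge> N \<Longrightarrow> \<bar>h (Inr (n, i))\<bar> \<le> \<epsilon>"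
        using dsumD(2)[OF h(2) ze] by auto
      then show ?thesis by (intro exI[of _ "Suc N"]) (auto split: nat.split)
    qed
    then show ?thesis
      using h(1) dsumD(1)[OF h(2)]
      by (intro dsumI) (simp, rename_tac n, case_tac n, simp_all)
  qed
qed (auto simp: fun_eq_iff split: nat.split sum.split)

lemma dsum_dsum2: "dsum z (\<lambda>n. C n \<oplus> D n) \<simeq> dsum z C \<oplus> dsum z D"
proof (rule coordinatewise_equiv[where
      u = "\<lambda>h. case_sum (\<lambda>(n, i). h (n, Inl i)) (\<lambda>(n, i). h (n, Inr i))"
      and v = "\<lambda>h (n, x). case x of Inl i \<Rightarrow> h (Inl (n, i)) | Inr i \<Rightarrow> h (Inr (n, i))"])
  show "coordinatewise (dsum z (\<lambda>n. C n \<oplus> D n)) (\<lambda>h. case_sum (\<lambda>(n, i). h (n, Inl i)) (\<lambda>(n, i). h (n, Inr i)))"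
    by (rule coordinatewise_reindex[where
          \<sigma> = "case_sum (\<lambda>(n, i). (n, Inl i)) (\<lambda>(n, i). (n, Inr i))"])
      (auto split: sum.split prod.split)
  show "coordinatewise (dsum z C \<oplus> dsum z D)
      (\<lambda>h (n, x). case x of Inl i \<Rightarrow> h (Inl (n, i)) | Inr i \<Rightarrow> h (Inr (n, i)))"
    by (rule coordinatewise_reindex[where
          \<sigma> = "\<lambda>(n, x). case x of Inl i \<Rightarrow> Inl (n, i) | Inr i \<Rightarrow> Inr (n, i)"])
      (auto split: sum.split prod.split)
  show "case_sum (\<lambda>(n, i). h (n, Inl i)) (\<lambda>(n, i). h (n, Inr i)) \<in> dsum z C \<oplus> dsum z D"
    if "h \<in> dsum z (\<lambda>n. C n \<oplus> D n)" for h
    using that unfolding dsum_def dsum2_def comp_def by simp meson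
  show "(\<lambda>(n, x). case x of Inl i \<Rightarrow> h (Inl (n, i)) | Inr i \<Rightarrow> h (Inr (n, i))) \<in> dsum z (\<lambda>n. C n \<oplus> D n)"
    if "h \<in> dsum z C \<oplus> dsum z D" for h
  proof -
    have h: "(\<lambda>x. h (Inl x)) \<in> dsum z C" "(\<lambda>x. h (Inr x)) \<in> dsum z D"
      using that by (simp_all add: dsum2_def comp_def)
    have "\<exists>N. \<forall>n\<ge>N. \<forall>x. \<bar>case x of Inl i \<Rightarrow> h (Inl (n, i)) | Inr i \<Rightarrow> h (Inr (n, i))\<bar> \<le> \<epsilon>" if ze: "z" "\<epsilon> > 0" for \<epsilon>
    proof -
      obtain N N' where "\<forall>n\<ge>N. \<forall>i. \<bar>h (Inl (n, i))\<bar> \<le> \<epsilon>" "\<forall>n\<ge>N'. \<forall>i. \<bar>h (Inr (n, i))\<bar> \<le> \<epsilon>"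
        using dsumD(2)[OF h(1) ze] dsumD(2)[OF h(2) ze] by auto
      then show ?thesis by (intro exI[of _ "max N N'"]) (auto split: sum.split)
    qed
    then show ?thesis
      using dsumD(1)[OF h(1)] dsumD(1)[OF h(2)]
      by (intro dsumI) (simp_all add: dsum2_def comp_def)
  qed
qed (auto simp: fun_eq_iff split: sum.split)

section \<open>Splitting off a retract\<close>

text \<open>The median of three increasing bijections of the line is an increasing bijection whose inverse is
  the median of the three inverses. This makes it easy to build piecewise linear bijections together with
  their inverses.\<close>

definition median3 :: "real \<Rightarrow> real \<Rightarrow> real \<Rightarrow> real"
  where "median3 a b c = max (min a b) (min (max a b) c)"

lemma median3_refl [simp]: "median3 a b b = b" "median3 b b a = b"
  by (auto simp: median3_def min_def max_def)

lemma median3_le_iff: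
  "median3 a b c \<le> t \<longleftrightarrow> a \<le> t \<and> b \<le> t \<or> a \<le> t \<and> c \<le> t \<or> b \<le> t \<and> c \<le> t"
  by (auto simp: median3_def min_le_iff_disj)

lemma le_median3_iff:
  "t \<le> median3 a b c \<longleftrightarrow> t \<le> a \<and> t \<le> b \<or> t \<le> a \<and> t \<le> c \<or> t \<le> b \<and> t \<le> c"
  by (auto simp: median3_def le_max_iff_disj)

lemma abs_median3_le:
  assumes "\<bar>a\<bar> \<le> M \<and> \<bar>b\<bar> \<le> M \<or> \<bar>a\<bar> \<le> M \<and> \<bar>c\<bar> \<le> M"
  shows "\<bar>median3 a b c\<bar> \<le> M"
  using assms by (auto simp: abs_le_iff median3_le_iff minus_le_iff[of "median3 a b c"] le_median3_iff)

lemma abs_median3_diff_less: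
  assumes "\<bar>a - a'\<bar> < e" "\<bar>b - b'\<bar> < e" "\<bar>c - c'\<bar> < e"
  shows "\<bar>median3 a b c - median3 a' b' c'\<bar> < e"
proof -
  have lattice: "\<bar>min p q - min p' q'\<bar> < e" "\<bar>max p q - max p' q'\<bar> < e"
    if "\<bar>p - p'\<bar> < e" "\<bar>q - q'\<bar> < e" for p q p' q' :: real
    using that by (auto simp: min_def max_def)
  show ?thesis
    unfolding median3_def by (intro lattice assms)
qed

text \<open>The order-theoretic form of the statement on inverses: comparing \<open>t\<close> with the three values on
  one side is the same as comparing \<open>y\<close> with the three values on the other side.\<close>

lemma median3_eq_transfer:
  assumes "median3 a b c = t"
    and "t \<le> a \<longleftrightarrow> a' \<le> y" "a \<le> t \<longleftrightarrow> y \<le> a'"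
    and "t \<le> b \<longleftrightarrow> b' \<le> y" "b \<le> t \<longleftrightarrow> y \<le> b'"
    and "t \<le> c \<longleftrightarrow> c' \<le> y" "c \<le> t \<longleftrightarrow> y \<le> c'"
  shows "median3 a' b' c' = y"
proof (rule antisym)
  show "median3 a' b' c' \<le> y"
    using assms(1) assms(2,4,6)[symmetric] le_median3_iff[of t a b c] by (simp add: median3_le_iff)
  show "y \<le> median3 a' b' c'"
    using assms(1) assms(3,5,7)[symmetric] median3_le_iff[of a b c t] by (simp add: le_median3_iff)
qed

text \<open>For \<open>s > 0\<close> and \<open>0 < \<delta> < 1\<close> the function \<open>tilt \<delta> s\<close> is the identity outside
  \<open>[-s, s / (1 - \<delta>)]\<close> and sends \<open>s\<close> to \<open>0\<close>: it is flat on the long interval to the left of \<open>s\<close> and steep on the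
  short one to the right. It replaces the subtraction \<open>t - s\<close>; negative \<open>s\<close> is the mirror image.\<close>

definition tilt :: "real \<Rightarrow> real \<Rightarrow> real \<Rightarrow> real"
  where "tilt \<delta> s t = median3 t ((t - s) / 2) ((t - s) / \<delta>)"

definition untilt :: "real \<Rightarrow> real \<Rightarrow> real \<Rightarrow> real"
  where "untilt \<delta> s y = median3 y (s + 2 * y) (s + \<delta> * y)"

context
  fixes \<delta> :: real
  assumes \<delta>: "\<delta> > 0"
begin

lemma tilt_untilt [simp]: "tilt \<delta> s (untilt \<delta> s y) = y"
  unfolding tilt_def
  by (rule median3_eq_transfer[OF untilt_def[symmetric]]) (use \<delta> in \<open>auto simp: field_simps\<close>)

lemma untilt_tilt [simp]: "untilt \<delta> s (tilt \<delta> s t) = t"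
  unfolding untilt_def
  by (rule median3_eq_transfer[OF tilt_def[symmetric]]) (use \<delta> in \<open>auto simp: field_simps\<close>)

lemma tilt_self [simp]: "tilt \<delta> s s = 0"
  by (simp add: tilt_def)

lemma untilt_0 [simp]: "untilt \<delta> s 0 = s"
  by (simp add: untilt_def)

lemma abs_tilt_le: "\<bar>s\<bar> \<le> M \<Longrightarrow> \<bar>t\<bar> \<le> M \<Longrightarrow> \<bar>tilt \<delta> s t\<bar> \<le> M"
  unfolding tilt_def by (rule abs_median3_le) auto

text \<open>Two of the three values in the median are bounded by \<open>(1 + \<delta>) M\<close>; the third, of slope two, is
  harmless for this reason.\<close>

lemma abs_untilt_le:
  assumes "\<bar>s\<bar> \<le> M" "\<bar>y\<bar> \<le> M"
  shows "\<bar>untilt \<delta> s y\<bar> \<le> (1 + \<delta>) * M"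
  unfolding untilt_def
proof (rule abs_median3_le, rule disjI2, rule conjI)
  have "\<bar>\<delta> * y\<bar> \<le> \<delta> * M" "0 \<le> \<delta> * M"
    using assms \<delta> by (simp_all add: abs_mult)
  then show "\<bar>y\<bar> \<le> (1 + \<delta>) * M" "\<bar>s + \<delta> * y\<bar> \<le> (1 + \<delta>) * M"
    using assms by (auto simp: distrib_right)
qed

lemma abs_tilt_diff_less:
  assumes "\<epsilon> > 0" "\<bar>s - s'\<bar> < min \<epsilon> (\<epsilon> * \<delta> / 2)" "\<bar>t - t'\<bar> < min \<epsilon> (\<epsilon> * \<delta> / 2)"
  shows "\<bar>tilt \<delta> s t - tilt \<delta> s' t'\<bar> < \<epsilon>"
  unfolding tilt_def
proof (rule abs_median3_diff_less)
  define \<eta> where "\<eta> = \<epsilon> * \<delta> / 2"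
  have "\<bar>(t - s) - (t' - s')\<bar> < 2 * \<eta>"
    using assms(2,3) unfolding \<eta>_def[symmetric] by linarith
  then have "\<bar>(t - s) - (t' - s')\<bar> < \<epsilon> * \<delta>" by (simp add: \<eta>_def)
  then have "\<bar>((t - s) - (t' - s')) / \<delta>\<bar> < \<epsilon>"
    using \<delta> by (simp add: pos_divide_less_eq)
  then show "\<bar>(t - s) / \<delta> - (t' - s') / \<delta>\<bar> < \<epsilon>"
    by (simp add: diff_divide_distrib)
qed (use assms in \<open>auto simp: field_simps\<close>)

lemma abs_untilt_diff_less:
  assumes "\<epsilon> > 0" "\<bar>s - s'\<bar> < \<epsilon> / (3 + \<delta>)" "\<bar>y - y'\<bar> < \<epsilon> / (3 + \<delta>)"
  shows "\<bar>untilt \<delta> s y - untilt \<delta> s' y'\<bar> < \<epsilon>"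
  unfolding untilt_def
proof (rule abs_median3_diff_less)
  \<comment> \<open>The arguments \<open>s + 2 * y\<close> and \<open>s + \<delta> * y\<close> move by less than \<open>3 * \<eta>\<close> and \<open>(1 + \<delta>) * \<eta>\<close>.\<close>
  define \<eta> where "\<eta> = \<epsilon> / (3 + \<delta>)"
  have "(3 + \<delta>) * \<eta> = \<epsilon>"
    using \<delta> by (simp add: \<eta>_def)
  then have e: "\<epsilon> = 3 * \<eta> + \<delta> * \<eta>"
    by (simp only: distrib_right)
  have "\<eta> > 0" using assms(1) \<delta> by (simp add: \<eta>_def)
  then have "\<delta> * \<eta> > 0" using \<delta> by simp
  moreover have "\<bar>\<delta> * (y - y')\<bar> < \<delta> * \<eta>"
    using assms(3) \<delta> by (simp add: abs_mult flip: \<eta>_def)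
  ultimately show "\<bar>y - y'\<bar> < \<epsilon>" "\<bar>s + 2 * y - (s' + 2 * y')\<bar> < \<epsilon>"
    "\<bar>s + \<delta> * y - (s' + \<delta> * y')\<bar> < \<epsilon>"
    using assms(2,3) e \<open>\<eta> > 0\<close> unfolding \<eta>_def[symmetric] right_diff_distrib by linarith+
qed

end

lemma continuous_map_median3:
  assumes "continuous_map X euclideanreal a" "continuous_map X euclideanreal b"
    "continuous_map X euclideanreal c"
  shows "continuous_map X euclideanreal (\<lambda>x. median3 (a x) (b x) (c x))"
  unfolding median3_def
  by (intro continuous_map_real_max continuous_map_real_min assms)

lemma continuous_map_tilt:
  assumes "continuous_map X euclideanreal s" "continuous_map X euclideanreal t"
  shows "continuous_map X euclideanreal (\<lambda>x. tilt \<delta> (s x) (t x))"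
  unfolding tilt_def divide_inverse
  by (intro continuous_map_median3 continuous_intros assms)

lemma continuous_map_untilt:
  assumes "continuous_map X euclideanreal s" "continuous_map X euclideanreal t"
  shows "continuous_map X euclideanreal (\<lambda>x. untilt \<delta> (s x) (t x))"
  unfolding untilt_def
  by (intro continuous_map_median3 continuous_intros assms)

text \<open>Extending by zero, instead of by \<^const>\<open>undefined\<close>, makes the functions on a clopen subset of
  \<open>X\<close> literally functions on \<open>X\<close>, and keeps the irrelevant coordinates from affecting the norm.\<close>

definition cfun :: "'a topology \<Rightarrow> ('a \<Rightarrow> real) set"
  where "cfun X = {f. continuous_map X euclideanreal f \<and> (\<forall>x. x \<notin> topspace X \<longrightarrow> f x = 0)}"

lemma cfunI:
  assumes "continuous_map X euclideanreal f" "\<And>x. x \<notin> topspace X \<Longrightarrow> f x = 0"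
  shows "f \<in> cfun X"
  using assms by (simp add: cfun_def)

lemma cfunD:
  assumes "f \<in> cfun X"
  shows "continuous_map X euclideanreal f" "x \<notin> topspace X \<Longrightarrow> f x = 0"
  using assms by (simp_all add: cfun_def)

lemma cfun_cut:
  assumes "continuous_map X euclideanreal f"
  shows "(\<lambda>x. if x \<in> topspace X then f x else 0) \<in> cfun X"
  by (rule cfunI) (auto intro: continuous_map_eq[OF assms])

text \<open>The map is \<open>f \<mapsto> (f \<circ> e, tilt (f \<circ> e \<circ> r) f)\<close>. Its second component vanishes on the image of
  \<open>e\<close> because \<open>tilt \<delta> s s = 0\<close>, and \<open>f\<close> is recovered from the two components by \<open>untilt\<close>. A value
  of either component depends on at most two values of \<open>f\<close>.\<close>

lemma cfun_split_retract:
  assumes e: "continuous_map Y X e" and r: "continuous_map X Y r"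
    and re: "\<And>y. y \<in> topspace Y \<Longrightarrow> r (e y) = y"
  shows "cfun X \<simeq> cfun Y \<oplus> {f \<in> cfun X. \<forall>y\<in>topspace Y. f (e y) = 0}"
    (is "_ \<simeq> _ \<oplus> ?H")
proof (rule almost_isometricI)
  fix c :: real assume "c > 1"
  define \<delta> where "\<delta> = c - 1"
  have \<delta>: "\<delta> > 0" and c: "c = 1 + \<delta>" using \<open>c > 1\<close> by (simp_all add: \<delta>_def)
  have eX: "e y \<in> topspace X" if "y \<in> topspace Y" for y
    using that e by (auto simp: continuous_map_def)
  have rY: "r x \<in> topspace Y" if "x \<in> topspace X" for x
    using that r by (auto simp: continuous_map_def)
  define u1 where "u1 f = (\<lambda>y. if y \<in> topspace Y then f (e y) else 0)" for f :: "_ \<Rightarrow> real"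
  define u2 where "u2 f = (\<lambda>x. if x \<in> topspace X then tilt \<delta> (f (e (r x))) (f x) else 0)"
    for f :: "_ \<Rightarrow> real"
  define v where "v h = (\<lambda>x. if x \<in> topspace X then untilt \<delta> (h (Inl (r x))) (h (Inr x)) else 0)"
    for h :: "_ \<Rightarrow> real"
  define u where "u f = case_sum (u1 f) (u2 f)" for f
  have cont_e: "continuous_map Y euclideanreal (\<lambda>y. f (e y))" if "f \<in> cfun X" for f
    using continuous_map_compose[OF e cfunD(1)[OF that]] by (simp add: comp_def)
  have cont_r: "continuous_map X euclideanreal (\<lambda>x. g (r x))" if "g \<in> cfun Y" for g
    using continuous_map_compose[OF r cfunD(1)[OF that]] by (simp add: comp_def)
  have in_sum: "h \<circ> Inl \<in> cfun Y" "h \<circ> Inr \<in> cfun X"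
    "\<And>y. y \<in> topspace Y \<Longrightarrow> h (Inr (e y)) = 0" if "h \<in> cfun Y \<oplus> ?H" for h
    using that by (auto simp: dsum2_def)
  have u1: "u1 f \<in> cfun Y" if "f \<in> cfun X" for f
    unfolding u1_def by (rule cfun_cut[OF cont_e[OF that]])
  have u2: "u2 f \<in> cfun X" if "f \<in> cfun X" for f
    unfolding u2_def
    using cont_r[OF u1[OF that]] cfunD(1)[OF that] rY
    by (intro cfun_cut continuous_map_tilt) (auto simp: u1_def elim!: continuous_map_eq)
  have u: "u f \<in> cfun Y \<oplus> ?H" if "f \<in> cfun X" for f
    using u1[OF that] u2[OF that] by (auto simp: u_def u2_def eX re \<delta>)
  have v: "v h \<in> cfun X" if "h \<in> cfun Y \<oplus> ?H" for h
    unfolding v_def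
    using cont_r[OF in_sum(1)[OF that]] cfunD(1)[OF in_sum(2)[OF that]]
    by (intro cfun_cut continuous_map_untilt) (simp_all add: comp_def)
  have vu: "v (u f) = f" if "f \<in> cfun X" for f
    using cfunD(2)[OF that] by (auto simp: fun_eq_iff u_def v_def u1_def u2_def rY \<delta>)
  have ve: "v h (e y) = h (Inl y)" if "h \<in> cfun Y \<oplus> ?H" "y \<in> topspace Y" for h y
    using in_sum(3)[OF that] that(2) by (simp add: v_def eX re \<delta>)
  have uv: "u (v h) = h" if h: "h \<in> cfun Y \<oplus> ?H" for h
  proof
    fix i
    show "u (v h) i = h i"
    proof (cases i)
      case (Inl y)
      then show ?thesis
        using ve[OF h] cfunD(2)[OF in_sum(1)[OF h], of y] by (simp add: u_def u1_def)
    next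
      case (Inr x)
      then show ?thesis
        using ve[OF h] rY cfunD(2)[OF in_sum(2)[OF h], of x]
        by (cases "x \<in> topspace X") (simp_all add: u_def u2_def v_def \<delta>)
    qed
  qed
  have "pointwise_ucont (cfun X) u"
  proof (rule pointwise_ucontI)
    fix j and \<epsilon> :: real assume \<epsilon>: "\<epsilon> > 0"
    show "\<exists>I \<eta>. finite I \<and> \<eta> > 0 \<and>
      (\<forall>f\<in>cfun X. \<forall>g\<in>cfun X. (\<forall>i\<in>I. \<bar>f i - g i\<bar> < \<eta>) \<longrightarrow> \<bar>u f j - u g j\<bar> < \<epsilon>)"
    proof (cases j)
      case (Inl y)
      then show ?thesis
        using \<epsilon> by (intro exI[of _ "{e y}"] exI[of _ \<epsilon>]) (auto simp: u_def u1_def)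
    next
      case (Inr x)
      then show ?thesis
        using \<epsilon> \<delta> abs_tilt_diff_less[OF \<delta> \<epsilon>]
        by (intro exI[of _ "{e (r x), x}"] exI[of _ "min \<epsilon> (\<epsilon> * \<delta> / 2)"]) (simp add: u_def u2_def)
    qed
  qed
  moreover have "pointwise_ucont (cfun Y \<oplus> ?H) v"
  proof (rule pointwise_ucontI)
    fix x and \<epsilon> :: real assume \<epsilon>: "\<epsilon> > 0"
    show "\<exists>I \<eta>. finite I \<and> \<eta> > 0 \<and>
      (\<forall>f\<in>cfun Y \<oplus> ?H. \<forall>g\<in>cfun Y \<oplus> ?H. (\<forall>i\<in>I. \<bar>f i - g i\<bar> < \<eta>) \<longrightarrow> \<bar>v f x - v g x\<bar> < \<epsilon>)"
      using \<epsilon> \<delta> abs_untilt_diff_less[OF \<delta> \<epsilon>]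
      by (intro exI[of _ "{Inl (r x), Inr x}"] exI[of _ "\<epsilon> / (3 + \<delta>)"]) (simp add: v_def)
  qed
  moreover have "sup_bounded c (cfun X) u"
    unfolding sup_bounded_def
  proof (intro ballI allI impI)
    fix f and M :: real and j assume f: "f \<in> cfun X" "\<forall>i. \<bar>f i\<bar> \<le> M"
    have "0 \<le> M" by (rule order_trans[OF abs_ge_zero]) (rule f(2)[rule_format, of undefined])
    moreover have "\<bar>u f j\<bar> \<le> M"
      using f calculation abs_tilt_le[OF \<delta>] by (cases j) (auto simp: u_def u1_def u2_def)
    ultimately show "\<bar>u f j\<bar> \<le> c * M"
      using mult_right_mono[of 1 c M] \<open>c > 1\<close> by simp
  qed
  moreover have "sup_bounded c (cfun Y \<oplus> ?H) v"
    unfolding sup_bounded_def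
  proof (intro ballI allI impI)
    fix h and M :: real and x assume h: "h \<in> cfun Y \<oplus> ?H" "\<forall>i. \<bar>h i\<bar> \<le> M"
    have "0 \<le> M" by (rule order_trans[OF abs_ge_zero]) (rule h(2)[rule_format, of undefined])
    then show "\<bar>v h x\<bar> \<le> c * M"
      using h abs_untilt_le[OF \<delta>] \<delta> by (simp add: v_def c)
  qed
  ultimately have "near_isometry c (cfun X) (cfun Y \<oplus> ?H) u v"
    using u v vu uv unfolding near_isometry_def by blast
  then show "\<exists>u v. near_isometry c (cfun X) (cfun Y \<oplus> ?H) u v" by blast
qed

section \<open>Self-absorbing function spaces\<close>

text \<open>Absorbing the scalars is carried along because adding a single point to a space adds a scalar
  summand to its function space.\<close>

definition self_absorbing :: "('i \<Rightarrow> real) set \<Rightarrow> bool"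
  where "self_absorbing C \<longleftrightarrow> C \<simeq> C \<oplus> C \<and> C \<simeq> scalars \<oplus> C"

lemma almost_isometric_cong:
  assumes "C \<simeq> C'" "D \<simeq> D'"
  shows "C \<simeq> D \<longleftrightarrow> C' \<simeq> D'"
  using assms by (meson almost_isometric_sym almost_isometric_trans)

lemma self_absorbing_cong:
  assumes "C \<simeq> D" "self_absorbing C"
  shows "self_absorbing D"
  unfolding self_absorbing_def
    almost_isometric_cong[OF assms(1) dsum2_cong[OF assms(1) assms(1)], symmetric]
    almost_isometric_cong[OF assms(1) dsum2_right_cong[OF assms(1), of scalars], symmetric]
  using assms(2) by (simp add: self_absorbing_def)

lemma dsum2_left_comm: "C \<oplus> (D \<oplus> E) \<simeq> D \<oplus> (C \<oplus> E)"
proof -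
  have "C \<oplus> (D \<oplus> E) \<simeq> (C \<oplus> D) \<oplus> E"
    by (rule almost_isometric_sym[OF dsum2_assoc])
  also have "\<dots> \<simeq> (D \<oplus> C) \<oplus> E"
    by (rule dsum2_left_cong[OF dsum2_comm])
  also have "\<dots> \<simeq> D \<oplus> (C \<oplus> E)"
    by (rule dsum2_assoc)
  finally show ?thesis .
qed

lemma dsum2_interchange: "(C \<oplus> C') \<oplus> (D \<oplus> D') \<simeq> (C \<oplus> D) \<oplus> (C' \<oplus> D')"
proof -
  have "(C \<oplus> C') \<oplus> (D \<oplus> D') \<simeq> C \<oplus> (C' \<oplus> (D \<oplus> D'))"
    by (rule dsum2_assoc)
  also have "\<dots> \<simeq> C \<oplus> (D \<oplus> (C' \<oplus> D'))"
    by (rule dsum2_right_cong[OF dsum2_left_comm])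
  also have "\<dots> \<simeq> (C \<oplus> D) \<oplus> (C' \<oplus> D')"
    by (rule almost_isometric_sym[OF dsum2_assoc])
  finally show ?thesis .
qed

lemma scalars_dsum2_self_absorbing:
  assumes "self_absorbing C"
  shows "self_absorbing (scalars \<oplus> C)"
  using assms self_absorbing_cong by (auto simp: self_absorbing_def)

lemma dsum2_square:
  assumes "C \<simeq> C \<oplus> C" "D \<simeq> D \<oplus> D"
  shows "C \<oplus> D \<simeq> (C \<oplus> D) \<oplus> (C \<oplus> D)"
  by (rule almost_isometric_trans[OF dsum2_cong[OF assms] dsum2_interchange])

lemma dsum2_self_absorbing:
  assumes "self_absorbing C" "self_absorbing D"
  shows "self_absorbing (C \<oplus> D)"
proof -
  have "C \<oplus> D \<simeq> (scalars \<oplus> C) \<oplus> D"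
    using assms by (intro dsum2_left_cong) (simp add: self_absorbing_def)
  also have "\<dots> \<simeq> scalars \<oplus> (C \<oplus> D)"
    by (rule dsum2_assoc)
  finally show ?thesis
    using assms by (simp add: self_absorbing_def dsum2_square)
qed

lemma dsum_square:
  assumes "\<And>n. C n \<simeq> C n \<oplus> C n"
  shows "dsum z C \<simeq> dsum z C \<oplus> dsum z C"
  by (rule almost_isometric_trans[OF dsum_cong[OF assms] dsum_dsum2])

text \<open>One absorbing summand suffices: move it to the front, summand by summand.\<close>

lemma dsum_absorbs_scalars:
  assumes "C n \<simeq> scalars \<oplus> C n"
  shows "dsum z C \<simeq> scalars \<oplus> dsum z C"
  using assms
proof (induction n arbitrary: C)
  case 0
  have "dsum z C \<simeq> C 0 \<oplus> dsum z (\<lambda>n. C (Suc n))"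
    by (rule dsum_split_first)
  also have "\<dots> \<simeq> (scalars \<oplus> C 0) \<oplus> dsum z (\<lambda>n. C (Suc n))"
    by (rule dsum2_left_cong[OF 0])
  also have "\<dots> \<simeq> scalars \<oplus> (C 0 \<oplus> dsum z (\<lambda>n. C (Suc n)))"
    by (rule dsum2_assoc)
  also have "\<dots> \<simeq> scalars \<oplus> dsum z C"
    by (rule dsum2_right_cong[OF almost_isometric_sym[OF dsum_split_first]])
  finally show ?case .
next
  case (Suc n)
  have "dsum z C \<simeq> C 0 \<oplus> dsum z (\<lambda>n. C (Suc n))"
    by (rule dsum_split_first)
  also have "\<dots> \<simeq> C 0 \<oplus> (scalars \<oplus> dsum z (\<lambda>n. C (Suc n)))"
    by (rule dsum2_right_cong[OF Suc.IH[of "\<lambda>n. C (Suc n)", OF Suc.prems]])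
  also have "\<dots> \<simeq> scalars \<oplus> (C 0 \<oplus> dsum z (\<lambda>n. C (Suc n)))"
    by (rule dsum2_left_comm)
  also have "\<dots> \<simeq> scalars \<oplus> dsum z C"
    by (rule dsum2_right_cong[OF almost_isometric_sym[OF dsum_split_first]])
  finally show ?case .
qed

definition supported :: "'i set \<Rightarrow> ('i \<Rightarrow> real) set"
  where "supported W = {f. \<forall>x. x \<notin> W \<longrightarrow> f x = 0}"

definition cut :: "'i set \<Rightarrow> ('i \<Rightarrow> real) \<Rightarrow> 'i \<Rightarrow> real"
  where "cut W f x = (if x \<in> W then f x else 0)"

lemma cut_simps [simp]: "x \<in> W \<Longrightarrow> cut W f x = f x" "x \<notin> W \<Longrightarrow> cut W f x = 0"
  by (simp_all add: cut_def)

lemma cut_in_supported [simp]: "cut W f \<in> supported W"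
  by (simp add: supported_def)

text \<open>The flag \<open>z\<close> has the same role as for \<^const>\<open>dsum\<close>.\<close>

definition shrinking :: "bool \<Rightarrow> (nat \<Rightarrow> 'i set) \<Rightarrow> ('i \<Rightarrow> real) \<Rightarrow> bool"
  where "shrinking z W f \<longleftrightarrow> (z \<longrightarrow> (\<forall>\<epsilon>>0. \<exists>N. \<forall>n\<ge>N. \<forall>x\<in>W n. \<bar>f x\<bar> \<le> \<epsilon>))"

text \<open>The functions on a disjoint union of pieces \<open>W n\<close> whose restriction to each piece is
  prescribed to lie in \<open>C n\<close>: an internal version of \<^const>\<open>dsum\<close>.\<close>

definition glued :: "bool \<Rightarrow> (nat \<Rightarrow> 'i set) \<Rightarrow> (nat \<Rightarrow> ('i \<Rightarrow> real) set) \<Rightarrow> ('i \<Rightarrow> real) set"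
  where "glued z W C = {f \<in> supported (\<Union>n. W n). (\<forall>n. cut (W n) f \<in> C n) \<and> shrinking z W f}"

lemma supported_insert:
  assumes "a \<notin> D"
  shows "supported (insert a D) \<simeq> scalars \<oplus> supported D"
proof (rule coordinatewise_equiv[where u = "\<lambda>f. case_sum (\<lambda>_. f a) (cut D f)"
      and v = "\<lambda>h x. if x = a then h (Inl ()) else h (Inr x)"])
  show "coordinatewise (supported (insert a D)) (\<lambda>f. case_sum (\<lambda>_. f a) (cut D f))"
    by (rule coordinatewise_reindex_partial[where P = "case_sum (\<lambda>_. True) (\<lambda>x. x \<in> D)"
          and \<sigma> = "case_sum (\<lambda>_. a) (\<lambda>x. x)"]) (auto simp: cut_def split: sum.split)
  show "coordinatewise (scalars \<oplus> supported D) (\<lambda>h x. if x = a then h (Inl ()) else h (Inr x))"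
    by (rule coordinatewise_reindex[where \<sigma> = "\<lambda>x. if x = a then Inl () else Inr x"]) auto
  show "case_sum (\<lambda>_. if a = a then h (Inl ()) else h (Inr a))
      (cut D (\<lambda>x. if x = a then h (Inl ()) else h (Inr x))) = h"
    if "h \<in> scalars \<oplus> supported D" for h
    using that assms by (intro sum_fun_eqI) (auto simp: dsum2_def supported_def cut_def fun_eq_iff)
qed (auto simp: dsum2_def supported_def cut_def fun_eq_iff)

text \<open>A finite-dimensional summand is absorbed one scalar at a time.\<close>

lemma supported_finite_dsum2:
  assumes "finite D" "C \<simeq> scalars \<oplus> C"
  shows "supported D \<oplus> C \<simeq> C"
  using assms(1)
proof induction
  case empty
  have zero: "supported {} = {\<lambda>_. 0}" by (auto simp: supported_def)
  show ?case
  proof (rule coordinatewise_equiv[where u = "\<lambda>h. h \<circ> Inr" and v = "case_sum (\<lambda>_. 0)"])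
    show "coordinatewise (supported {} \<oplus> C) (\<lambda>h. h \<circ> Inr)"
      by (rule coordinatewise_reindex[where \<sigma> = Inr]) simp
    show "coordinatewise C (case_sum (\<lambda>_. 0))"
      by (rule coordinatewise_reindex_partial[where P = "case_sum (\<lambda>_. False) (\<lambda>_. True)"
            and \<sigma> = "case_sum undefined (\<lambda>x. x)"]) (auto split: sum.split)
    show "case_sum (\<lambda>_. 0) (h \<circ> Inr) = h" if "h \<in> supported {} \<oplus> C" for h
      using that by (intro sum_fun_eqI) (auto simp: zero dsum2_def)
  qed (auto simp: zero dsum2_def comp_def)
next
  case (insert a D)
  have "supported (insert a D) \<oplus> C \<simeq> (scalars \<oplus> supported D) \<oplus> C"
    by (rule dsum2_left_cong[OF supported_insert[OF insert.hyps(2)]])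
  also have "\<dots> \<simeq> scalars \<oplus> (supported D \<oplus> C)"
    by (rule dsum2_assoc)
  also have "\<dots> \<simeq> scalars \<oplus> C"
    by (rule dsum2_right_cong[OF insert.IH])
  also have "\<dots> \<simeq> C"
    by (rule almost_isometric_sym[OF assms(2)])
  finally show ?case .
qed

text \<open>All sequences for \<open>z = False\<close>, the space \<open>c\<^sub>0\<close> for \<open>z = True\<close>. The finiteness of the sets
  of large entries, unlike convergence to zero, does not refer to the order of the indices.\<close>

definition seqs :: "bool \<Rightarrow> (nat \<Rightarrow> real) set"
  where "seqs z = {f. z \<longrightarrow> (\<forall>\<epsilon>>0. finite {n. \<epsilon> < \<bar>f n\<bar>})}"

lemma finite_large_vimage:
  assumes "finite {n. \<epsilon> < \<bar>f n\<bar>}" "inj \<sigma>"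
  shows "finite {n. \<epsilon> < \<bar>f (\<sigma> n) :: real\<bar>}"
  using finite_vimageI[OF assms] by (simp add: vimage_def)

lemma seqs_self_absorbing: "self_absorbing (seqs z)"
proof -
  have "seqs z \<simeq> seqs z \<oplus> seqs z"
  proof (rule coordinatewise_equiv[where
        u = "\<lambda>f. case_sum (\<lambda>n. f (2 * n)) (\<lambda>n. f (2 * n + 1))" and
        v = "\<lambda>h n. if even n then h (Inl (n div 2)) else h (Inr (n div 2))"])
    show "coordinatewise (seqs z) (\<lambda>f. case_sum (\<lambda>n. f (2 * n)) (\<lambda>n. f (2 * n + 1)))"
      by (rule coordinatewise_reindex[where \<sigma> = "case_sum (\<lambda>n. 2 * n) (\<lambda>n. 2 * n + 1)"])
        (auto split: sum.split)
    show "coordinatewise (seqs z \<oplus> seqs z) (\<lambda>h n. if even n then h (Inl (n div 2)) else h (Inr (n div 2)))"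
      by (rule coordinatewise_reindex[where \<sigma> = "\<lambda>n. if even n then Inl (n div 2) else Inr (n div 2)"]) simp
    show "case_sum (\<lambda>n. f (2 * n)) (\<lambda>n. f (2 * n + 1)) \<in> seqs z \<oplus> seqs z" if "f \<in> seqs z" for f
      using that finite_large_vimage[of _ f "\<lambda>n. 2 * n"] finite_large_vimage[of _ f "\<lambda>n. 2 * n + 1"]
      by (auto simp: seqs_def inj_def)
    show "(\<lambda>n. if even n then h (Inl (n div 2)) else h (Inr (n div 2))) \<in> seqs z"
      if h: "h \<in> seqs z \<oplus> seqs z" for h
    proof -
      have "finite {n. \<epsilon> < \<bar>if even n then h (Inl (n div 2)) else h (Inr (n div 2))\<bar>}"
        if "z" "\<epsilon> > 0" for \<epsilon>
      proof (rule finite_subset)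
        show "{n. \<epsilon> < \<bar>if even n then h (Inl (n div 2)) else h (Inr (n div 2))\<bar>} \<subseteq>
            (\<lambda>n. 2 * n) ` {n. \<epsilon> < \<bar>h (Inl n)\<bar>} \<union> (\<lambda>n. 2 * n + 1) ` {n. \<epsilon> < \<bar>h (Inr n)\<bar>}"
        proof
          fix n assume n: "n \<in> {n. \<epsilon> < \<bar>if even n then h (Inl (n div 2)) else h (Inr (n div 2))\<bar>}"
          show "n \<in> (\<lambda>n. 2 * n) ` {n. \<epsilon> < \<bar>h (Inl n)\<bar>} \<union> (\<lambda>n. 2 * n + 1) ` {n. \<epsilon> < \<bar>h (Inr n)\<bar>}"
          proof (cases "even n")
            case True
            then show ?thesis using n by (intro UnI1 image_eqI[of _ _ "n div 2"]) auto
          next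
            case False
            then show ?thesis using n by (intro UnI2 image_eqI[of _ _ "n div 2"]) auto
          qed
        qed
        show "finite ((\<lambda>n. 2 * n) ` {n. \<epsilon> < \<bar>h (Inl n)\<bar>} \<union> (\<lambda>n. 2 * n + 1) ` {n. \<epsilon> < \<bar>h (Inr n)\<bar>})"
          using h that by (auto simp: dsum2_def seqs_def)
      qed
      then show ?thesis by (simp add: seqs_def)
    qed
    show "(\<lambda>n. if even n then case_sum (\<lambda>n. f (2 * n)) (\<lambda>n. f (2 * n + 1)) (Inl (n div 2))
        else case_sum (\<lambda>n. f (2 * n)) (\<lambda>n. f (2 * n + 1)) (Inr (n div 2))) = f" for f :: "nat \<Rightarrow> real"
      by (rule ext) auto
  qed (auto intro!: sum_fun_eqI)
  moreover have "seqs z \<simeq> scalars \<oplus> seqs z"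
  proof (rule coordinatewise_equiv[where
        u = "\<lambda>f. case_sum (\<lambda>_. f 0) (\<lambda>n. f (Suc n))" and
        v = "\<lambda>h. case_nat (h (Inl ())) (\<lambda>n. h (Inr n))"])
    show "coordinatewise (seqs z) (\<lambda>f. case_sum (\<lambda>_. f 0) (\<lambda>n. f (Suc n)))"
      by (rule coordinatewise_reindex[where \<sigma> = "case_sum (\<lambda>_. 0) Suc"]) (auto split: sum.split)
    show "coordinatewise (scalars \<oplus> seqs z) (\<lambda>h. case_nat (h (Inl ())) (\<lambda>n. h (Inr n)))"
      by (rule coordinatewise_reindex[where \<sigma> = "case_nat (Inl ()) Inr"]) (auto split: nat.split)
    show "case_sum (\<lambda>_. f 0) (\<lambda>n. f (Suc n)) \<in> scalars \<oplus> seqs z" if "f \<in> seqs z" for f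
      using that finite_large_vimage[of _ f Suc] by (auto simp: seqs_def)
    show "case_nat (h (Inl ())) (\<lambda>n. h (Inr n)) \<in> seqs z" if h: "h \<in> scalars \<oplus> seqs z" for h
    proof -
      have "finite {n. \<epsilon> < \<bar>case_nat (h (Inl ())) (\<lambda>n. h (Inr n)) n\<bar>}" if "z" "\<epsilon> > 0" for \<epsilon>
      proof (rule finite_subset)
        show "{n. \<epsilon> < \<bar>case_nat (h (Inl ())) (\<lambda>n. h (Inr n)) n\<bar>} \<subseteq> insert 0 (Suc ` {n. \<epsilon> < \<bar>h (Inr n)\<bar>})"
        proof
          fix n assume "n \<in> {n. \<epsilon> < \<bar>case_nat (h (Inl ())) (\<lambda>n. h (Inr n)) n\<bar>}"
          then show "n \<in> insert 0 (Suc ` {n. \<epsilon> < \<bar>h (Inr n)\<bar>})"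
            by (cases n) auto
        qed
        show "finite (insert 0 (Suc ` {n. \<epsilon> < \<bar>h (Inr n)\<bar>}))"
          using h that by (auto simp: dsum2_def seqs_def)
      qed
      then show ?thesis by (simp add: seqs_def)
    qed
  qed (auto intro!: sum_fun_eqI split: nat.split)
  ultimately show ?thesis by (simp add: self_absorbing_def)
qed

text \<open>Infinitely many finite pieces form one copy of \<^const>\<open>seqs\<close>: since the pieces are finite, a
  function is small on all but finitely many pieces iff it is large at only finitely many points.\<close>

lemma glued_finite_self_absorbing:
  assumes "\<And>n. finite (W n)" "disjoint_family W" "infinite (\<Union>n. W n)"
  shows "self_absorbing (glued z W (\<lambda>n. supported (W n)))"
proof -
  let ?D = "\<Union>n. W n"
  have "countable ?D" using assms(1) by (simp add: countable_finite)
  define \<sigma> where "\<sigma> = from_nat_into ?D"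
  define \<tau> where "\<tau> = to_nat_on ?D"
  have \<sigma>\<tau>: "\<sigma> (\<tau> x) = x" if "x \<in> ?D" for x
    using that \<open>countable ?D\<close> by (simp add: \<sigma>_def \<tau>_def)
  have \<tau>\<sigma>: "\<tau> (\<sigma> n) = n" for n
    using assms(3) \<open>countable ?D\<close> by (simp add: \<sigma>_def \<tau>_def)
  have \<sigma>: "\<sigma> n \<in> ?D" for n
    unfolding \<sigma>_def using assms(3) by (intro from_nat_into) auto
  have shrinking_iff: "shrinking z W f \<longleftrightarrow> (z \<longrightarrow> (\<forall>\<epsilon>>0. finite {x\<in>?D. \<epsilon> < \<bar>f x\<bar>}))" for f
  proof -
    have "(\<exists>N. \<forall>n\<ge>N. \<forall>x\<in>W n. \<bar>f x\<bar> \<le> \<epsilon>) \<longleftrightarrow> finite {x\<in>?D. \<epsilon> < \<bar>f x\<bar>}" for \<epsilon>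
    proof
      assume "\<exists>N. \<forall>n\<ge>N. \<forall>x\<in>W n. \<bar>f x\<bar> \<le> \<epsilon>"
      then obtain N where N: "\<forall>n\<ge>N. \<forall>x\<in>W n. \<bar>f x\<bar> \<le> \<epsilon>" by blast
      have "{x\<in>?D. \<epsilon> < \<bar>f x\<bar>} \<subseteq> (\<Union>n<N. W n)"
      proof
        fix x assume x: "x \<in> {x\<in>?D. \<epsilon> < \<bar>f x\<bar>}"
        then obtain n where n: "x \<in> W n" by blast
        have "n < N"
        proof (rule ccontr)
          assume "\<not> n < N"
          then have "\<bar>f x\<bar> \<le> \<epsilon>" using N n by (meson not_less)
          then show False using x by simp
        qed
        then show "x \<in> (\<Union>n<N. W n)" using n by blast
      qed
      moreover have "finite (\<Union>n<N. W n)" using assms(1) by simp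
      ultimately show "finite {x\<in>?D. \<epsilon> < \<bar>f x\<bar>}" by (rule finite_subset)
    next
      assume fin: "finite {x\<in>?D. \<epsilon> < \<bar>f x\<bar>}"
      have "\<forall>x\<in>?D. \<exists>n. x \<in> W n" by blast
      then obtain k where k: "\<And>x. x \<in> ?D \<Longrightarrow> x \<in> W (k x)" by metis
      have k_eq: "k x = n" if "x \<in> W n" for x n
        using k[of x] that assms(2) by (auto simp: disjoint_family_on_def)
      obtain N where N: "\<forall>n\<in>k ` {x\<in>?D. \<epsilon> < \<bar>f x\<bar>}. n < N"
        using finite_imageI[OF fin, of k] finite_nat_set_iff_bounded by blast
      have "\<bar>f x\<bar> \<le> \<epsilon>" if "n \<ge> N" "x \<in> W n" for n x
      proof (rule ccontr)
        assume "\<not> \<bar>f x\<bar> \<le> \<epsilon>"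
        then have "k x < N" using that(2) by (intro N[rule_format] imageI) auto
        then show False using k_eq that by simp
      qed
      then show "\<exists>N. \<forall>n\<ge>N. \<forall>x\<in>W n. \<bar>f x\<bar> \<le> \<epsilon>" by blast
    qed
    then show ?thesis by (simp add: shrinking_def)
  qed
  have "seqs z \<simeq> glued z W (\<lambda>n. supported (W n))"
  proof (rule coordinatewise_equiv[where u = "\<lambda>f. cut ?D (f \<circ> \<tau>)" and v = "\<lambda>g. g \<circ> \<sigma>"])
    show "coordinatewise (seqs z) (\<lambda>f. cut ?D (f \<circ> \<tau>))"
      by (rule coordinatewise_reindex_partial[where P = "\<lambda>x. x \<in> ?D" and \<sigma> = \<tau>]) (simp add: cut_def)
    show "coordinatewise (glued z W (\<lambda>n. supported (W n))) (\<lambda>g. g \<circ> \<sigma>)"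
      by (rule coordinatewise_reindex) simp
    show "cut ?D (f \<circ> \<tau>) \<in> glued z W (\<lambda>n. supported (W n))" if f: "f \<in> seqs z" for f
    proof -
      have "finite {x\<in>?D. \<epsilon> < \<bar>cut ?D (f \<circ> \<tau>) x\<bar>}" if "z" "\<epsilon> > 0" for \<epsilon>
      proof (rule finite_subset)
        show "{x\<in>?D. \<epsilon> < \<bar>cut ?D (f \<circ> \<tau>) x\<bar>} \<subseteq> \<sigma> ` {n. \<epsilon> < \<bar>f n\<bar>}"
        proof
          fix x assume x: "x \<in> {x\<in>?D. \<epsilon> < \<bar>cut ?D (f \<circ> \<tau>) x\<bar>}"
          then have "x \<in> ?D" by blast
          then show "x \<in> \<sigma> ` {n. \<epsilon> < \<bar>f n\<bar>}"
            using x \<sigma>\<tau> by (intro image_eqI[of _ _ "\<tau> x"]) (simp_all add: cut_def)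
        qed
        show "finite (\<sigma> ` {n. \<epsilon> < \<bar>f n\<bar>})" using f that by (simp add: seqs_def)
      qed
      then show ?thesis by (simp add: glued_def shrinking_iff)
    qed
    show "g \<circ> \<sigma> \<in> seqs z" if g: "g \<in> glued z W (\<lambda>n. supported (W n))" for g
    proof -
      have "finite {n. \<epsilon> < \<bar>g (\<sigma> n)\<bar>}" if "z" "\<epsilon> > 0" for \<epsilon>
      proof (rule finite_subset)
        show "{n. \<epsilon> < \<bar>g (\<sigma> n)\<bar>} \<subseteq> \<tau> ` {x\<in>?D. \<epsilon> < \<bar>g x\<bar>}"
        proof
          fix n assume n: "n \<in> {n. \<epsilon> < \<bar>g (\<sigma> n)\<bar>}"
          then show "n \<in> \<tau> ` {x\<in>?D. \<epsilon> < \<bar>g x\<bar>}"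
            using \<tau>\<sigma> \<sigma> by (intro image_eqI[of _ _ "\<sigma> n"]) simp_all
        qed
        have "shrinking z W g" using g by (simp add: glued_def)
        then show "finite (\<tau> ` {x\<in>?D. \<epsilon> < \<bar>g x\<bar>})"
          using that unfolding shrinking_iff by blast
      qed
      then show ?thesis by (simp add: seqs_def)
    qed
    show "cut ?D (f \<circ> \<tau>) \<circ> \<sigma> = f" for f
      using \<sigma> \<tau>\<sigma> by (simp add: fun_eq_iff cut_def)
    show "cut ?D (g \<circ> \<sigma> \<circ> \<tau>) = g" if "g \<in> glued z W (\<lambda>n. supported (W n))" for g
      using that \<sigma>\<tau> by (auto simp: fun_eq_iff cut_def glued_def supported_def)
  qed
  then show ?thesis
    using seqs_self_absorbing self_absorbing_cong by blast
qed

lemma glued_finite: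
  assumes "disjoint_family W" "finite (\<Union>n. W n)"
  shows "glued z W (\<lambda>n. supported (W n)) = supported (\<Union>n. W n)"
proof -
  have "\<forall>x\<in>\<Union>n. W n. \<exists>n. x \<in> W n" by blast
  then obtain k where k: "\<And>x. x \<in> (\<Union>n. W n) \<Longrightarrow> x \<in> W (k x)" by metis
  have k_eq: "k x = n" if "x \<in> W n" for x n
    using k[of x] that assms(1) by (auto simp: disjoint_family_on_def)
  obtain N where N: "\<forall>n\<in>k ` (\<Union>n. W n). n < N"
    using finite_imageI[OF assms(2), of k] finite_nat_set_iff_bounded by blast
  have empty: "W n = {}" if "n \<ge> N" for n
  proof (rule equals0I)
    fix x assume "x \<in> W n"
    then have "k x < N" using N by blast
    then show False using k_eq[OF \<open>x \<in> W n\<close>] that by simp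
  qed
  have "shrinking z W f" for f
    unfolding shrinking_def by (intro impI allI exI[of _ N]) (simp add: empty)
  then show ?thesis by (auto simp: glued_def)
qed

text \<open>The pieces with index in \<open>J\<close> are kept as one glued space and the remaining ones become an abstract
  direct sum. Trivial summands take the place of the former, so that no reindexing is needed.\<close>

lemma glued_split:
  assumes disj: "disjoint_family W" and C: "\<And>n. C n \<subseteq> supported (W n)"
    and fin: "\<And>n. n \<in> J \<Longrightarrow> C n = supported (W n)"
  defines "V \<equiv> \<lambda>n. if n \<in> J then W n else {}"
  shows "glued z W C \<simeq> glued z V (\<lambda>n. supported (V n)) \<oplus> dsum z (\<lambda>n. if n \<in> J then {\<lambda>_. 0} else C n)"
    (is "_ \<simeq> ?V \<oplus> dsum z ?G")
proof -
  let ?D = "\<Union>n. V n"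
  have "\<forall>x\<in>\<Union>n. W n. \<exists>n. x \<in> W n" by blast
  then obtain k where k: "\<And>x. x \<in> (\<Union>n. W n) \<Longrightarrow> x \<in> W (k x)" by metis
  have k_eq: "k x = n" if "x \<in> W n" for x n
    using k[of x] that disj by (auto simp: disjoint_family_on_def)
  have D_iff: "x \<in> ?D \<longleftrightarrow> n \<in> J" if "x \<in> W n" for x n
    using k_eq that by (auto simp: V_def split: if_splits)
  have DW: "?D \<subseteq> (\<Union>n. W n)"
    by (auto simp: V_def split: if_splits)
  define u where "u f = case_sum (cut ?D f) (\<lambda>(n, x). if n \<in> J then 0 else cut (W n) f x)"
    for f :: "'a \<Rightarrow> real"
  define v where "v h x = (if x \<in> ?D then h (Inl x) else if x \<in> (\<Union>n. W n) then h (Inr (k x, x)) else 0)"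
    for h :: "'a + nat \<times> 'a \<Rightarrow> real" and x
  have vW: "v h x = (if n \<in> J then h (Inl x) else h (Inr (n, x)))" if "x \<in> W n" for h x n
    using D_iff[OF that] k_eq[OF that] that by (auto simp: v_def)
  show ?thesis
  proof (rule coordinatewise_equiv[of _ u _ v])
    show "coordinatewise (glued z W C) u"
      by (rule coordinatewise_reindex_partial[where \<sigma> = "case_sum (\<lambda>x. x) snd" and
            P = "case_sum (\<lambda>x. x \<in> ?D) (\<lambda>(n, x). n \<notin> J \<and> x \<in> W n)"])
        (auto simp: u_def cut_def split: sum.split)
    show "coordinatewise (?V \<oplus> dsum z ?G) v"
      by (rule coordinatewise_reindex_partial[where P = "\<lambda>x. x \<in> (\<Union>n. W n)" and
            \<sigma> = "\<lambda>x. if x \<in> ?D then Inl x else Inr (k x, x)"]) (use DW in \<open>auto simp: v_def\<close>)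
    show "u f \<in> ?V \<oplus> dsum z ?G" if f: "f \<in> glued z W C" for f
    proof -
      have small: "\<exists>N. \<forall>n\<ge>N. \<forall>x\<in>W n. \<bar>f x\<bar> \<le> \<epsilon>" if "z" "\<epsilon> > 0" for \<epsilon>
        using f that by (simp add: glued_def shrinking_def)
      have "\<exists>N. \<forall>n\<ge>N. \<forall>x\<in>V n. \<bar>cut ?D f x\<bar> \<le> \<epsilon>" if ze: "z" "\<epsilon> > 0" for \<epsilon>
        using small[OF ze] by (auto simp: cut_def V_def split: if_splits)
      then have "cut ?D f \<in> ?V"
        by (simp add: glued_def shrinking_def)
      moreover have "(\<lambda>(n, x). if n \<in> J then 0 else cut (W n) f x) \<in> dsum z ?G"
      proof (rule dsumI)
        show "(\<lambda>i. case (n, i) of (n, x) \<Rightarrow> if n \<in> J then 0 else cut (W n) f x) \<in> ?G n" for n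
          using f by (auto simp: glued_def)
        fix \<epsilon> :: real assume ze: z "\<epsilon> > 0"
        then obtain N where "\<forall>n\<ge>N. \<forall>x\<in>W n. \<bar>f x\<bar> \<le> \<epsilon>"
          using small by blast
        then have "\<forall>n\<ge>N. \<forall>i. \<bar>case (n, i) of (n, x) \<Rightarrow> if n \<in> J then 0 else cut (W n) f x\<bar> \<le> \<epsilon>"
          using ze by (auto simp: cut_def)
        then show "\<exists>N. \<forall>n\<ge>N. \<forall>i. \<bar>case (n, i) of (n, x) \<Rightarrow> if n \<in> J then 0 else cut (W n) f x\<bar> \<le> \<epsilon>"
          by blast
      qed
      ultimately show ?thesis by (simp add: u_def)
    qed
    have sum: "h \<circ> Inl \<in> ?V" "h \<circ> Inr \<in> dsum z ?G" if "h \<in> ?V \<oplus> dsum z ?G" for h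
      using that by (auto simp: dsum2_def)
    have G: "(\<lambda>x. h (Inr (n, x))) \<in> ?G n" if "h \<in> ?V \<oplus> dsum z ?G" for h n
      using dsumD(1)[OF sum(2)[OF that], of n] by simp
    have G0: "h (Inr (n, x)) = 0" if h: "h \<in> ?V \<oplus> dsum z ?G" and "n \<in> J \<or> x \<notin> W n" for h n x
      using G[OF h, of n] that(2) C[of n] by (auto simp: supported_def fun_eq_iff split: if_splits)
    show "v h \<in> glued z W C" if h: "h \<in> ?V \<oplus> dsum z ?G" for h
    proof -
      have "cut (W n) (v h) \<in> C n" for n
      proof (cases "n \<in> J")
        case True
        then show ?thesis by (simp add: fin)
      next
        case False
        have "cut (W n) (v h) = (\<lambda>x. h (Inr (n, x)))"
          using vW[of _ n h] G0[OF h, of n] False by (auto simp: cut_def fun_eq_iff)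
        then show ?thesis using G[OF h, of n] False by simp
      qed
      moreover have "shrinking z W (v h)"
        unfolding shrinking_def
      proof (intro impI allI)
        fix \<epsilon> :: real assume ze: z "0 < \<epsilon>"
        obtain N where N: "\<forall>n\<ge>N. \<forall>x\<in>V n. \<bar>h (Inl x)\<bar> \<le> \<epsilon>"
          using sum(1)[OF h] ze by (auto simp: glued_def shrinking_def)
        obtain N' where N': "\<forall>n\<ge>N'. \<forall>x. \<bar>h (Inr (n, x))\<bar> \<le> \<epsilon>"
          using dsumD(2)[OF sum(2)[OF h] ze] by auto
        have "\<bar>v h x\<bar> \<le> \<epsilon>" if "n \<ge> max N N'" "x \<in> W n" for n x
          using that N N' vW[OF that(2), of h] by (auto simp: V_def)
        then show "\<exists>N. \<forall>n\<ge>N. \<forall>x\<in>W n. \<bar>v h x\<bar> \<le> \<epsilon>" by blast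
      qed
      moreover have "v h \<in> supported (\<Union>n. W n)"
        using DW by (auto simp: supported_def v_def)
      ultimately show ?thesis by (simp add: glued_def)
    qed
    show "v (u f) = f" if f: "f \<in> glued z W C" for f
    proof
      fix x
      show "v (u f) x = f x"
      proof (cases "x \<in> (\<Union>n. W n)")
        case True
        then obtain n where "x \<in> W n" by blast
        then show ?thesis
          using vW[of x n "u f"] D_iff[of x n] by (simp add: u_def)
      next
        case False
        then have "v (u f) x = 0" using DW by (auto simp: v_def)
        moreover have "f x = 0" using f False by (simp add: glued_def supported_def)
        ultimately show ?thesis by simp
      qed
    qed
    show "u (v h) = h" if h: "h \<in> ?V \<oplus> dsum z ?G" for h
    proof
      fix i
      show "u (v h) i = h i"
      proof (cases i)
        case (Inl x)
        have "h (Inl x) = 0" if "x \<notin> ?D"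
          using sum(1)[OF h] that by (simp add: glued_def supported_def)
        then show ?thesis by (simp add: Inl u_def v_def cut_def)
      next
        case (Inr nx)
        obtain n x where nx: "nx = (n, x)" by (cases nx)
        show ?thesis
          using G0[OF h, of n x] vW[of x n h] by (auto simp: Inr nx u_def cut_def)
      qed
    qed
  qed
qed

text \<open>Split off all finite pieces. If infinite pieces remain, their sum is self-absorbing, and it either
  absorbs the finite pieces, when these have finitely many points altogether, or is joined by another
  self-absorbing space.\<close>

lemma glued_dichotomy:
  assumes disj: "disjoint_family W" and C: "\<And>n. C n \<subseteq> supported (W n)"
    and dich: "\<And>n. finite (W n) \<and> C n = supported (W n) \<or> self_absorbing (C n)"
  shows "finite (\<Union>n. W n) \<and> glued z W C = supported (\<Union>n. W n) \<or> self_absorbing (glued z W C)"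
proof -
  define J where "J = {n. finite (W n) \<and> C n = supported (W n)}"
  define V where "V = (\<lambda>n. if n \<in> J then W n else {})"
  let ?G = "\<lambda>n. if n \<in> J then {\<lambda>_. 0} else C n"
  have V: "disjoint_family V" "\<And>n. finite (V n)"
    using disj by (auto simp: V_def J_def disjoint_family_on_def)
  show ?thesis
  proof (cases "J = UNIV")
    case True
    then have "C = (\<lambda>n. supported (W n))" "\<And>n. finite (W n)"
      by (auto simp: J_def)
    then show ?thesis
      using glued_finite[OF disj] glued_finite_self_absorbing[OF _ disj] by auto
  next
    case False
    then obtain m where m: "m \<notin> J" by blast
    have sa: "self_absorbing (C n)" if "n \<notin> J" for n
      using dich[of n] that by (auto simp: J_def)
    have zero: "{\<lambda>_. 0 :: real} \<simeq> {\<lambda>_. 0} \<oplus> {\<lambda>_. 0}"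
      by (rule coordinatewise_equiv[where u = "\<lambda>_ _. 0" and v = "\<lambda>_ _. 0"])
        (auto simp: dsum2_def fun_eq_iff split_sum_all intro!: coordinatewiseI)
    have "dsum z ?G \<simeq> dsum z ?G \<oplus> dsum z ?G"
      by (rule dsum_square) (use sa zero in \<open>auto simp: self_absorbing_def\<close>)
    moreover have absorb: "dsum z ?G \<simeq> scalars \<oplus> dsum z ?G"
      by (rule dsum_absorbs_scalars[of _ m]) (use sa m in \<open>auto simp: self_absorbing_def\<close>)
    ultimately have G: "self_absorbing (dsum z ?G)"
      by (simp add: self_absorbing_def)
    have split: "glued z W C \<simeq> glued z V (\<lambda>n. supported (V n)) \<oplus> dsum z ?G"
      unfolding V_def by (rule glued_split[OF disj C]) (simp add: J_def)
    have "self_absorbing (glued z V (\<lambda>n. supported (V n)) \<oplus> dsum z ?G)"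
    proof (cases "finite (\<Union>n. V n)")
      case True
      show ?thesis
        unfolding glued_finite[OF V(1) True]
        by (rule self_absorbing_cong[OF almost_isometric_sym[OF supported_finite_dsum2[OF True absorb]] G])
    next
      case False
      show ?thesis
        by (rule dsum2_self_absorbing[OF glued_finite_self_absorbing[OF V(2,1) False] G])
    qed
    then show ?thesis
      using self_absorbing_cong[OF almost_isometric_sym[OF split]] by blast
  qed
qed

section \<open>Annuli in countable metrizable spaces\<close>

text \<open>What is used of a metric: around each point \<open>p\<close> the rest of the space is partitioned into
  clopen annuli, which converge to \<open>p\<close>. By the last axiom, centres whose \<open>n\<close>-th annulus contains
  a fixed point \<open>x\<close> converge to \<open>x\<close> as \<open>n\<close> grows.\<close>

locale annular_space =
  fixes X :: "'a topology" and ann :: "'a \<Rightarrow> nat \<Rightarrow> 'a set"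
  assumes openin_ann: "p \<in> topspace X \<Longrightarrow> openin X (ann p n)"
    and closedin_ann: "p \<in> topspace X \<Longrightarrow> closedin X (ann p n)"
    and disjoint_ann: "p \<in> topspace X \<Longrightarrow> m \<noteq> n \<Longrightarrow> ann p m \<inter> ann p n = {}"
    and Union_ann: "p \<in> topspace X \<Longrightarrow> (\<Union>n. ann p n) = topspace X - {p}"
    and ann_converge: "openin X U \<Longrightarrow> p \<in> U \<Longrightarrow> \<exists>N. \<forall>n\<ge>N. ann p n \<subseteq> U"
    and centre_converge: "openin X U \<Longrightarrow> x \<in> U \<Longrightarrow>
      \<exists>N. \<forall>n\<ge>N. \<forall>p\<in>topspace X. x \<in> ann p n \<longrightarrow> p \<in> U"

text \<open>Only countably many distances occur, so there are radii tending to zero that are not distances.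
  Balls with these radii are clopen.\<close>

lemma annular_space_exists:
  assumes "metrizable_space X" "countable (topspace X)"
  shows "\<exists>ann. annular_space X ann"
proof -
  obtain M d where Md: "Metric_space M d" and X: "X = Metric_space.mtopology M d"
    using assms(1) unfolding metrizable_space_def by blast
  interpret Metric_space M d by (rule Md)
  have M: "topspace X = M" by (simp add: X)
  define D where "D = (\<lambda>(x, y). d x y) ` (M \<times> M)"
  have "countable D" using assms(2) by (simp add: D_def M)
  have "\<exists>r. 1 / real (n + 2) < r \<and> r < 1 / real (n + 1) \<and> r \<notin> D" for n
  proof -
    have "1 / real (n + 2) < 1 / real (n + 1)" by (simp add: field_simps)
    then have "uncountable {1 / real (n + 2) <..< 1 / real (n + 1)}"
      by (simp add: uncountable_open_interval)
    then have "\<not> {1 / real (n + 2) <..< 1 / real (n + 1)} \<subseteq> D"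
      using \<open>countable D\<close> countable_subset by blast
    then show ?thesis by auto
  qed
  then obtain r where r: "\<And>n. 1 / real (n + 2) < r n" "\<And>n. r n < 1 / real (n + 1)" "\<And>n. r n \<notin> D"
    by metis
  have r_pos: "r n > 0" for n
    using r(1)[of n] by (rule less_trans[rotated]) simp
  have r_Suc: "r (Suc n) < r n" for n
    using r(2)[of "Suc n"] r(1)[of n] by simp
  have r_less: "r n < r m" if "m < n" for m n
  proof -
    have "- r m < - r n"
      by (rule lift_Suc_mono_less[of "\<lambda>n. - r n"]) (use r_Suc that in auto)
    then show ?thesis by simp
  qed
  have r_tendsto: "\<exists>N. \<forall>n\<ge>N. r n < e" if "e > 0" for e
  proof -
    obtain N where "1 / real (Suc N) < e"
      by (rule nat_approx_posE[OF \<open>e > 0\<close>])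
    then have "r N < e" using r(2)[of N] by simp
    moreover have "r n \<le> r N" if "n \<ge> N" for n
      using r_less[of N n] that by (cases "n = N") auto
    ultimately have "\<forall>n\<ge>N. r n < e" using le_less_trans by blast
    then show ?thesis by blast
  qed
  have clopen: "openin X (mball p (r n))" "closedin X (mball p (r n))" for p n
  proof -
    show "openin X (mball p (r n))" by (simp add: X)
    have "mball p (r n) = mcball p (r n)"
      using r(3)[of n] by (force simp: D_def)
    then show "closedin X (mball p (r n))" by (simp add: X)
  qed
  define big where "big p n = (if n = 0 then M else mball p (r (n - 1)))" for p n
  define ann where "ann p n = big p n - mball p (r n)" for p n
  have big: "openin X (big p n)" "closedin X (big p n)" for p n
    using clopen openin_topspace[of X] closedin_topspace[of X] by (simp_all add: big_def M)
  have in_ann: "x \<in> ann p n \<longleftrightarrow> x \<in> M \<and> p \<in> M \<and> r n \<le> d p x \<and> (n = 0 \<or> d p x < r (n - 1))"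
    if "p \<in> M" for p x n
    using that by (auto simp: ann_def big_def)
  have "annular_space X ann"
  proof
    fix p m n assume p: "p \<in> topspace X"
    show "openin X (ann p n)" "closedin X (ann p n)"
      unfolding ann_def by (intro openin_diff closedin_diff big clopen)+
    show "ann p m \<inter> ann p n = {}" if "m \<noteq> n"
    proof -
      have "\<not> (r i \<le> t \<and> t < r (j - 1))" if "i < j" for i j t
      proof (cases "i = j - 1")
        case False
        then have "i < j - 1" using that by linarith
        then show ?thesis using r_less[of i "j - 1"] by linarith
      qed auto
      then have "\<not> (x \<in> ann p i \<and> x \<in> ann p j)" if "i < j" for x i j
        using in_ann that p M by (metis less_nat_zero_code)
      then show ?thesis using that by (meson disjoint_iff linorder_neqE_nat)
    qed
    show "(\<Union>n. ann p n) = topspace X - {p}"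
    proof
      show "(\<Union>n. ann p n) \<subseteq> topspace X - {p}"
      proof
        fix x assume "x \<in> (\<Union>n. ann p n)"
        then obtain n where "x \<in> M" "r n \<le> d p x" using in_ann p M by blast
        moreover have "d p p = 0" using p M by simp
        ultimately show "x \<in> topspace X - {p}" using r_pos[of n] M by auto
      qed
      show "topspace X - {p} \<subseteq> (\<Union>n. ann p n)"
      proof
        fix x assume x: "x \<in> topspace X - {p}"
        then have "d p x > 0" using p M by auto
        then obtain N where "r N \<le> d p x" using r_tendsto less_imp_le by blast
        define n where "n = (LEAST n. r n \<le> d p x)"
        have "r n \<le> d p x" unfolding n_def by (rule LeastI) fact
        moreover have "n = 0 \<or> d p x < r (n - 1)"
          using not_less_Least[of "n - 1" "\<lambda>n. r n \<le> d p x"] unfolding n_def[symmetric] by force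
        ultimately have "x \<in> ann p n" using in_ann p x M by auto
        then show "x \<in> (\<Union>n. ann p n)" by blast
      qed
    qed
  next
    have near: "d p x < r (n - 1)" if "x \<in> ann p n" "n > 0" "p \<in> M" for x p n
      using in_ann that by auto
    show "\<exists>N. \<forall>n\<ge>N. ann p n \<subseteq> U" if U: "openin X U" "p \<in> U" for U p
    proof -
      have "p \<in> M" using U openin_subset M by blast
      obtain e where e: "e > 0" "mball p e \<subseteq> U"
        using U unfolding X openin_mtopology by blast
      obtain N where N: "\<forall>n\<ge>N. r n < e" using r_tendsto e(1) by blast
      have "ann p n \<subseteq> U" if "n \<ge> Suc N" for n
      proof
        fix x assume x: "x \<in> ann p n"
        have "d p x < e" using near[OF x] that N[rule_format, of "n - 1"] \<open>p \<in> M\<close> by force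
        then show "x \<in> U" using e(2) x in_ann \<open>p \<in> M\<close> by auto
      qed
      then show ?thesis by blast
    qed
    show "\<exists>N. \<forall>n\<ge>N. \<forall>p\<in>topspace X. x \<in> ann p n \<longrightarrow> p \<in> U" if U: "openin X U" "x \<in> U" for U x
    proof -
      have "x \<in> M" using U openin_subset M by blast
      obtain e where e: "e > 0" "mball x e \<subseteq> U"
        using U unfolding X openin_mtopology by blast
      obtain N where N: "\<forall>n\<ge>N. r n < e" using r_tendsto e(1) by blast
      have "p \<in> U" if "n \<ge> Suc N" "p \<in> topspace X" "x \<in> ann p n" for n p
      proof -
        have "d p x < e" using near[OF that(3)] that N[rule_format, of "n - 1"] M by force
        then have "p \<in> mball x e" using that M \<open>x \<in> M\<close> by (simp add: commute)
        then show ?thesis using e(2) by blast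
      qed
      then show ?thesis by blast
    qed
  qed
  then show ?thesis by blast
qed


section \<open>Trees of nested boxes\<close>

text \<open>A countable metrizable space is coded by a tree: choose a point, partition the rest into clopen
  annuli around it, choose a point in each annulus, and so on. If the points are chosen in the order of a
  fixed enumeration, every point is chosen at a finite stage, and a map between two such spaces that
  respects the trees is continuous. Nodes are lists of numbers with the most recent choice in front.\<close>

lemma continuous_map_nbhdI:
  assumes "\<And>x. x \<in> topspace X \<Longrightarrow> f x \<in> topspace Y"
    and "\<And>x U. x \<in> topspace X \<Longrightarrow> openin Y U \<Longrightarrow> f x \<in> U \<Longrightarrow>
      \<exists>V. openin X V \<and> x \<in> V \<and> (\<forall>y\<in>V. f y \<in> U)"
  shows "continuous_map X Y f"
  unfolding continuous_map_eq_topcontinuous_at topcontinuous_at_def using assms by simp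

text \<open>The last axiom makes the descent of a point into smaller and smaller boxes come to an end.\<close>

locale box_tree =
  fixes X :: "'a topology" and T :: "nat list set" and B :: "nat list \<Rightarrow> 'a set"
  assumes root: "[] \<in> T" "B [] = topspace X"
    and parent: "n # s \<in> T \<Longrightarrow> s \<in> T"
    and box_mono: "n # s \<in> T \<Longrightarrow> B (n # s) \<subseteq> B s"
    and box_disjoint: "m # s \<in> T \<Longrightarrow> n # s \<in> T \<Longrightarrow> m \<noteq> n \<Longrightarrow> B (m # s) \<inter> B (n # s) = {}"
    and box_open: "s \<in> T \<Longrightarrow> openin X (B s)"
    and box_closed: "s \<in> T \<Longrightarrow> closedin X (B s)"
    and box_depth: "x \<in> topspace X \<Longrightarrow> \<exists>N. \<forall>s\<in>T. x \<in> B s \<longrightarrow> length s \<le> N"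
begin

text \<open>The node at which the descent of \<open>x\<close> ends.\<close>

definition stops :: "'a \<Rightarrow> nat list \<Rightarrow> bool"
  where "stops x s \<longleftrightarrow> s \<in> T \<and> x \<in> B s \<and> (\<forall>n. n # s \<in> T \<longrightarrow> x \<notin> B (n # s))"

definition stop :: "'a \<Rightarrow> nat list"
  where "stop x = (THE s. stops x s)"

lemma append_parent: "u @ s \<in> T \<Longrightarrow> s \<in> T"
  by (induction u) (auto dest: parent)

lemma append_mono: "u @ s \<in> T \<Longrightarrow> B (u @ s) \<subseteq> B s"
  by (induction u) (auto dest: parent box_mono)

lemma stops_extends:
  assumes "stops x s" "t \<in> T" "x \<in> B t"
  shows "\<exists>u. s = u @ t"
  using assms(2,3)
proof (induction t)
  case (Cons n t)
  have "t \<in> T" "x \<in> B t" using Cons.prems parent box_mono by blast+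
  then obtain u where u: "s = u @ t" using Cons.IH by blast
  show ?case
  proof (cases u rule: rev_cases)
    case Nil
    then show ?thesis using assms(1) Cons.prems u by (simp add: stops_def)
  next
    case (snoc u' m)
    then have s: "s = u' @ (m # t)" using u by simp
    then have "m # t \<in> T" "x \<in> B (m # t)"
      using assms(1) append_parent append_mono unfolding stops_def by blast+
    then have "m = n" using box_disjoint Cons.prems by blast
    then show ?thesis using s by blast
  qed
qed simp

lemma stops_unique:
  assumes "stops x s" "stops x t"
  shows "s = t"
proof -
  obtain u v where "s = u @ t" "t = v @ s"
    using stops_extends assms unfolding stops_def by metis
  then show ?thesis by simp
qed

lemma stops_stop:
  assumes "x \<in> topspace X"
  shows "stops x (stop x)"
proof -
  let ?P = "\<lambda>s. s \<in> T \<and> x \<in> B s"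
  obtain N where N: "\<forall>s\<in>T. x \<in> B s \<longrightarrow> length s \<le> N"
    using box_depth[OF assms] by blast
  have "?P []" using root assms by simp
  moreover have "\<forall>s. ?P s \<longrightarrow> length s < Suc N" using N by (simp add: less_Suc_eq_le)
  ultimately have "\<exists>s. ?P s \<and> (\<forall>t. ?P t \<longrightarrow> length t \<le> length s)"
    by (rule ex_has_greatest_nat[where f = length])
  then obtain s where s: "s \<in> T" "x \<in> B s" "\<And>t. t \<in> T \<Longrightarrow> x \<in> B t \<Longrightarrow> length t \<le> length s"
    by auto
  have "stops x s"
    unfolding stops_def
  proof (intro conjI allI impI notI)
    fix n assume "n # s \<in> T" "x \<in> B (n # s)"
    then have "length (n # s) \<le> length s" by (rule s(3))
    then show False by simp
  qed (use s in auto)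
  show ?thesis
    unfolding stop_def
    by (rule theI[of _ s]) (fact \<open>stops x s\<close>, rule stops_unique[OF _ \<open>stops x s\<close>])
qed

lemma stop_eq: "x \<in> topspace X \<Longrightarrow> stops x s \<Longrightarrow> stop x = s"
  using stops_stop stops_unique by blast

lemma box_topspace: "s \<in> T \<Longrightarrow> B s \<subseteq> topspace X"
  by (simp add: box_open openin_subset)

text \<open>If \<open>y\<close> is close to \<open>x\<close>, then it enters the box in which \<open>x\<close> stops and either stops there too or
  continues into a child with a large number. The boxes of these children in \<open>Y\<close> are close
  to \<open>q (stop x)\<close>.\<close>

lemma continuous_map_stop:
  assumes D: "box_tree Y T D" and q: "\<And>s. s \<in> T \<Longrightarrow> q s \<in> D s"
    and conv: "\<And>s U. s \<in> T \<Longrightarrow> openin Y U \<Longrightarrow> q s \<in> U \<Longrightarrow>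
      \<exists>N. \<forall>n\<ge>N. n # s \<in> T \<longrightarrow> D (n # s) \<subseteq> U"
  shows "continuous_map X Y (\<lambda>x. q (stop x))"
proof -
  interpret D: box_tree Y T D by (rule D)
  show ?thesis
  proof (rule continuous_map_nbhdI)
    fix x assume x: "x \<in> topspace X"
    define s where "s = stop x"
    have s: "s \<in> T" "x \<in> B s" "\<And>n. n # s \<in> T \<Longrightarrow> x \<notin> B (n # s)"
      using stops_stop[OF x] by (auto simp: stops_def s_def)
    show "q (stop x) \<in> topspace Y"
      using q[OF s(1)] D.box_topspace[OF s(1)] by (auto simp: s_def)
    fix U assume U: "openin Y U" "q (stop x) \<in> U"
    then obtain N where N: "\<And>n. n \<ge> N \<Longrightarrow> n # s \<in> T \<Longrightarrow> D (n # s) \<subseteq> U"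
      using conv[OF s(1) U(1)] unfolding s_def by blast
    \<comment> \<open>Since \<open>x\<close> stops at \<open>s\<close>, it is in none of the boxes that are removed.\<close>
    define V where "V = B s - (\<Union>n\<in>{n. n < N \<and> n # s \<in> T}. B (n # s))"
    have "openin X V"
      unfolding V_def using s(1)
      by (intro openin_diff closedin_Union box_open) (auto intro: box_closed)
    moreover have "x \<in> V" using s by (auto simp: V_def)
    moreover have "q (stop y) \<in> U" if "y \<in> V" for y
    proof -
      have y: "y \<in> B s" "y \<in> topspace X"
        using that box_topspace[OF s(1)] by (auto simp: V_def)
      note st = stops_stop[OF y(2)]
      obtain u where u: "stop y = u @ s"
        using stops_extends[OF st s(1) y(1)] by blast
      show ?thesis
      proof (cases u rule: rev_cases)
        case Nil
        then show ?thesis using u U by (simp add: s_def)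
      next
        case (snoc u' n)
        then have eq: "stop y = u' @ (n # s)" using u by simp
        have "u' @ (n # s) \<in> T" "y \<in> B (u' @ (n # s))" using st by (simp_all add: stops_def eq)
        then have n: "n # s \<in> T" "y \<in> B (n # s)"
          using append_parent append_mono by blast+
        then have "n \<ge> N" using that by (auto simp: V_def not_less[symmetric])
        have "q (stop y) \<in> D (n # s)"
          using q[of "stop y"] D.append_mono[of u' "n # s"] \<open>u' @ (n # s) \<in> T\<close> by (auto simp: eq)
        then show ?thesis using N[OF \<open>n \<ge> N\<close> n(1)] by blast
      qed
    qed
    ultimately show "\<exists>V. openin X V \<and> x \<in> V \<and> (\<forall>y\<in>V. q (stop y) \<in> U)" by blast
  qed
qed

end

text \<open>The tree that is generated by annuli, with the points chosen in \<open>K\<close>. At a node of depth \<open>l\<close>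
  with box \<open>S\<close>, the \<open>n\<close>-th child belongs to the annulus with number \<open>sel l S n\<close>; the others are left out.
  The condition \<open>l \<le> sel l S n\<close>, imposed if \<open>K\<close> is not the whole space, makes the centres along an infinite branch
  converge to each common point of its boxes, so such a point would be in the closed set \<open>K\<close>.\<close>

locale annular_tree = annular_space X ann
  for X :: "'a topology" and ann +
  fixes K :: "'a set" and idx :: "'a \<Rightarrow> nat" and sel :: "nat \<Rightarrow> 'a set \<Rightarrow> nat \<Rightarrow> nat"
  assumes K_closed: "closedin X K"
    and idx_inj: "inj_on idx (topspace X)"
    and sel_mono: "K \<inter> S \<noteq> {} \<Longrightarrow> strict_mono (sel l S)"
    and sel_ge: "K \<noteq> topspace X \<Longrightarrow> K \<inter> S \<noteq> {} \<Longrightarrow> l \<le> sel l S n"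
begin

definition first :: "'a set \<Rightarrow> 'a"
  where "first S = arg_min idx (\<lambda>x. x \<in> K \<inter> S)"

primrec box :: "nat list \<Rightarrow> 'a set"
  where "box [] = topspace X"
  | "box (n # s) = box s \<inter> ann (first (box s)) (sel (length s) (box s) n)"

definition nodes :: "nat list set"
  where "nodes = {s. K \<inter> box s \<noteq> {}}"

definition pt :: "nat list \<Rightarrow> 'a"
  where "pt s = first (box s)"

lemma K_topspace: "K \<subseteq> topspace X"
  using K_closed by (rule closedin_subset)

lemma pt_in: "s \<in> nodes \<Longrightarrow> pt s \<in> K" "s \<in> nodes \<Longrightarrow> pt s \<in> box s"
  and idx_pt_le: "x \<in> K \<Longrightarrow> x \<in> box s \<Longrightarrow> idx (pt s) \<le> idx x"
  using arg_min_nat_lemma[of "\<lambda>x. x \<in> K \<inter> box s" _ idx]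
  by (auto simp: nodes_def pt_def first_def)

lemma pt_topspace: "s \<in> nodes \<Longrightarrow> pt s \<in> topspace X"
  using pt_in K_topspace by blast

lemma box_Cons: "box (n # s) = box s \<inter> ann (pt s) (sel (length s) (box s) n)"
  by (simp add: pt_def)

declare box.simps(2) [simp del]

lemma nodes_parent: "n # s \<in> nodes \<Longrightarrow> s \<in> nodes"
  by (auto simp: nodes_def box_Cons)

lemma pt_notin_child: "s \<in> nodes \<Longrightarrow> pt s \<notin> box (n # s)"
  using Union_ann[OF pt_topspace] by (auto simp: box_Cons)

lemma box_clopen: "s \<in> nodes \<Longrightarrow> openin X (box s) \<and> closedin X (box s)"
proof (induction s)
  case (Cons n s)
  then have "s \<in> nodes" by (rule_tac nodes_parent)
  then show ?case
    using Cons.IH openin_ann[OF pt_topspace] closedin_ann[OF pt_topspace]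
    by (auto simp: box_Cons intro: openin_Int closedin_Int)
qed simp

lemma length_le_idx: "s \<in> nodes \<Longrightarrow> length s \<le> idx (pt s)"
proof (induction s)
  case (Cons n s)
  note s = nodes_parent[OF Cons.prems]
  have "pt (n # s) \<in> box s" using pt_in(2)[OF Cons.prems] by (simp add: box_Cons)
  then have "idx (pt s) \<le> idx (pt (n # s))"
    using pt_in(1)[OF Cons.prems] by (rule_tac idx_pt_le)
  moreover have "pt s \<noteq> pt (n # s)"
    using pt_notin_child[OF s] pt_in(2)[OF Cons.prems] by metis
  then have "idx (pt s) \<noteq> idx (pt (n # s))"
    using inj_on_eq_iff[OF idx_inj pt_topspace[OF s] pt_topspace[OF Cons.prems]] by simp
  ultimately show ?case using Cons.IH[OF s] by simp
qed simp

text \<open>Points of \<open>K\<close> lie only in boxes of bounded depth because the chosen points have strictly increasing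
  positions in the enumeration. Points outside \<open>K\<close> do so because their distance from the centres in
  \<open>K\<close> stays away from zero.\<close>

lemma box_tree_box:
  assumes "T \<subseteq> nodes" "[] \<in> T" "\<And>n s. n # s \<in> T \<Longrightarrow> s \<in> T"
  shows "box_tree X T box"
proof
  fix s m n
  show "box (m # s) \<inter> box (n # s) = {}" if "m # s \<in> T" "n # s \<in> T" "m \<noteq> n"
  proof -
    have s: "s \<in> nodes" using that assms by blast
    then have "K \<inter> box s \<noteq> {}" by (simp add: nodes_def)
    then have "sel (length s) (box s) m \<noteq> sel (length s) (box s) n"
      using sel_mono that(3) by (metis strict_mono_eq)
    then show ?thesis
      using disjoint_ann[OF pt_topspace[OF s]] by (auto simp: box_Cons)
  qed
  show "openin X (box s)" "closedin X (box s)" if "s \<in> T"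
    using box_clopen assms(1) that by blast+
next
  fix x assume x: "x \<in> topspace X"
  show "\<exists>N. \<forall>s\<in>T. x \<in> box s \<longrightarrow> length s \<le> N"
  proof (cases "x \<in> K")
    case True
    then show ?thesis
      using length_le_idx idx_pt_le assms(1) by (meson order_trans subsetD)
  next
    case False
    then have K: "K \<noteq> topspace X" using x by blast
    have "openin X (topspace X - K)" "x \<in> topspace X - K"
      using K_closed x False by auto
    from centre_converge[OF this] obtain N
      where N: "\<And>n p. n \<ge> N \<Longrightarrow> p \<in> topspace X \<Longrightarrow> x \<in> ann p n \<Longrightarrow> p \<in> topspace X - K" by blast
    have "length s \<le> N" if s: "s \<in> T" "x \<in> box s" for s
    proof (cases s)
      case (Cons n t)
      then have t: "t \<in> nodes" using s assms by blast
      then have "K \<inter> box t \<noteq> {}" by (simp add: nodes_def)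
      then have "length t \<le> sel (length t) (box t) n" using sel_ge[OF K] by blast
      moreover have "sel (length t) (box t) n < N"
      proof (rule ccontr)
        assume "\<not> sel (length t) (box t) n < N"
        moreover have "x \<in> ann (pt t) (sel (length t) (box t) n)"
          using s(2) by (simp add: Cons box_Cons)
        ultimately show False
          using N[OF _ pt_topspace[OF t]] pt_in(1)[OF t] by (meson DiffD2 not_less)
      qed
      ultimately show ?thesis by (simp add: Cons)
    qed simp
    then show ?thesis by blast
  qed
qed (use assms box_Cons in auto)

lemma box_converge:
  assumes s: "s \<in> nodes" and U: "openin X U" "pt s \<in> U"
  shows "\<exists>N. \<forall>n\<ge>N. box (n # s) \<subseteq> U"
proof -
  obtain N where N: "\<And>n. n \<ge> N \<Longrightarrow> ann (pt s) n \<subseteq> U"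
    using ann_converge[OF U] by blast
  have "strict_mono (sel (length s) (box s))"
    using s by (intro sel_mono) (simp add: nodes_def)
  then have "n \<le> sel (length s) (box s) n" for n
    by (rule strict_mono_imp_increasing)
  then have "box (n # s) \<subseteq> U" if "n \<ge> N" for n
    using N[of "sel (length s) (box s) n"] that by (auto simp: box_Cons intro: order_trans)
  then show ?thesis by blast
qed

end

text \<open>Code \<open>Y\<close> by its tree. Since \<open>K\<close> has no isolated points, infinitely many annuli around each
  chosen point of \<open>K\<close> meet \<open>K\<close>, and selecting them gives a tree in \<open>X\<close> with the same nodes. Sending the
  point of \<open>Y\<close> at a node to the point of \<open>K\<close> at that node embeds \<open>Y\<close>; sending every point of \<open>X\<close> to the
  point of \<open>Y\<close> at the node where it stops is a retraction.\<close>

lemma countable_retract_of_crowded: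
  assumes X: "metrizable_space X" "countable (topspace X)"
    and Y: "metrizable_space Y" "countable (topspace Y)" "topspace Y \<noteq> {}"
    and K: "closedin X K" "K \<noteq> {}"
    and crowded: "\<And>x U. x \<in> K \<Longrightarrow> openin X U \<Longrightarrow> x \<in> U \<Longrightarrow> \<exists>y\<in>K \<inter> U. y \<noteq> x"
  shows "\<exists>e r. continuous_map Y X e \<and> continuous_map X Y r \<and> (\<forall>y\<in>topspace Y. r (e y) = y)"
proof -
  obtain annX annY where annX: "annular_space X annX" and annY: "annular_space Y annY"
    using annular_space_exists[OF X] annular_space_exists[OF Y(1,2)] by blast
  interpret AX: annular_space X annX by (rule annX)
  define hits where "hits l S = {m. l \<le> m \<and>
      K \<inter> S \<inter> annX (arg_min (to_nat_on (topspace X)) (\<lambda>x. x \<in> K \<inter> S)) m \<noteq> {}}" for l S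
  \<comment> \<open>The second alternative does not occur at a node; it only makes \<open>selX\<close> strictly increasing everywhere.\<close>
  define selX where "selX l S = (if infinite (hits l S) then enumerate (hits l S) else (\<lambda>n. l + n))" for l S
  interpret X: annular_tree X annX K "to_nat_on (topspace X)" selX
  proof
    show "strict_mono (selX l S)" for l S
      by (auto simp: selX_def strict_mono_enumerate strict_mono_def)
    show "l \<le> selX l S n" for l S n
      using enumerate_in_set[of "hits l S" n] by (auto simp: selX_def hits_def)
  qed (use K X in auto)
  interpret Y: annular_tree Y annY "topspace Y" "to_nat_on (topspace Y)" "\<lambda>_ _ n. n"
  proof (intro annular_tree.intro annular_tree_axioms.intro annY)
  qed (use Y in \<open>auto simp: strict_mono_def\<close>)
  have hits: "infinite (hits (length s) (X.box s))" if s: "s \<in> X.nodes" for s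
  proof -
    have "\<exists>m\<ge>N. m \<in> hits (length s) (X.box s)" for N
    proof -
      define M where "M = max N (length s)"
      define U where "U = X.box s - (\<Union>m<M. annX (X.pt s) m)"
      have "openin X U"
        unfolding U_def using X.box_clopen[OF s] AX.closedin_ann[OF X.pt_topspace[OF s]]
        by (intro openin_diff closedin_Union) auto
      moreover have "X.pt s \<in> U"
        using X.pt_in[OF s] AX.Union_ann[OF X.pt_topspace[OF s]] by (auto simp: U_def)
      ultimately obtain y where y: "y \<in> K" "y \<in> U" "y \<noteq> X.pt s"
        using crowded[OF X.pt_in(1)[OF s]] by blast
      then have "y \<in> (\<Union>m. annX (X.pt s) m)"
        using AX.Union_ann[OF X.pt_topspace[OF s]] X.K_topspace by blast
      then obtain m where m: "y \<in> annX (X.pt s) m" by blast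
      have "\<not> m < M" using m y(2) by (auto simp: U_def)
      moreover have "y \<in> K \<inter> X.box s \<inter> annX (X.pt s) m" using m y by (auto simp: U_def)
      ultimately have "m \<in> hits (length s) (X.box s)" "m \<ge> N"
        by (auto simp: hits_def M_def X.pt_def X.first_def)
      then show ?thesis by blast
    qed
    then show ?thesis unfolding infinite_nat_iff_unbounded_le by blast
  qed
  have nodes: "s \<in> X.nodes" for s
  proof (induction s)
    case Nil
    then show ?case using K X.K_topspace by (auto simp: X.nodes_def)
  next
    case (Cons n s)
    have "selX (length s) (X.box s) n \<in> hits (length s) (X.box s)"
      using hits[OF Cons.IH] by (simp add: selX_def enumerate_in_set)
    then show ?case
      by (auto simp: X.nodes_def X.box_Cons hits_def X.pt_def X.first_def)
  qed
  have YT: "[] \<in> Y.nodes" using Y(3) by (simp add: Y.nodes_def)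
  have BY: "box_tree Y Y.nodes Y.box"
    by (rule Y.box_tree_box[OF subset_refl YT Y.nodes_parent])
  have "Y.nodes \<subseteq> X.nodes" using nodes by blast
  then have BX: "box_tree X Y.nodes X.box"
    by (rule X.box_tree_box[OF _ YT Y.nodes_parent])
  interpret BY: box_tree Y Y.nodes Y.box by (rule BY)
  interpret BX: box_tree X Y.nodes X.box by (rule BX)
  define e where "e y = X.pt (BY.stop y)" for y
  define r where "r x = Y.pt (BX.stop x)" for x
  have "continuous_map Y X e"
    unfolding e_def
  proof (rule BY.continuous_map_stop[OF BX X.pt_in(2)[OF nodes]])
    fix s U assume "openin X U" "X.pt s \<in> U"
    from X.box_converge[OF nodes this]
    show "\<exists>N. \<forall>n\<ge>N. n # s \<in> Y.nodes \<longrightarrow> X.box (n # s) \<subseteq> U" by blast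
  qed
  moreover have "continuous_map X Y r"
    unfolding r_def
  proof (rule BX.continuous_map_stop[OF BY Y.pt_in(2)])
    fix s U assume "s \<in> Y.nodes" "openin Y U" "Y.pt s \<in> U"
    from Y.box_converge[OF this]
    show "\<exists>N. \<forall>n\<ge>N. n # s \<in> Y.nodes \<longrightarrow> Y.box (n # s) \<subseteq> U" by blast
  qed
  moreover have "r (e y) = y" if y: "y \<in> topspace Y" for y
  proof -
    let ?s = "BY.stop y"
    have s: "?s \<in> Y.nodes" "y \<in> Y.box ?s" "\<And>n. n # ?s \<in> Y.nodes \<Longrightarrow> y \<notin> Y.box (n # ?s)"
      using BY.stops_stop[OF y] by (auto simp: BY.stops_def)
    have "BX.stops (X.pt ?s) ?s"
      using s(1) X.pt_in(2)[OF nodes] X.pt_notin_child[OF nodes] by (simp add: BX.stops_def)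
    then have "BX.stop (e y) = ?s"
      unfolding e_def by (rule BX.stop_eq[OF X.pt_topspace[OF nodes]])
    moreover have "Y.pt ?s = y"
    proof (rule ccontr)
      assume "Y.pt ?s \<noteq> y"
      then have "y \<in> (\<Union>n. annY (Y.pt ?s) n)"
        unfolding Y.Union_ann[OF Y.pt_topspace[OF s(1)]] using y by simp
      then obtain n where "y \<in> annY (Y.pt ?s) n" by blast
      then have "y \<in> Y.box (n # ?s)" using s(2) by (simp add: Y.box_Cons)
      moreover have "n # ?s \<in> Y.nodes" using calculation y unfolding Y.nodes_def by blast
      ultimately show False using s(3) by blast
    qed
    ultimately show ?thesis by (simp add: r_def)
  qed
  ultimately show ?thesis by blast
qed

section \<open>Clopen pieces of a countable metrizable space\<close>

definition clopenin :: "'a topology \<Rightarrow> 'a set \<Rightarrow> bool"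
  where "clopenin X W \<longleftrightarrow> openin X W \<and> closedin X W"

lemma clopenin_Int: "clopenin X V \<Longrightarrow> clopenin X W \<Longrightarrow> clopenin X (V \<inter> W)"
  by (simp add: clopenin_def openin_Int closedin_Int)

lemma clopenin_diff: "clopenin X V \<Longrightarrow> clopenin X W \<Longrightarrow> clopenin X (V - W)"
  by (simp add: clopenin_def openin_diff closedin_diff)

lemma clopenin_UN_finite: "finite I \<Longrightarrow> (\<And>i. i \<in> I \<Longrightarrow> clopenin X (W i)) \<Longrightarrow> clopenin X (\<Union>i\<in>I. W i)"
  by (induction I rule: finite_induct) (auto simp: clopenin_def intro: openin_Un closedin_Un)

lemma clopenin_topspace [simp]: "clopenin X (topspace X)"
  by (simp add: clopenin_def)

lemma clopenin_subset: "clopenin X W \<Longrightarrow> W \<subseteq> topspace X"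
  by (simp add: clopenin_def openin_subset)

lemma cut_in_cfun:
  assumes "continuous_map (subtopology X W) euclideanreal f" "V \<subseteq> W" "V \<subseteq> topspace X"
  shows "cut V f \<in> cfun (subtopology X V)"
proof (rule cfunI)
  show "continuous_map (subtopology X V) euclideanreal (cut V f)"
    by (rule continuous_map_eq[OF continuous_map_from_subtopology_mono[OF assms(1,2)]]) simp
qed (use assms in \<open>auto simp: cut_def\<close>)

lemma cfun_supported: "W \<subseteq> topspace X \<Longrightarrow> cfun (subtopology X W) \<subseteq> supported W"
  by (auto simp: cfun_def supported_def)

lemma cfun_finite:
  assumes "t1_space X" "finite W" "W \<subseteq> topspace X" "openin X W"
  shows "cfun (subtopology X W) = supported W"
proof -
  have "t1_space (subtopology X W)" using assms(1) by (rule t1_space_subtopology)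
  then have "subtopology X W = discrete_topology W"
    using assms by (intro finite_t1_space_imp_discrete_topology) auto
  then show ?thesis by (auto simp: cfun_def supported_def)
qed

lemma continuous_on_open_piece:
  assumes V: "openin X V" "V \<subseteq> W" and W: "openin X W" and x: "x \<in> V"
    and f: "cut V f \<in> cfun (subtopology X V)" and U: "openin euclideanreal U" "f x \<in> U"
  shows "\<exists>O'. openin (subtopology X W) O' \<and> x \<in> O' \<and> (\<forall>y\<in>O'. f y \<in> U)"
proof -
  have top: "topspace (subtopology X V) = V"
    using openin_subset[OF V(1)] by auto
  have "openin (subtopology X V) {y \<in> topspace (subtopology X V). cut V f y \<in> U}"
    by (rule openin_continuous_map_preimage[OF cfunD(1)[OF f] U(1)])
  then have "openin X {y \<in> V. cut V f y \<in> U}"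
    unfolding top openin_open_subtopology[OF V(1)] by simp
  then have "openin (subtopology X W) {y \<in> V. cut V f y \<in> U}"
    using V(2) W by (auto simp: openin_open_subtopology)
  then show ?thesis using x U(2) by (intro exI[of _ "{y \<in> V. cut V f y \<in> U}"]) auto
qed

text \<open>On a union of open pieces continuity is a local condition, so the function space is the full
  product.\<close>

lemma cfun_eq_glued:
  assumes V: "\<And>n. openin X (V n)"
  shows "cfun (subtopology X (\<Union>n. V n)) = glued False V (\<lambda>n. cfun (subtopology X (V n)))"
    (is "cfun (subtopology X ?W) = _")
proof (intro equalityI subsetI)
  have W: "openin X ?W" using V by (intro openin_Union) auto
  have sub: "V n \<subseteq> topspace X" "?W \<subseteq> topspace X" for n
    using openin_subset[OF V] openin_subset[OF W] by auto
  show "f \<in> glued False V (\<lambda>n. cfun (subtopology X (V n)))" if f: "f \<in> cfun (subtopology X ?W)" for f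
    using cut_in_cfun[OF cfunD(1)[OF f] _ sub(1)] f cfun_supported[OF sub(2)]
    by (auto simp: glued_def shrinking_def)
  show "f \<in> cfun (subtopology X ?W)" if f: "f \<in> glued False V (\<lambda>n. cfun (subtopology X (V n)))" for f
  proof (rule cfunI)
    show "continuous_map (subtopology X ?W) euclideanreal f"
    proof (rule continuous_map_nbhdI)
      fix x U assume x: "x \<in> topspace (subtopology X ?W)" and U: "openin euclideanreal U" "f x \<in> U"
      then obtain n where n: "x \<in> V n" by auto
      have "cut (V n) f \<in> cfun (subtopology X (V n))" using f by (simp add: glued_def)
      then show "\<exists>O'. openin (subtopology X ?W) O' \<and> x \<in> O' \<and> (\<forall>y\<in>O'. f y \<in> U)"
        using UN_upper[of n UNIV V]
        by (intro continuous_on_open_piece[where V = "V n"] V W U n) auto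
    qed simp
    show "f x = 0" if "x \<notin> topspace (subtopology X ?W)" for x
    proof -
      have "x \<notin> ?W" using that sub(2) by auto
      then show ?thesis using f by (simp add: glued_def supported_def)
    qed
  qed
qed

text \<open>If the pieces converge to \<open>p\<close>, continuity at \<open>p\<close> of a function with \<open>f p = 0\<close> means that its
  suprema on the pieces tend to zero: a \<open>c\<^sub>0\<close>-sum.\<close>

lemma cfun_vanishing_eq_glued:
  assumes W: "clopenin X W" and p: "p \<in> W" and V: "\<And>n. clopenin X (V n)"
    and UV: "(\<Union>n. V n) = W - {p}"
    and conv: "\<And>U. openin X U \<Longrightarrow> p \<in> U \<Longrightarrow> \<exists>N. \<forall>n\<ge>N. V n \<subseteq> U"
  shows "{f \<in> cfun (subtopology X W). f p = 0} = glued True V (\<lambda>n. cfun (subtopology X (V n)))"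
proof (intro equalityI subsetI)
  have sub: "W \<subseteq> topspace X" "V n \<subseteq> topspace X" "V n \<subseteq> W" for n
    using clopenin_subset[OF W] clopenin_subset[OF V] UV by auto
  have openW: "openin X W" using W by (simp add: clopenin_def)
  have top: "topspace (subtopology X W) = W" using sub by auto
  show "f \<in> glued True V (\<lambda>n. cfun (subtopology X (V n)))"
    if "f \<in> {f \<in> cfun (subtopology X W). f p = 0}" for f
  proof -
    have f: "f \<in> cfun (subtopology X W)" "f p = 0" using that by auto
    have "\<exists>N. \<forall>n\<ge>N. \<forall>x\<in>V n. \<bar>f x\<bar> \<le> \<epsilon>" if "\<epsilon> > 0" for \<epsilon>
    proof -
      have "openin (subtopology X W) {x \<in> topspace (subtopology X W). f x \<in> {-\<epsilon><..<\<epsilon>}}"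
        by (rule openin_continuous_map_preimage[OF cfunD(1)[OF f(1)]]) simp
      then have "openin X {x \<in> W. f x \<in> {-\<epsilon><..<\<epsilon>}}"
        unfolding top openin_open_subtopology[OF openW] by simp
      moreover have "p \<in> {x \<in> W. f x \<in> {-\<epsilon><..<\<epsilon>}}" using p f(2) that by simp
      ultimately obtain N where "\<forall>n\<ge>N. V n \<subseteq> {x \<in> W. f x \<in> {-\<epsilon><..<\<epsilon>}}"
        using conv by blast
      then have "\<forall>n\<ge>N. \<forall>x\<in>V n. \<bar>f x\<bar> \<le> \<epsilon>" by force
      then show ?thesis by blast
    qed
    then have "shrinking True V f" by (simp add: shrinking_def)
    moreover have "f \<in> supported (\<Union>n. V n)"
      using f cfun_supported[OF sub(1)] by (auto simp: UV supported_def)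
    ultimately show ?thesis
      using cut_in_cfun[OF cfunD(1)[OF f(1)] sub(3,2)] by (simp add: glued_def)
  qed
  show "f \<in> {f \<in> cfun (subtopology X W). f p = 0}"
    if "f \<in> glued True V (\<lambda>n. cfun (subtopology X (V n)))" for f
  proof -
    have f: "f \<in> supported (W - {p})" "\<And>n. cut (V n) f \<in> cfun (subtopology X (V n))" "shrinking True V f"
      using that by (simp_all add: glued_def UV)
    have fp: "f p = 0" using f(1) by (simp add: supported_def)
    have "continuous_map (subtopology X W) euclideanreal f"
    proof (rule continuous_map_nbhdI)
      fix x U assume x: "x \<in> topspace (subtopology X W)" and U: "openin euclideanreal U" "f x \<in> U"
      show "\<exists>O'. openin (subtopology X W) O' \<and> x \<in> O' \<and> (\<forall>y\<in>O'. f y \<in> U)"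
      proof (cases "x = p")
        case True
        then obtain \<epsilon> where \<epsilon>: "\<epsilon> > 0" "ball 0 \<epsilon> \<subseteq> U"
          using U fp open_contains_ball by (metis open_openin)
        have "\<exists>N. \<forall>n\<ge>N. \<forall>x\<in>V n. \<bar>f x\<bar> \<le> \<epsilon> / 2"
          using f(3) half_gt_zero[OF \<epsilon>(1)] unfolding shrinking_def by blast
        then obtain N where N: "\<And>n x. n \<ge> N \<Longrightarrow> x \<in> V n \<Longrightarrow> \<bar>f x\<bar> \<le> \<epsilon> / 2" by blast
        let ?O = "W - (\<Union>n\<in>{..<N}. V n)"
        have "clopenin X (\<Union>n\<in>{..<N}. V n)" by (rule clopenin_UN_finite) (use V in auto)
        then have "clopenin X ?O" by (rule clopenin_diff[OF W])
        then have "openin (subtopology X W) ?O"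
          using openW by (simp add: clopenin_def openin_open_subtopology)
        moreover have "f y \<in> U" if y: "y \<in> ?O" for y
        proof (cases "y = p")
          case True
          then show ?thesis using \<epsilon> fp by auto
        next
          case False
          then obtain n where n: "y \<in> V n" using y UV by blast
          then have "n \<ge> N" using y by (auto simp: not_less[symmetric])
          then have "\<bar>f y\<bar> < \<epsilon>" using N[OF _ n] \<epsilon>(1) by force
          then show ?thesis using \<epsilon>(2) by (auto simp: subset_iff)
        qed
        moreover have "x \<in> ?O" using True p UV by blast
        ultimately show ?thesis by blast
      next
        case False
        then obtain n where n: "x \<in> V n" using x UV top by blast
        have "openin X (V n)" using V by (simp add: clopenin_def)
        then show ?thesis by (rule continuous_on_open_piece[where f = f and x = x, OF _ sub(3) openW n f(2) U])
      qed
    qed simp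
    then show ?thesis
      using fp f(1) sub(1) by (auto simp: supported_def top intro!: cfunI)
  qed
qed

text \<open>The condition is imposed on all clopen subsets because covers by good pieces have to be made
  disjoint.\<close>

definition good_piece :: "'a topology \<Rightarrow> 'a set \<Rightarrow> bool"
  where "good_piece X W \<longleftrightarrow> clopenin X W \<and>
    (\<forall>V. clopenin X V \<and> V \<subseteq> W \<longrightarrow> finite V \<or> self_absorbing (cfun (subtopology X V)))"

context
  fixes X :: "'a topology"
  assumes metrizable: "metrizable_space X" and countable: "countable (topspace X)"
begin

lemma piece_dichotomy:
  assumes "clopenin X V" "finite V \<or> self_absorbing (cfun (subtopology X V))"
  shows "finite V \<and> cfun (subtopology X V) = supported V \<or> self_absorbing (cfun (subtopology X V))"
  using assms cfun_finite[OF metrizable_imp_t1_space[OF metrizable]] clopenin_subset[OF assms(1)]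
  by (auto simp: clopenin_def)

text \<open>By countability, countably many good pieces cover \<open>W\<close>; make them disjoint.\<close>

lemma clopen_in_good_union:
  assumes W: "clopenin X W" "W \<subseteq> \<Union>{G. good_piece X G}"
  shows "finite W \<or> self_absorbing (cfun (subtopology X W))"
proof (cases "W = {}")
  case False
  have "countable W"
    using countable clopenin_subset[OF W(1)] by (rule countable_subset[rotated])
  define x where "x = from_nat_into W"
  have x: "x n \<in> W" for n using False by (simp add: x_def from_nat_into)
  have "\<exists>G. good_piece X G \<and> x n \<in> G" for n using x[of n] W(2) by blast
  then obtain G where G: "\<And>n. good_piece X (G n)" "\<And>n. x n \<in> G n" by metis
  define V where "V n = W \<inter> disjointed G n" for n
  have V: "clopenin X (V n)" for n
    unfolding V_def disjointed_def using G(1)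
    by (intro clopenin_Int clopenin_diff clopenin_UN_finite W(1)) (auto simp: good_piece_def)
  have VG: "V n \<subseteq> G n" for n
    by (auto simp: V_def disjointed_def)
  have UV: "(\<Union>n. V n) = W"
  proof -
    have "W \<subseteq> range x" using range_from_nat_into[OF False \<open>countable W\<close>] by (simp add: x_def)
    then have "W \<subseteq> (\<Union>n. G n)" using G(2) by blast
    then have "W \<subseteq> (\<Union>n. disjointed G n)" by (simp add: UN_disjointed_eq)
    then show ?thesis by (auto simp: V_def)
  qed
  have disj: "disjoint_family V"
    using disjoint_family_disjointed[of G] by (auto simp: disjoint_family_on_def V_def)
  have eq: "cfun (subtopology X W) = glued False V (\<lambda>n. cfun (subtopology X (V n)))"
    using cfun_eq_glued[of X V] V by (simp add: UV clopenin_def)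
  have "finite (V n) \<or> self_absorbing (cfun (subtopology X (V n)))" for n
    using G(1)[of n] V[of n] VG[of n] by (simp add: good_piece_def)
  then have "finite (\<Union>n. V n) \<and> glued False V (\<lambda>n. cfun (subtopology X (V n))) = supported (\<Union>n. V n)
      \<or> self_absorbing (glued False V (\<lambda>n. cfun (subtopology X (V n))))"
    using piece_dichotomy[OF V] cfun_supported[OF clopenin_subset[OF V]]
    by (intro glued_dichotomy[OF disj]) auto
  then show ?thesis by (auto simp: UV eq)
qed simp

text \<open>The annuli around \<open>p\<close> are covered by good pieces and converge to \<open>p\<close>, which takes care of the functions
  that vanish at \<open>p\<close>. The value at \<open>p\<close> is one more scalar, by the retraction of \<open>W\<close> to the
  point \<open>p\<close>.\<close>

lemma clopen_with_one_bad_point: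
  assumes W: "clopenin X W" and p: "p \<in> W" and good: "W - {p} \<subseteq> \<Union>{G. good_piece X G}"
  shows "finite W \<or> self_absorbing (cfun (subtopology X W))"
proof -
  obtain ann where "annular_space X ann"
    using annular_space_exists[OF metrizable countable] by blast
  then interpret annular_space X ann .
  have pX: "p \<in> topspace X" using clopenin_subset[OF W] p by blast
  define V where "V n = W \<inter> ann p n" for n
  have V: "clopenin X (V n)" for n
    unfolding V_def using openin_ann[OF pX] closedin_ann[OF pX]
    by (intro clopenin_Int W) (simp add: clopenin_def)
  have UV: "(\<Union>n. V n) = W - {p}"
    using Union_ann[OF pX] clopenin_subset[OF W] by (auto simp: V_def)
  have disj: "disjoint_family V"
    using disjoint_ann[OF pX] by (auto simp: disjoint_family_on_def V_def)
  have conv: "\<exists>N. \<forall>n\<ge>N. V n \<subseteq> U" if "openin X U" "p \<in> U" for U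
    using ann_converge[OF that] by (auto simp: V_def)
  let ?H = "{f \<in> cfun (subtopology X W). f p = 0}"
  have eq: "?H = glued True V (\<lambda>n. cfun (subtopology X (V n)))"
    by (rule cfun_vanishing_eq_glued[OF W p V UV conv])
  have "finite (V n) \<or> self_absorbing (cfun (subtopology X (V n)))" for n
    using UV good by (intro clopen_in_good_union V) auto
  then have "finite (\<Union>n. V n) \<and> glued True V (\<lambda>n. cfun (subtopology X (V n))) = supported (\<Union>n. V n)
      \<or> self_absorbing (glued True V (\<lambda>n. cfun (subtopology X (V n))))"
    using piece_dichotomy[OF V] cfun_supported[OF clopenin_subset[OF V]]
    by (intro glued_dichotomy[OF disj]) auto
  then consider "finite W" | "self_absorbing ?H"
    unfolding UV eq[symmetric] by auto
  then show ?thesis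
  proof cases
    case 2
    let ?Y = "discrete_topology {()}"
    have "cfun (subtopology X W) \<simeq> cfun ?Y \<oplus> {f \<in> cfun (subtopology X W). \<forall>y\<in>topspace ?Y. f p = 0}"
      by (rule cfun_split_retract[where e = "\<lambda>_. p" and r = "\<lambda>_. ()"])
        (use p pX in auto)
    moreover have "cfun ?Y = scalars" by (auto simp: cfun_def)
    ultimately have "cfun (subtopology X W) \<simeq> scalars \<oplus> ?H" by simp
    then show ?thesis
      using self_absorbing_cong[OF almost_isometric_sym scalars_dsum2_self_absorbing[OF 2]] by blast
  qed simp
qed

text \<open>If \<open>x\<close> were isolated in the complement \<open>K\<close> of all good pieces, a clopen neighbourhood of \<open>x\<close> would
  have \<open>x\<close> as its only bad point. All its clopen subsets then satisfy the dichotomy, so it would be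
  good itself.\<close>

lemma crowded_kernel_or_self_absorbing:
  assumes "infinite (topspace X)"
  shows "self_absorbing (cfun X) \<or>
    (\<exists>K. closedin X K \<and> K \<noteq> {} \<and> (\<forall>x\<in>K. \<forall>U. openin X U \<and> x \<in> U \<longrightarrow> (\<exists>y\<in>K \<inter> U. y \<noteq> x)))"
proof -
  let ?G = "\<Union>{G. good_piece X G}"
  define K where "K = topspace X - ?G"
  have "openin X ?G" by (rule openin_Union) (auto simp: good_piece_def clopenin_def)
  then have "closedin X K" by (auto simp: K_def)
  show ?thesis
  proof (cases "K = {}")
    case True
    then have "finite (topspace X) \<or> self_absorbing (cfun (subtopology X (topspace X)))"
      by (intro clopen_in_good_union) (auto simp: K_def)
    then show ?thesis using assms by simp
  next
    case False
    have "\<exists>y\<in>K \<inter> U. y \<noteq> x" if x: "x \<in> K" and U: "openin X U" "x \<in> U" for x U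
    proof (rule ccontr)
      assume isolated: "\<not> (\<exists>y\<in>K \<inter> U. y \<noteq> x)"
      obtain ann where "annular_space X ann"
        using annular_space_exists[OF metrizable countable] by blast
      then interpret annular_space X ann .
      have xX: "x \<in> topspace X" using x by (simp add: K_def)
      obtain N where N: "\<And>n. n \<ge> N \<Longrightarrow> ann x n \<subseteq> U" using ann_converge[OF U] by blast
      \<comment> \<open>A clopen neighbourhood of \<open>x\<close> inside \<open>U\<close>.\<close>
      define V where "V = topspace X - (\<Union>n\<in>{..<N}. ann x n)"
      have V: "clopenin X V"
        unfolding V_def using openin_ann[OF xX] closedin_ann[OF xX]
        by (intro clopenin_diff clopenin_topspace clopenin_UN_finite) (auto simp: clopenin_def)
      have "x \<in> V" using xX Union_ann[OF xX] by (auto simp: V_def)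
      have "V \<subseteq> U"
      proof
        fix y assume y: "y \<in> V"
        show "y \<in> U"
        proof (cases "y = x")
          case False
          then have "y \<in> (\<Union>n. ann x n)"
            unfolding Union_ann[OF xX] using y by (simp add: V_def)
          then obtain n where n: "y \<in> ann x n" by blast
          then have "n \<ge> N" using y by (auto simp: V_def not_less[symmetric])
          then show ?thesis using N n by blast
        qed (use U in simp)
      qed
      then have VG: "V - {x} \<subseteq> ?G"
        using isolated clopenin_subset[OF V] by (auto simp: K_def)
      have "good_piece X V"
        unfolding good_piece_def
      proof (intro conjI V allI impI)
        fix V' assume V': "clopenin X V' \<and> V' \<subseteq> V"
        show "finite V' \<or> self_absorbing (cfun (subtopology X V'))"
        proof (cases "x \<in> V'")
          case True
          then show ?thesis using V' VG by (intro clopen_with_one_bad_point[of _ x]) auto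
        next
          case False
          then show ?thesis using V' VG by (intro clopen_in_good_union) auto
        qed
      qed
      then have "x \<in> ?G" using \<open>x \<in> V\<close> by blast
      then show False using x by (simp add: K_def)
    qed
    then show ?thesis using \<open>closedin X K\<close> False by blast
  qed
qed

end

lemma cfun_discrete_prod:
  "cfun (prod_topology (discrete_topology UNIV) X) = dsum False (\<lambda>_ :: nat. cfun X)"
proof (intro equalityI subsetI)
  let ?P = "prod_topology (discrete_topology (UNIV :: nat set)) X"
  show "h \<in> dsum False (\<lambda>_. cfun X)" if h: "h \<in> cfun ?P" for h
  proof (rule dsumI)
    fix n
    have "continuous_map X ?P (\<lambda>x. (n, x))"
      by (simp add: continuous_map_pairwise comp_def)
    then show "(\<lambda>i. h (n, i)) \<in> cfun X"
      using continuous_map_compose[OF _ cfunD(1)[OF h]] cfunD(2)[OF h]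
      by (intro cfunI) (auto simp: comp_def)
  qed simp
  show "h \<in> cfun ?P" if h: "h \<in> dsum False (\<lambda>_. cfun X)" for h
  proof (rule cfunI)
    show "continuous_map ?P euclideanreal h"
    proof (rule continuous_map_nbhdI)
      fix nx U assume nx: "nx \<in> topspace ?P" and U: "openin euclideanreal U" "h nx \<in> U"
      obtain n x where [simp]: "nx = (n, x)" by (cases nx)
      let ?V = "{y \<in> topspace X. h (n, y) \<in> U}"
      have "openin X ?V"
        by (rule openin_continuous_map_preimage[OF cfunD(1)[OF dsumD(1)[OF h]] U(1)])
      then have "openin ?P ({n} \<times> ?V)"
        by (simp add: openin_prod_Times_iff)
      moreover have "nx \<in> {n} \<times> ?V" using nx U(2) by simp
      ultimately show "\<exists>O'. openin ?P O' \<and> nx \<in> O' \<and> (\<forall>y\<in>O'. h y \<in> U)" by blast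
    qed simp
    show "h nx = 0" if "nx \<notin> topspace ?P" for nx
      using that cfunD(2)[OF dsumD(1)[OF h]] by (cases nx) auto
  qed
qed

theorem cfun_square:
  assumes X: "metrizable_space X" "countable (topspace X)" "infinite (topspace X)"
  shows "cfun X \<simeq> cfun X \<oplus> cfun X"
proof -
  consider "self_absorbing (cfun X)"
    | K where "closedin X K" "K \<noteq> {}" "\<And>x U. x \<in> K \<Longrightarrow> openin X U \<Longrightarrow> x \<in> U \<Longrightarrow> \<exists>y\<in>K \<inter> U. y \<noteq> x"
    using crowded_kernel_or_self_absorbing[OF X] by blast
  then show ?thesis
  proof cases
    case 1
    then show ?thesis by (simp add: self_absorbing_def)
  next
    case (2 K)
    let ?P = "prod_topology (discrete_topology (UNIV :: nat set)) X"
    let ?E = "cfun X" and ?EN = "dsum False (\<lambda>_. cfun X)"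
    have P: "metrizable_space ?P" using X(1) by (simp add: metrizable_space_prod_topology)
    have P': "countable (topspace ?P)" "topspace ?P \<noteq> {}" using X(2,3) by auto
    obtain e r where er: "continuous_map ?P X e" "continuous_map X ?P r"
      "\<And>y. y \<in> topspace ?P \<Longrightarrow> r (e y) = y"
      using countable_retract_of_crowded[OF X(1,2) P P' 2] by blast
    define H where "H = {f \<in> cfun X. \<forall>y\<in>topspace ?P. f (e y) = 0}"
    have E: "?E \<simeq> ?EN \<oplus> H"
      using cfun_split_retract[OF er] by (simp add: cfun_discrete_prod H_def)
    have "?E \<oplus> ?E \<simeq> ?E \<oplus> (?EN \<oplus> H)" by (rule dsum2_right_cong[OF E])
    also have "\<dots> \<simeq> (?E \<oplus> ?EN) \<oplus> H" by (rule almost_isometric_sym[OF dsum2_assoc])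
    also have "\<dots> \<simeq> ?EN \<oplus> H"
      by (rule dsum2_left_cong[OF almost_isometric_sym[OF dsum_split_first]])
    also have "\<dots> \<simeq> ?E" by (rule almost_isometric_sym[OF E])
    finally show ?thesis by (rule almost_isometric_sym)
  qed
qed

section \<open>Transfer to the spaces of continuous functions\<close>

lemma pointwise_ucont_finite:
  assumes u: "pointwise_ucont C u" and "finite J" "\<epsilon> > 0"
  shows "\<exists>I \<delta>. finite I \<and> \<delta> > 0 \<and>
    (\<forall>f\<in>C. \<forall>g\<in>C. (\<forall>i\<in>I. \<bar>f i - g i\<bar> < \<delta>) \<longrightarrow> (\<forall>j\<in>J. \<bar>u f j - u g j\<bar> < \<epsilon>))"
  using assms(2)
proof induction
  case empty
  show ?case by (intro exI[of _ "{}"] exI[of _ 1]) simp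
next
  case (insert a J)
  obtain I \<delta> where I: "finite I" "\<delta> > 0"
    "\<forall>f\<in>C. \<forall>g\<in>C. (\<forall>i\<in>I. \<bar>f i - g i\<bar> < \<delta>) \<longrightarrow> (\<forall>j\<in>J. \<bar>u f j - u g j\<bar> < \<epsilon>)"
    using insert.IH by blast
  obtain K \<eta> where K: "finite K" "\<eta> > 0"
    "\<forall>f\<in>C. \<forall>g\<in>C. (\<forall>i\<in>K. \<bar>f i - g i\<bar> < \<eta>) \<longrightarrow> \<bar>u f a - u g a\<bar> < \<epsilon>"
    using pointwise_ucontD[OF u \<open>\<epsilon> > 0\<close>, of a] by blast
  show ?case
  proof (intro exI[of _ "I \<union> K"] exI[of _ "min \<delta> \<eta>"] conjI ballI impI)
    fix f g j
    assume fg: "f \<in> C" "g \<in> C" and d: "\<forall>i\<in>I \<union> K. \<bar>f i - g i\<bar> < min \<delta> \<eta>" and j: "j \<in> insert a J"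
    have "\<forall>i\<in>I. \<bar>f i - g i\<bar> < \<delta>" "\<forall>i\<in>K. \<bar>f i - g i\<bar> < \<eta>" using d by auto
    then show "\<bar>u f j - u g j\<bar> < \<epsilon>" using I(3) K(3) fg j by blast
  qed (use I K in auto)
qed

lemma restrict_in_Cp:
  assumes "f \<in> cfun X"
  shows "restrict f (topspace X) \<in> lts_carrier (Cp X)"
  using cfunD(1)[OF assms] by (simp add: lts_carrier_Cp continuous_map_restrict_iff)

lemma cut_in_cfun_Cp:
  assumes "f \<in> lts_carrier (Cp X)"
  shows "cut (topspace X) f \<in> cfun X"
proof (rule cfunI)
  have "continuous_map X euclideanreal f" using assms by (simp add: lts_carrier_Cp)
  then show "continuous_map X euclideanreal (cut (topspace X) f)"
    by (rule continuous_map_eq) simp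
qed simp

lemma restrict_cut_Cp: "f \<in> lts_carrier (Cp X) \<Longrightarrow> restrict (cut (topspace X) f) (topspace X) = f"
  by (auto simp: lts_carrier_Cp fun_eq_iff extensional_def)

lemma cut_restrict_cfun: "f \<in> cfun X \<Longrightarrow> cut (topspace X) (restrict f (topspace X)) = f"
  by (auto simp: cfun_def fun_eq_iff cut_def)

lemma cfun_scale: "f \<in> cfun X \<Longrightarrow> (\<lambda>x. a * f x) \<in> cfun X"
  by (auto simp: cfun_def intro!: continuous_intros)

lemma lts_minus_Cp:
  "lts_minus (Cp X) f g = restrict (\<lambda>x. f x - g x) (topspace X)"
  by (auto simp: lts_minus_def Cp_def fun_eq_iff)

lemma lts_minus_Cp_closed:
  assumes "f \<in> lts_carrier (Cp X)" "g \<in> lts_carrier (Cp X)"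
  shows "lts_minus (Cp X) f g \<in> lts_carrier (Cp X)"
  using assms unfolding lts_minus_Cp lts_carrier_Cp
  by (auto simp: continuous_map_restrict_iff intro!: continuous_intros)

text \<open>The basic neighbourhoods of zero.\<close>

definition small_on :: "'a topology \<Rightarrow> 'a set \<Rightarrow> real \<Rightarrow> ('a \<Rightarrow> real) set"
  where "small_on X F \<delta> = {f \<in> lts_carrier (Cp X). \<forall>x\<in>F. \<bar>f x\<bar> < \<delta>}"

lemma lts_minus_in_small_on_iff:
  assumes "f \<in> lts_carrier (Cp X)" "g \<in> lts_carrier (Cp X)" "F \<subseteq> topspace X"
  shows "lts_minus (Cp X) f g \<in> small_on X F \<delta> \<longleftrightarrow> (\<forall>x\<in>F. \<bar>f x - g x\<bar> < \<delta>)"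
  using lts_minus_Cp_closed[OF assms(1,2)] assms(3) by (auto simp: small_on_def lts_minus_Cp)

lemma Cp_nhd_zero:
  assumes U: "openin (lts_top (Cp X)) U" "lts_zero (Cp X) \<in> U"
  shows "\<exists>F \<delta>. finite F \<and> F \<subseteq> topspace X \<and> \<delta> > 0 \<and> small_on X F \<delta> \<subseteq> U"
proof -
  let ?X = "topspace X"
  obtain T where T: "openin (product_topology (\<lambda>_. euclideanreal) ?X) T"
    "U = T \<inter> {f. continuous_map X euclideanreal f}"
    using U(1) by (auto simp: Cp_def openin_subtopology)
  have "(\<lambda>x\<in>?X. 0) \<in> T" using U(2) T(2) by (simp add: Cp_def)
  then obtain S where S: "finite {i \<in> ?X. S i \<noteq> topspace euclideanreal}"
    "\<And>i. i \<in> ?X \<Longrightarrow> openin euclideanreal (S i)" "(\<lambda>x\<in>?X. 0) \<in> Pi\<^sub>E ?X S" "Pi\<^sub>E ?X S \<subseteq> T"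
    using T(1) unfolding openin_product_topology_alt by meson
  define F where "F = {i \<in> ?X. S i \<noteq> topspace euclideanreal}"
  have "\<exists>e>0. ball 0 e \<subseteq> S i" if "i \<in> F" for i
  proof -
    have i: "i \<in> ?X" using that by (simp add: F_def)
    have "open (S i)" using S(2)[OF i] by simp
    moreover have "0 \<in> S i" using S(3) i by (auto simp: PiE_iff)
    ultimately show ?thesis by (simp add: open_contains_ball)
  qed
  then obtain e where e: "\<And>i. i \<in> F \<Longrightarrow> e i > (0::real)" "\<And>i. i \<in> F \<Longrightarrow> ball 0 (e i) \<subseteq> S i"
    by metis
  define \<delta> where "\<delta> = Min (insert 1 (e ` F))"
  have fin: "finite F" using S(1) by (simp add: F_def)
  have \<delta>: "\<delta> > 0" "\<And>i. i \<in> F \<Longrightarrow> \<delta> \<le> e i"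
    using fin e(1) by (auto simp: \<delta>_def)
  have "f \<in> U" if f: "f \<in> lts_carrier (Cp X)" and small: "\<forall>x\<in>F. \<bar>f x\<bar> < \<delta>" for f
  proof -
    have "f i \<in> S i" if i: "i \<in> ?X" for i
    proof (cases "i \<in> F")
      case True
      then have "\<bar>f i\<bar> < e i" using small \<delta>(2)[OF True] by force
      then show ?thesis using e(2)[OF True] by (auto simp: subset_iff)
    next
      case False
      then show ?thesis using i by (simp add: F_def)
    qed
    then have "f \<in> Pi\<^sub>E ?X S" using f by (auto simp: lts_carrier_Cp PiE_iff)
    then show ?thesis using S(4) T(2) f by (auto simp: lts_carrier_Cp)
  qed
  then have "small_on X F \<delta> \<subseteq> U" by (auto simp: small_on_def)
  moreover have "F \<subseteq> topspace X" by (auto simp: F_def)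
  ultimately show ?thesis using fin \<delta>(1) by blast
qed

lemma small_on_nhd:
  assumes "finite F" "F \<subseteq> topspace X" "\<delta> > 0"
  shows "openin (lts_top (Cp X)) (small_on X F \<delta>)" "lts_zero (Cp X) \<in> small_on X F \<delta>"
proof -
  let ?S = "\<lambda>x. if x \<in> F then {-\<delta><..<\<delta>} else UNIV :: real set"
  have "finite {i \<in> topspace X. ?S i \<noteq> topspace euclideanreal}"
    using assms(1) by (rule finite_subset[rotated]) auto
  then have "openin (product_topology (\<lambda>_. euclideanreal) (topspace X)) (Pi\<^sub>E (topspace X) ?S)"
    by (auto simp: openin_PiE_gen)
  moreover have "small_on X F \<delta> = Pi\<^sub>E (topspace X) ?S \<inter> {f. continuous_map X euclideanreal f}"
  proof (intro equalityI subsetI)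
    fix f assume f: "f \<in> small_on X F \<delta>"
    then have "- \<delta> < f x \<and> f x < \<delta>" if "x \<in> F" for x
      using that by (auto simp: small_on_def abs_less_iff)
    then show "f \<in> Pi\<^sub>E (topspace X) ?S \<inter> {f. continuous_map X euclideanreal f}"
      using f by (simp add: small_on_def lts_carrier_Cp PiE_iff)
  next
    fix f assume f: "f \<in> Pi\<^sub>E (topspace X) ?S \<inter> {f. continuous_map X euclideanreal f}"
    have "\<bar>f x\<bar> < \<delta>" if "x \<in> F" for x
    proof -
      have "x \<in> topspace X" using that assms(2) by blast
      then have "f x \<in> ?S x" using PiE_mem[of f _ ?S x] f by blast
      then show ?thesis using that by auto
    qed
    then show "f \<in> small_on X F \<delta>"
      using f by (simp add: small_on_def lts_carrier_Cp PiE_iff)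
  qed
  ultimately show "openin (lts_top (Cp X)) (small_on X F \<delta>)"
    by (auto simp: Cp_def openin_subtopology)
  show "lts_zero (Cp X) \<in> small_on X F \<delta>"
    using ext_normed_lts.zero_closed[OF ext_normed_lts_Cp, of X] assms
    by (auto simp: small_on_def Cp_def)
qed

lemma Cp_prod_nhd_zero:
  assumes U: "openin (lts_top (lts_prod (Cp Y) (Cp Z))) U" "lts_zero (lts_prod (Cp Y) (Cp Z)) \<in> U"
  shows "\<exists>F G \<delta>. finite F \<and> F \<subseteq> topspace Y \<and> finite G \<and> G \<subseteq> topspace Z \<and> \<delta> > 0 \<and>
    small_on Y F \<delta> \<times> small_on Z G \<delta> \<subseteq> U"
proof -
  have "openin (prod_topology (lts_top (Cp Y)) (lts_top (Cp Z))) U"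
    "(lts_zero (Cp Y), lts_zero (Cp Z)) \<in> U"
    using U by (simp_all add: lts_prod_def)
  then have "\<exists>U1 U2. openin (lts_top (Cp Y)) U1 \<and> openin (lts_top (Cp Z)) U2 \<and>
      lts_zero (Cp Y) \<in> U1 \<and> lts_zero (Cp Z) \<in> U2 \<and> U1 \<times> U2 \<subseteq> U"
    unfolding openin_prod_topology_alt by simp
  then obtain U1 U2 where O: "openin (lts_top (Cp Y)) U1" "openin (lts_top (Cp Z)) U2"
    "lts_zero (Cp Y) \<in> U1" "lts_zero (Cp Z) \<in> U2" "U1 \<times> U2 \<subseteq> U"
    by blast
  obtain F \<delta>1 where F: "finite F" "F \<subseteq> topspace Y" "\<delta>1 > 0" "small_on Y F \<delta>1 \<subseteq> U1"
    using Cp_nhd_zero[OF O(1,3)] by blast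
  obtain G \<delta>2 where G: "finite G" "G \<subseteq> topspace Z" "\<delta>2 > 0" "small_on Z G \<delta>2 \<subseteq> U2"
    using Cp_nhd_zero[OF O(2,4)] by blast
  have "small_on Y F (min \<delta>1 \<delta>2) \<subseteq> small_on Y F \<delta>1" "small_on Z G (min \<delta>1 \<delta>2) \<subseteq> small_on Z G \<delta>2"
    by (auto simp: small_on_def)
  then have "small_on Y F (min \<delta>1 \<delta>2) \<times> small_on Z G (min \<delta>1 \<delta>2) \<subseteq> U"
    using F(4) G(4) O(5) by blast
  then show ?thesis
    using F G by (intro exI[of _ F] exI[of _ G] exI[of _ "min \<delta>1 \<delta>2"]) simp
qed

lemma small_on_prod_nhd:
  assumes "finite F" "F \<subseteq> topspace Y" "finite G" "G \<subseteq> topspace Z" "\<delta> > 0"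
  shows "openin (lts_top (lts_prod (Cp Y) (Cp Z))) (small_on Y F \<delta> \<times> small_on Z G \<delta>)"
    "lts_zero (lts_prod (Cp Y) (Cp Z)) \<in> small_on Y F \<delta> \<times> small_on Z G \<delta>"
  using small_on_nhd[OF assms(1,2,5)] small_on_nhd[OF assms(3,4,5)]
  by (simp_all add: lts_prod_def openin_prod_Times_iff)

lemma lts_minus_prod:
  "lts_minus (lts_prod E F) p q = (lts_minus E (fst p) (fst q), lts_minus F (snd p) (snd q))"
  by (simp add: lts_minus_def lts_prod_def case_prod_unfold)

lemma lts_carrier_prod: "lts_carrier (lts_prod E F) = lts_carrier E \<times> lts_carrier F"
  by (simp add: lts_prod_def)

lemma lts_minus_prod_in_small_on_iff:
  assumes "p \<in> lts_carrier (lts_prod (Cp Y) (Cp Z))" "q \<in> lts_carrier (lts_prod (Cp Y) (Cp Z))"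
    and "F \<subseteq> topspace Y" "G \<subseteq> topspace Z"
  shows "lts_minus (lts_prod (Cp Y) (Cp Z)) p q \<in> small_on Y F \<delta> \<times> small_on Z G \<delta> \<longleftrightarrow>
    (\<forall>y\<in>F. \<bar>fst p y - fst q y\<bar> < \<delta>) \<and> (\<forall>z\<in>G. \<bar>snd p z - snd q z\<bar> < \<delta>)"
  using assms by (auto simp: lts_minus_prod lts_carrier_prod mem_Times_iff lts_minus_in_small_on_iff)

lemma lts_norm_Cp_le_iff:
  assumes "M \<ge> 0"
  shows "lts_norm (Cp X) f \<le> ennreal M \<longleftrightarrow> (\<forall>x\<in>topspace X. \<bar>f x\<bar> \<le> M)"
  using assms by (simp add: Cp_def SUP_le_iff)

text \<open>Pass between extension by zero and extension by \<^const>\<open>undefined\<close>. The two-sided estimate with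
  factor \<open>c\<close> becomes the one-sided estimate of the definition after division by \<open>c\<close>, with \<open>c\<^sup>2 = 1 + \<epsilon>\<close>.\<close>

lemma bumpeq_of_almost_isometric:
  assumes "cfun X \<simeq> cfun Y \<oplus> cfun Z"
  shows "Cp X \<bumpeq> lts_prod (Cp Y) (Cp Z)"
  unfolding lts_bumpeq_def
proof (intro allI impI)
  fix \<epsilon> :: real assume \<epsilon>: "\<epsilon> > 0"
  define c where "c = sqrt (1 + \<epsilon>)"
  have c: "c > 1" "c * c = 1 + \<epsilon>" using \<epsilon> by (simp_all add: c_def)
  obtain u v where "near_isometry c (cfun X) (cfun Y \<oplus> cfun Z) u v"
    using assms c(1) by (rule almost_isometricE)
  then have uD: "\<And>f. f \<in> cfun X \<Longrightarrow> u f \<in> cfun Y \<oplus> cfun Z"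
    and vD: "\<And>h. h \<in> cfun Y \<oplus> cfun Z \<Longrightarrow> v h \<in> cfun X"
    and vu: "\<And>f. f \<in> cfun X \<Longrightarrow> v (u f) = f"
    and uv: "\<And>h. h \<in> cfun Y \<oplus> cfun Z \<Longrightarrow> u (v h) = h"
    and cont: "pointwise_ucont (cfun X) u" "pointwise_ucont (cfun Y \<oplus> cfun Z) v"
    and bound: "sup_bounded c (cfun X) u" "sup_bounded c (cfun Y \<oplus> cfun Z) v"
    by (auto simp: near_isometry_def)
  let ?E = "Cp X" and ?F = "lts_prod (Cp Y) (Cp Z)"
  define ux where "ux f = u (cut (topspace X) f)" for f
  define U where "U f = (restrict (\<lambda>y. ux f (Inl y) / c) (topspace Y),
    restrict (\<lambda>z. ux f (Inr z) / c) (topspace Z))" for f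
  define glue where "glue g = case_sum (\<lambda>y. c * cut (topspace Y) (fst g) y) (\<lambda>z. c * cut (topspace Z) (snd g) z)"
    for g :: "('b \<Rightarrow> real) \<times> ('c \<Rightarrow> real)"
  define V where "V g = restrict (v (glue g)) (topspace X)" for g
  have ux: "ux f \<in> cfun Y \<oplus> cfun Z" if "f \<in> lts_carrier ?E" for f
    unfolding ux_def by (rule uD[OF cut_in_cfun_Cp[OF that]])
  have ux': "(\<lambda>y. ux f (Inl y)) \<in> cfun Y" "(\<lambda>z. ux f (Inr z)) \<in> cfun Z" if "f \<in> lts_carrier ?E" for f
    using ux[OF that] by (simp_all add: dsum2_def comp_def)
  have U: "U f \<in> lts_carrier ?F" if "f \<in> lts_carrier ?E" for f
    unfolding lts_carrier_prod U_def
    using restrict_in_Cp[OF cfun_scale[OF ux'(1)[OF that], of "1 / c"]]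
      restrict_in_Cp[OF cfun_scale[OF ux'(2)[OF that], of "1 / c"]] by simp
  have glue: "glue g \<in> cfun Y \<oplus> cfun Z" if "g \<in> lts_carrier ?F" for g
    unfolding glue_def case_sum_in_dsum2_iff using that
    by (intro conjI cfun_scale cut_in_cfun_Cp) (auto simp: lts_carrier_prod)
  have V: "V g \<in> lts_carrier ?E" if "g \<in> lts_carrier ?F" for g
    unfolding V_def by (rule restrict_in_Cp[OF vD[OF glue[OF that]]])
  have glue_U: "glue (U f) = ux f" if "f \<in> lts_carrier ?E" for f
    using cfunD(2)[OF ux'(1)[OF that]] cfunD(2)[OF ux'(2)[OF that]] c(1)
    by (auto simp: glue_def U_def cut_def fun_eq_iff split: sum.split)
  have VU: "V (U f) = f" if "f \<in> lts_carrier ?E" for f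
    unfolding V_def glue_U[OF that] ux_def vu[OF cut_in_cfun_Cp[OF that]]
    by (rule restrict_cut_Cp[OF that])
  have UV: "U (V g) = g" if g: "g \<in> lts_carrier ?F" for g
  proof -
    have "ux (V g) = glue g"
      unfolding ux_def V_def cut_restrict_cfun[OF vD[OF glue[OF g]]] by (rule uv[OF glue[OF g]])
    then show ?thesis
      using g c(1) by (cases g)
        (auto simp: U_def glue_def lts_carrier_prod lts_carrier_Cp fun_eq_iff extensional_def restrict_def)
  qed
  have bij: "bij_betw U (lts_carrier ?E) (lts_carrier ?F)"
    by (rule bij_betw_byWitness[of _ V]) (use U V UV VU in auto)
  have inv: "inv_into (lts_carrier ?E) U g = V g" if "g \<in> lts_carrier ?F" for g
    by (rule inv_into_f_eq) (use bij V[OF that] UV[OF that] in \<open>auto simp: bij_betw_def\<close>)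
  have "lts_uniformly_continuous ?E ?F U"
    unfolding lts_uniformly_continuous_def
  proof (intro conjI allI impI)
    show "U \<in> lts_carrier ?E \<rightarrow> lts_carrier ?F" by (rule Pi_I, rule U)
    fix N assume "openin (lts_top ?F) N \<and> lts_zero ?F \<in> N"
    then obtain F G \<delta> where FG: "finite F" "F \<subseteq> topspace Y" "finite G" "G \<subseteq> topspace Z" "\<delta> > 0"
      and N: "small_on Y F \<delta> \<times> small_on Z G \<delta> \<subseteq> N"
      using Cp_prod_nhd_zero[of Y Z N] by auto
    have "finite (Inl ` F \<union> Inr ` G)" using FG by simp
    from pointwise_ucont_finite[OF cont(1) this \<open>\<delta> > 0\<close>] obtain I \<eta> where I: "finite I" "\<eta> > 0"
      and close: "\<forall>f\<in>cfun X. \<forall>g\<in>cfun X. (\<forall>i\<in>I. \<bar>f i - g i\<bar> < \<eta>) \<longrightarrow>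
        (\<forall>j\<in>Inl ` F \<union> Inr ` G. \<bar>u f j - u g j\<bar> < \<delta>)"
      by auto
    show "\<exists>N'. openin (lts_top ?E) N' \<and> lts_zero ?E \<in> N' \<and>
        (\<forall>f\<in>lts_carrier ?E. \<forall>g\<in>lts_carrier ?E. lts_minus ?E f g \<in> N' \<longrightarrow> lts_minus ?F (U f) (U g) \<in> N)"
    proof (intro exI conjI ballI impI)
      let ?N = "small_on X (I \<inter> topspace X) \<eta>"
      show "openin (lts_top ?E) ?N" "lts_zero ?E \<in> ?N"
        using small_on_nhd[of "I \<inter> topspace X" X \<eta>] I by auto
      fix f g assume fg: "f \<in> lts_carrier ?E" "g \<in> lts_carrier ?E" and "lts_minus ?E f g \<in> ?N"
      then have "\<forall>x\<in>I \<inter> topspace X. \<bar>f x - g x\<bar> < \<eta>"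
        using lts_minus_in_small_on_iff[OF fg] by blast
      then have "\<forall>i\<in>I. \<bar>cut (topspace X) f i - cut (topspace X) g i\<bar> < \<eta>"
        using I(2) by (simp add: cut_def)
      then have *: "\<forall>j\<in>Inl ` F \<union> Inr ` G. \<bar>ux f j - ux g j\<bar> < \<delta>"
        using close[THEN bspec, OF cut_in_cfun_Cp[OF fg(1)], THEN bspec, OF cut_in_cfun_Cp[OF fg(2)]]
        unfolding ux_def by (rule_tac mp)
      then have ux_close: "\<bar>ux f (Inl y) - ux g (Inl y)\<bar> < \<delta>" if "y \<in> F" for y
        using that by simp
      have ux_close': "\<bar>ux f (Inr z) - ux g (Inr z)\<bar> < \<delta>" if "z \<in> G" for z
        using * that by simp
      have shrink: "\<bar>a / c - b / c\<bar> < \<delta>" if "\<bar>a - b\<bar> < \<delta>" for a b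
      proof -
        have "\<bar>a / c - b / c\<bar> = \<bar>a - b\<bar> / c" using c(1) by (simp flip: diff_divide_distrib)
        also have "\<dots> \<le> \<bar>a - b\<bar> / 1" using c(1) by (intro divide_left_mono) auto
        finally show ?thesis using that by simp
      qed
      have "lts_minus ?F (U f) (U g) \<in> small_on Y F \<delta> \<times> small_on Z G \<delta>"
        unfolding lts_minus_prod_in_small_on_iff[OF U[OF fg(1)] U[OF fg(2)] FG(2,4)]
        using FG(2,4) by (auto simp: U_def subset_iff intro!: shrink ux_close ux_close')
      then show "lts_minus ?F (U f) (U g) \<in> N" by (rule subsetD[OF N])
    qed
  qed
  moreover have "lts_uniformly_continuous ?F ?E (inv_into (lts_carrier ?E) U)"
    unfolding lts_uniformly_continuous_def
  proof (intro conjI allI impI)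
    show "inv_into (lts_carrier ?E) U \<in> lts_carrier ?F \<rightarrow> lts_carrier ?E"
      by (rule Pi_I) (simp add: inv V)
    fix N assume "openin (lts_top ?E) N \<and> lts_zero ?E \<in> N"
    then obtain F \<delta> where F: "finite F" "F \<subseteq> topspace X" "\<delta> > 0" and N: "small_on X F \<delta> \<subseteq> N"
      using Cp_nhd_zero[of X N] by auto
    from pointwise_ucont_finite[OF cont(2) F(1,3)] obtain I \<eta> where I: "finite I" "\<eta> > 0"
      and close: "\<forall>f\<in>cfun Y \<oplus> cfun Z. \<forall>g\<in>cfun Y \<oplus> cfun Z.
        (\<forall>i\<in>I. \<bar>f i - g i\<bar> < \<eta>) \<longrightarrow> (\<forall>j\<in>F. \<bar>v f j - v g j\<bar> < \<delta>)"
      by auto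
    define IY where "IY = Inl -` I \<inter> topspace Y"
    define IZ where "IZ = Inr -` I \<inter> topspace Z"
    have IYZ: "finite IY" "IY \<subseteq> topspace Y" "finite IZ" "IZ \<subseteq> topspace Z"
      using I(1) by (auto simp: IY_def IZ_def finite_vimageI)
    have "\<eta> / c > 0" using I(2) c(1) by simp
    show "\<exists>N'. openin (lts_top ?F) N' \<and> lts_zero ?F \<in> N' \<and>
        (\<forall>p\<in>lts_carrier ?F. \<forall>q\<in>lts_carrier ?F. lts_minus ?F p q \<in> N' \<longrightarrow>
          lts_minus ?E (inv_into (lts_carrier ?E) U p) (inv_into (lts_carrier ?E) U q) \<in> N)"
    proof (intro exI conjI ballI impI)
      let ?N = "small_on Y IY (\<eta> / c) \<times> small_on Z IZ (\<eta> / c)"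
      show "openin (lts_top ?F) ?N" "lts_zero ?F \<in> ?N"
        by (rule small_on_prod_nhd[OF IYZ \<open>\<eta> / c > 0\<close>])+
      fix p q assume pq: "p \<in> lts_carrier ?F" "q \<in> lts_carrier ?F" and d: "lts_minus ?F p q \<in> ?N"
      have small: "\<forall>y\<in>IY. \<bar>fst p y - fst q y\<bar> < \<eta> / c" "\<forall>z\<in>IZ. \<bar>snd p z - snd q z\<bar> < \<eta> / c"
        using iffD1[OF lts_minus_prod_in_small_on_iff[OF pq IYZ(2,4)] d] by simp_all
      have stretch: "\<bar>c * a - c * b\<bar> < \<eta>" if "\<bar>a - b\<bar> < \<eta> / c" for a b
      proof -
        have "\<bar>c * a - c * b\<bar> = c * \<bar>a - b\<bar>"
          using c(1) by (simp add: abs_mult flip: right_diff_distrib)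
        also have "\<dots> < c * (\<eta> / c)" by (rule mult_strict_left_mono[OF that]) (use c(1) in simp)
        finally show ?thesis using c(1) by simp
      qed
      have "\<forall>i\<in>I. \<bar>glue p i - glue q i\<bar> < \<eta>"
      proof
        fix i assume i: "i \<in> I"
        show "\<bar>glue p i - glue q i\<bar> < \<eta>"
        proof (cases i)
          case (Inl y)
          show ?thesis
          proof (cases "y \<in> topspace Y")
            case True
            then have "y \<in> IY" using i Inl by (simp add: IY_def)
            then show ?thesis using True small(1) stretch by (simp add: Inl glue_def)
          qed (use I(2) in \<open>simp add: Inl glue_def\<close>)
        next
          case (Inr z)
          show ?thesis
          proof (cases "z \<in> topspace Z")
            case True
            then have "z \<in> IZ" using i Inr by (simp add: IZ_def)
            then show ?thesis using True small(2) stretch by (simp add: Inr glue_def)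
          qed (use I(2) in \<open>simp add: Inr glue_def\<close>)
        qed
      qed
      then have "\<forall>x\<in>F. \<bar>v (glue p) x - v (glue q) x\<bar> < \<delta>"
        using close[THEN bspec, OF glue[OF pq(1)], THEN bspec, OF glue[OF pq(2)]] by (rule_tac mp)
      then have "\<forall>x\<in>F. \<bar>V p x - V q x\<bar> < \<delta>"
        using F(2) by (simp add: V_def subset_iff)
      then have "lts_minus ?E (V p) (V q) \<in> small_on X F \<delta>"
        using lts_minus_in_small_on_iff[OF V[OF pq(1)] V[OF pq(2)] F(2)] by blast
      then show "lts_minus ?E (inv_into (lts_carrier ?E) U p) (inv_into (lts_carrier ?E) U q) \<in> N"
        unfolding inv[OF pq(1)] inv[OF pq(2)] by (rule subsetD[OF N])
    qed
  qed
  moreover have "lts_norm ?F (U f) \<le> lts_norm ?E f" if f: "f \<in> lts_carrier ?E" for f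
  proof (cases "lts_norm ?E f")
    case (real M)
    then have "\<forall>x\<in>topspace X. \<bar>f x\<bar> \<le> M"
      using lts_norm_Cp_le_iff[of M X f] by simp
    then have "\<bar>cut (topspace X) f i\<bar> \<le> M" for i
      using real(1) by (simp add: cut_def)
    then have "\<bar>ux f j\<bar> \<le> c * M" for j
      unfolding ux_def by (rule sup_boundedD[OF bound(1) cut_in_cfun_Cp[OF f]])
    then have "\<bar>ux f j / c\<bar> \<le> M" for j
      using c(1) by (simp add: divide_le_eq mult.commute)
    then have "lts_norm (Cp Y) (fst (U f)) \<le> ennreal M" "lts_norm (Cp Z) (snd (U f)) \<le> ennreal M"
      unfolding lts_norm_Cp_le_iff[OF real(1)] by (simp_all add: U_def)
    then show ?thesis
      unfolding real(2) by (simp add: lts_prod_def case_prod_unfold)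
  qed simp
  moreover have "ennreal (inverse (1 + \<epsilon>)) * lts_norm ?E f \<le> lts_norm ?F (U f)"
    if f: "f \<in> lts_carrier ?E" for f
  proof (cases "lts_norm ?F (U f)")
    case (real M)
    then have "lts_norm (Cp Y) (fst (U f)) \<le> ennreal M" "lts_norm (Cp Z) (snd (U f)) \<le> ennreal M"
      by (simp_all add: lts_prod_def case_prod_unfold flip: real(2))
    then have small: "\<forall>y\<in>topspace Y. \<bar>fst (U f) y\<bar> \<le> M" "\<forall>z\<in>topspace Z. \<bar>snd (U f) z\<bar> \<le> M"
      unfolding lts_norm_Cp_le_iff[OF real(1)] by blast+
    have "\<bar>glue (U f) j\<bar> \<le> c * M" for j
      using small c(1) real(1) by (cases j) (auto simp: glue_def cut_def abs_mult)
    then have "\<bar>v (glue (U f)) x\<bar> \<le> c * (c * M)" for x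
      by (rule sup_boundedD[OF bound(2) glue[OF U[OF f]]])
    then have "\<bar>V (U f) x\<bar> \<le> (1 + \<epsilon>) * M" if "x \<in> topspace X" for x
      using that by (simp add: V_def mult.assoc flip: c(2))
    then have "\<forall>x\<in>topspace X. \<bar>f x\<bar> \<le> (1 + \<epsilon>) * M"
      by (simp add: VU[OF f])
    then have "lts_norm ?E f \<le> ennreal ((1 + \<epsilon>) * M)"
      using lts_norm_Cp_le_iff[of "(1 + \<epsilon>) * M" X f] \<epsilon> real(1) by simp
    then have "ennreal (inverse (1 + \<epsilon>)) * lts_norm ?E f \<le> ennreal (inverse (1 + \<epsilon>)) * ennreal ((1 + \<epsilon>) * M)"
      by (rule mult_left_mono) simp
    also have "\<dots> = ennreal (inverse (1 + \<epsilon>) * ((1 + \<epsilon>) * M))"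
      using \<epsilon> real(1) by (subst ennreal_mult) auto
    also have "inverse (1 + \<epsilon>) * ((1 + \<epsilon>) * M) = M"
      using \<epsilon> by simp
    finally show ?thesis unfolding real(2) .
  qed simp
  ultimately show "\<exists>u. lts_uniform_homeomorphism ?E ?F u \<and> (\<forall>f\<in>lts_carrier ?E.
      ennreal (inverse (1 + \<epsilon>)) * lts_norm ?E f \<le> lts_norm ?F (u f) \<and> lts_norm ?F (u f) \<le> lts_norm ?E f)"
    using bij unfolding lts_uniform_homeomorphism_def by blast
qed

theorem corollary6p6:
  fixes X :: "'a topology"
  assumes "metrizable_space X"
    and "countable (topspace X)"
    and "infinite (topspace X)"
  shows "Cp X \<bumpeq> lts_prod (Cp X) (Cp X) \<and>
    lts_uniformly_homeomorphic (Cp X) (lts_prod (Cp X) (Cp X))"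
proof -
  have bumpeq: "Cp X \<bumpeq> lts_prod (Cp X) (Cp X)"
    by (rule bumpeq_of_almost_isometric[OF cfun_square[OF assms]])
  then have "lts_uniformly_homeomorphic (Cp X) (lts_prod (Cp X) (Cp X))"
    unfolding lts_bumpeq_def lts_uniformly_homeomorphic_def using zero_less_one by blast
  with bumpeq show ?thesis ..
qed

end
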